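(* There exist constants $C>0$ and $\delta_0>0$ such that for all $0<\delta<\delta_0$ the first real transmission eigenvalue $\lambda^1_\delta$ satisfies $$\left|\lambda^1_\delta-\lambda_0\right|\le C\delta,$$ where $\lambda_0$ is the first Dirichlet eigenvalue of $-\Delta$ in $\Omega$.
   Context: Setting. $\Omega\subset\mathbb R^2$ is a bounded, simply connected domain with $C^\infty$ boundary $\Gamma$. For small $\delta>0$, $\Omega_\delta=\{x\in\Omega: d(x,\Gamma)>\delta\}$, $\Gamma_\delta=\{x\in\Omega: d(x,\Gamma)=\delta\}$, and the thin layer is $\Omega\setminus\overline{\Omega_\delta}$ (constant thickness $\delta$). $\nu$ is the unit normal to $\Gamma$ directed into $\Omega$. The refractive index $n$ is a fixed real function, $C^\infty$ on $\overline\Omega\setminus\Omega_{\delta_*}$ for some fixed $\delta_*>0$ (only $0<\delta\le\delta_*$ is considered), with constants $0<n_*<n(x)<n^*<1$. Transmission eigenvalues. $\lambda=k^2>0$ is a transmission eigenvalue if there is a nontrivial $(w,v)\in L^2(\Omega\setminus\overline{\Omega_\delta})\times L^2(\Omega)$ with $\Delta w+\lambda n w=0$ in $\Omega\setminus\overline{\Omega_\delta}$, $\Delta v+\lambda v=0$ in $\Omega$, $v=w$ and $\partial v/\partial\nu=\partial w/\partial\nu$ on $\Gamma$, $w=0$ on $\Gamma_\delta$. The precise (equivalent) meaning is variational: set $u=w-v$ in $\Omega\setminus\overline{\Omega_\delta}$, $u=-v$ in $\Omega_\delta$; then $u$ is a nonzero element of $$W_\delta=\{u\in H^1_0(\Omega):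 \Delta u\in L^2(\Omega\setminus\overline{\Omega_\delta}),\ \partial u/\partial\nu=0\text{ on }\Gamma\}$$ (here $\Delta u$ is taken in the layer) satisfying, for all $\psi\in W_\delta$, $$\int_{\Omega\setminus\overline{\Omega_\delta}}\frac{1}{1-n}(\Delta u+\lambda u)(\Delta\overline\psi+\lambda\overline\psi)\,dx+\lambda^2\int_\Omega u\overline\psi\,dx+\lambda\int_\Omega\nabla u\cdot\nabla\overline\psi\,dx=2\lambda^2\int_\Omega u\overline\psi\,dx .$$ Conversely $w=\frac{1}{\lambda(1-n)}(\Delta u+\lambda u)$ in the layer, $v=-u$ in $\Omega_\delta$, $v=\frac1{\lambda(1-n)}(\Delta u+\lambda n u)$ in the layer. Transmission eigenvalues exist and are discrete with only accumulation point $+\infty$; $\lambda^1_\delta$ denotes the smallest (real, positive) one. *)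

theory Defs
  imports "HOL-Analysis.Analysis"
begin

section \<open>Smooth functions, smooth boundaries, test functions\<close>

text \<open>Meant for open sets only. Requiring differentiability at every order makes the iterated
  Frechet derivatives below genuine derivatives.\<close>

fun Ck_on :: "nat \<Rightarrow> 'a::euclidean_space set \<Rightarrow> ('a \<Rightarrow> 'b::real_normed_vector) \<Rightarrow> bool" where
  "Ck_on 0 U f \<longleftrightarrow> continuous_on U f"
| "Ck_on (Suc k) U f \<longleftrightarrow> (\<forall>x\<in>U. f differentiable (at x)) \<and>
     (\<forall>b\<in>Basis. Ck_on k U (\<lambda>x. frechet_derivative f (at x) b))"

definition smooth_on :: "'a::euclidean_space set \<Rightarrow> ('a \<Rightarrow> 'b::real_normed_vector) \<Rightarrow> bool" where
  "smooth_on U f \<longleftrightarrow> (\<forall>k. Ck_on k U f)"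

text \<open>\<open>C\<^sup>\<infinity>\<close> on a set that need not be open: restriction of a smooth function on an open neighbourhood.\<close>

definition smooth_extendable_on ::
    "'a::euclidean_space set \<Rightarrow> ('a \<Rightarrow> 'b::real_normed_vector) \<Rightarrow> bool" where
  "smooth_extendable_on S f \<longleftrightarrow>
     (\<exists>U g. open U \<and> S \<subseteq> U \<and> smooth_on U g \<and> (\<forall>x\<in>S. g x = f x))"

text \<open>Near each boundary point the set is, after a rotation of the coordinate axes, the region strictly
  above the graph of a smooth function; \<open>e\<close> is the upward direction, and the function
  is evaluated only at the projection of \<open>x\<close> to the hyperplane orthogonal to \<open>e\<close>.\<close>

definition smooth_boundary :: "'a::euclidean_space set \<Rightarrow> bool" where
  "smooth_boundary \<Omega> \<longleftrightarrow>
     (\<forall>p\<in>frontier \<Omega>. \<exists>r>0. \<exists>e. \<exists>\<gamma> :: 'a \<Rightarrow> real. norm e = 1 \<and> smooth_on UNIV \<gamma> \<and>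
        \<Omega> \<inter> ball p r = {x \<in> ball p r. x \<bullet> e > \<gamma> (x - (x \<bullet> e) *\<^sub>R e)})"

text \<open>\<open>C\<^sub>c\<^sup>\<infinity>(U)\<close>, its elements being extended by zero to the whole space.\<close>

definition test_functions :: "'a::euclidean_space set \<Rightarrow> ('a \<Rightarrow> complex) set" where
  "test_functions U = {\<phi>. smooth_on UNIV \<phi> \<and>
     compact (closure {x. \<phi> x \<noteq> 0}) \<and> closure {x. \<phi> x \<noteq> 0} \<subseteq> U}"

definition partial :: "'a::euclidean_space \<Rightarrow> ('a \<Rightarrow> complex) \<Rightarrow> 'a \<Rightarrow> complex" where
  "partial b f x = frechet_derivative f (at x) b"

definition laplacian :: "('a::euclidean_space \<Rightarrow> complex) \<Rightarrow> 'a \<Rightarrow> complex" where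
  "laplacian f x = (\<Sum>b\<in>Basis. partial b (partial b f) x)"

section \<open>Lebesgue and Sobolev spaces\<close>

text \<open>Elements are functions on the whole space, of which only the restriction to \<open>U\<close> matters;
  functions that agree almost everywhere on \<open>U\<close> are not identified.\<close>

definition L2 :: "'a::euclidean_space set \<Rightarrow> ('a \<Rightarrow> complex) set" where
  "L2 U = {f. f \<in> borel_measurable (lebesgue_on U) \<and>
     integrable (lebesgue_on U) (\<lambda>x. (norm (f x))\<^sup>2)}"

definition is_weak_partial ::
    "'a::euclidean_space set \<Rightarrow> 'a \<Rightarrow> ('a \<Rightarrow> complex) \<Rightarrow> ('a \<Rightarrow> complex) \<Rightarrow> bool" where
  "is_weak_partial U b u g \<longleftrightarrow> g \<in> L2 U \<and>
     (\<forall>\<phi>\<in>test_functions U.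
        (LINT x|lebesgue_on U. u x * partial b \<phi> x) = - (LINT x|lebesgue_on U. g x * \<phi> x))"

definition is_weak_laplacian ::
    "'a::euclidean_space set \<Rightarrow> ('a \<Rightarrow> complex) \<Rightarrow> ('a \<Rightarrow> complex) \<Rightarrow> bool" where
  "is_weak_laplacian U u g \<longleftrightarrow> g \<in> L2 U \<and>
     (\<forall>\<phi>\<in>test_functions U.
        (LINT x|lebesgue_on U. u x * laplacian \<phi> x) = (LINT x|lebesgue_on U. g x * \<phi> x))"

text \<open>Weak derivatives are unique up to null sets, so the choice below does not affect integrals.\<close>

definition weak_partial ::
    "'a::euclidean_space set \<Rightarrow> 'a \<Rightarrow> ('a \<Rightarrow> complex) \<Rightarrow> 'a \<Rightarrow> complex" where
  "weak_partial U b u = (SOME g. is_weak_partial U b u g)"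

definition weak_laplacian ::
    "'a::euclidean_space set \<Rightarrow> ('a \<Rightarrow> complex) \<Rightarrow> 'a \<Rightarrow> complex" where
  "weak_laplacian U u = (SOME g. is_weak_laplacian U u g)"

definition H1 :: "'a::euclidean_space set \<Rightarrow> ('a \<Rightarrow> complex) set" where
  "H1 U = {u \<in> L2 U. \<forall>b\<in>Basis. \<exists>g. is_weak_partial U b u g}"

text \<open>The closure of \<open>C\<^sub>c\<^sup>\<infinity>(U)\<close> in the norm of \<open>H\<^sup>1(U)\<close>.\<close>

definition H10 :: "'a::euclidean_space set \<Rightarrow> ('a \<Rightarrow> complex) set" where
  "H10 U = {u \<in> H1 U. \<exists>\<phi> :: nat \<Rightarrow> 'a \<Rightarrow> complex.
     (\<forall>k. \<phi> k \<in> test_functions U) \<and>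
     (\<lambda>k. (LINT x|lebesgue_on U. (norm (\<phi> k x - u x))\<^sup>2) +
        (\<Sum>b\<in>Basis. LINT x|lebesgue_on U. (norm (partial b (\<phi> k) x - weak_partial U b u x))\<^sup>2))
       \<longlonglongrightarrow> 0}"

definition L2_inner :: "'a::euclidean_space set \<Rightarrow> ('a \<Rightarrow> complex) \<Rightarrow> ('a \<Rightarrow> complex) \<Rightarrow> complex" where
  "L2_inner U u \<psi> = (LINT x|lebesgue_on U. u x * cnj (\<psi> x))"

definition grad_inner :: "'a::euclidean_space set \<Rightarrow> ('a \<Rightarrow> complex) \<Rightarrow> ('a \<Rightarrow> complex) \<Rightarrow> complex" where
  "grad_inner U u \<psi> =
     (LINT x|lebesgue_on U. (\<Sum>b\<in>Basis. weak_partial U b u x * cnj (weak_partial U b \<psi> x)))"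

section \<open>Dirichlet eigenvalues\<close>

definition dirichlet_eigenvalue :: "'a::euclidean_space set \<Rightarrow> real \<Rightarrow> bool" where
  "dirichlet_eigenvalue \<Omega> \<mu> \<longleftrightarrow>
     (\<exists>u\<in>H10 \<Omega>. \<not> (AE x in lebesgue_on \<Omega>. u x = 0) \<and>
        (\<forall>\<psi>\<in>H10 \<Omega>. grad_inner \<Omega> u \<psi> = of_real \<mu> * L2_inner \<Omega> u \<psi>))"

definition first_dirichlet_eigenvalue :: "'a::euclidean_space set \<Rightarrow> real" where
  "first_dirichlet_eigenvalue \<Omega> = (LEAST \<mu>. dirichlet_eigenvalue \<Omega> \<mu>)"

section \<open>Transmission eigenvalues\<close>

definition inner_domain :: "'a::euclidean_space set \<Rightarrow> real \<Rightarrow> 'a set" where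
  "inner_domain \<Omega> \<delta> = {x \<in> \<Omega>. infdist x (frontier \<Omega>) > \<delta>}"

definition thin_layer :: "'a::euclidean_space set \<Rightarrow> real \<Rightarrow> 'a set" where
  "thin_layer \<Omega> \<delta> = \<Omega> - closure (inner_domain \<Omega> \<delta>)"

text \<open>The normal derivative on \<open>\<Gamma> = frontier \<Omega>\<close> of \<open>u \<in> H\<^sup>1(\<Omega>)\<close> with \<open>\<Delta>u \<in> L\<^sup>2\<close> of the layer is in
  general only a distribution in \<open>H\<^sup>-\<^sup>1\<^sup>/\<^sup>2(\<Gamma>)\<close>. As usual it is defined by Green's formula, here through its
  pairing with the restriction to \<open>\<Gamma>\<close> of smooth functions supported away from the inner domain, so
  that no term arises from the inner boundary of the layer. The sign is due to the normal
  \<open>\<nu>\<close> pointing into \<open>\<Omega>\<close>.\<close>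

definition normal_derivative ::
    "'a::euclidean_space set \<Rightarrow> real \<Rightarrow> ('a \<Rightarrow> complex) \<Rightarrow> ('a \<Rightarrow> complex) \<Rightarrow> complex" where
  "normal_derivative \<Omega> \<delta> u \<phi> =
     - (LINT x|lebesgue_on (thin_layer \<Omega> \<delta>).
          weak_laplacian (thin_layer \<Omega> \<delta>) u x * \<phi> x +
          (\<Sum>b\<in>Basis. weak_partial \<Omega> b u x * partial b \<phi> x))"

definition W_space :: "'a::euclidean_space set \<Rightarrow> real \<Rightarrow> ('a \<Rightarrow> complex) set" where
  "W_space \<Omega> \<delta> = {u \<in> H10 \<Omega>.
     (\<exists>g. is_weak_laplacian (thin_layer \<Omega> \<delta>) u g) \<and>
     (\<forall>\<phi>\<in>test_functions (- closure (inner_domain \<Omega> \<delta>)). normal_derivative \<Omega> \<delta> u \<phi> = 0)}"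

text \<open>The variational form of the system \<open>\<Delta>w + \<mu> n w = 0\<close> in the layer, \<open>\<Delta>v + \<mu> v = 0\<close> in \<open>\<Omega>\<close>, with \<open>v = w\<close>
  and \<open>\<partial>v/\<partial>\<nu> = \<partial>w/\<partial>\<nu>\<close> on \<open>\<Gamma>\<close>, and \<open>w = 0\<close> on the inner boundary, written for \<open>u = w - v\<close> in the layer
  and \<open>u = -v\<close> in the inner domain; \<open>\<mu> = k\<^sup>2\<close> is the squared wave number.\<close>

definition transmission_eigenvalue ::
    "'a::euclidean_space set \<Rightarrow> ('a \<Rightarrow> real) \<Rightarrow> real \<Rightarrow> real \<Rightarrow> bool" where
  "transmission_eigenvalue \<Omega> n \<delta> \<mu> \<longleftrightarrow> \<mu> > 0 \<and>
     (\<exists>u\<in>W_space \<Omega> \<delta>. \<not> (AE x in lebesgue_on \<Omega>. u x = 0) \<and>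
        (\<forall>\<psi>\<in>W_space \<Omega> \<delta>.
           (LINT x|lebesgue_on (thin_layer \<Omega> \<delta>).
              of_real (1 / (1 - n x)) *
              (weak_laplacian (thin_layer \<Omega> \<delta>) u x + of_real \<mu> * u x) *
              cnj (weak_laplacian (thin_layer \<Omega> \<delta>) \<psi> x + of_real \<mu> * \<psi> x)) +
           (of_real \<mu>)\<^sup>2 * L2_inner \<Omega> u \<psi> + of_real \<mu> * grad_inner \<Omega> u \<psi>
           = 2 * (of_real \<mu>)\<^sup>2 * L2_inner \<Omega> u \<psi>))"

definition first_transmission_eigenvalue ::
    "'a::euclidean_space set \<Rightarrow> ('a \<Rightarrow> real) \<Rightarrow> real \<Rightarrow> real" where
  "first_transmission_eigenvalue \<Omega> n \<delta> = (LEAST \<mu>. transmission_eigenvalue \<Omega> n \<delta> \<mu>)"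

end

(* Write q_\<mu>(u) for the transmission form at \<mu>. If u is a transmission eigenfunction then q_\<mu>(u) = 0, and
   dropping the nonnegative layer term shows that the Rayleigh quotient of u is at most \<mu>; hence the first
   Dirichlet eigenvalue \<lambda> is a lower bound. Conversely the least \<mu> > 0 for which q_\<mu> is somewhere
   nonpositive is an eigenvalue: a minimizing sequence converges by Rellich's theorem and the parallelogram law,
   and a zero of a nonnegative form lies in its kernel. Test functions supported in the inner domain see no
   layer, so this least value is at most the first Dirichlet eigenvalue of the inner domain. That one is at most
   (1 + O(\<delta>)) \<lambda>, because composing with the perturbed identity y - t X(y), where t is comparable to \<delta>
   and X is a smooth field transversal to the boundary, turns test functions on \<Omega> into test functions on the
   inner domain. *)

theory Submission
  imports Defs "HOL-Complex_Analysis.Great_Picard" "HOL-Library.Diagonal_Subsequence"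
begin

section \<open>Square-integrable functions\<close>

text \<open>The parameter \<mu> enters quadratically and also inside the layer term, so the
  eigenvalues are not critical values of a quotient of two fixed forms and the usual min-max formula
  is not at hand. For fixed \<open>u\<close>, however, \<open>q \<mu> u\<close> is a polynomial in
  \<mu>, and the infimum of those \<mu> at which \<open>q\<close> is somewhere nonpositive takes
  over the role of the least Rayleigh quotient. An empty layer turns the same problem into the
  Dirichlet problem, so one locale gives existence and minimality of both first eigenvalues, and
  their comparison becomes a comparison of two infima. The upper bound must be linear in \<delta>.
  Cutting an eigenfunction off near the boundary would call for a bound on its gradient up to the
  boundary. A map that is C^1-close to the identity instead changes the energy of every test
  function by a factor 1 + O(\<delta>), whatever the function does near the boundary. The distance
  to the boundary, which defines the layer, is never differentiated; a cone condition at the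
  boundary points takes the place of its regularity.\<close>

definition L2_norm :: "'a::euclidean_space set \<Rightarrow> ('a \<Rightarrow> complex) \<Rightarrow> real" where
  "L2_norm U f = sqrt (LINT x|lebesgue_on U. (norm (f x))\<^sup>2)"

lemma L2D:
  assumes "f \<in> L2 U"
  shows "f \<in> borel_measurable (lebesgue_on U)" "integrable (lebesgue_on U) (\<lambda>x. (norm (f x))\<^sup>2)"
  using assms by (auto simp: L2_def)

lemma L2_I_bound:
  assumes "f \<in> borel_measurable (lebesgue_on U)" "integrable (lebesgue_on U) g"
    and "AE x in lebesgue_on U. (norm (f x))\<^sup>2 \<le> g x"
  shows "f \<in> L2 U"
  unfolding L2_def using assms
  by (auto intro!: Bochner_Integration.integrable_bound[OF assms(2)] elim!: eventually_mono)

lemma L2_zero [simp]: "(\<lambda>x. 0) \<in> L2 U"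
  by (simp add: L2_def)

lemma norm_add_sq_le: "(norm (a + b))\<^sup>2 \<le> 2 * (norm a)\<^sup>2 + 2 * (norm (b::'a::real_normed_vector))\<^sup>2"
proof -
  have "(norm (a + b))\<^sup>2 \<le> (norm a + norm b)\<^sup>2"
    by (intro power_mono norm_triangle_ineq) auto
  also have "\<dots> \<le> 2 * (norm a)\<^sup>2 + 2 * (norm b)\<^sup>2"
    using sum_squares_bound[of "norm a" "norm b"] by (simp add: power2_sum)
  finally show ?thesis .
qed

lemma L2_add [intro]:
  assumes "f \<in> L2 U" "g \<in> L2 U"
  shows "(\<lambda>x. f x + g x) \<in> L2 U"
  by (rule L2_I_bound[where g = "\<lambda>x. 2 * (norm (f x))\<^sup>2 + 2 * (norm (g x))\<^sup>2"])
     (use L2D[OF assms(1)] L2D[OF assms(2)] norm_add_sq_le in auto)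

lemma L2_bounded_mult:
  assumes "f \<in> L2 U" "h \<in> borel_measurable (lebesgue_on U)" "\<And>x. x \<in> U \<Longrightarrow> norm (h x) \<le> B"
  shows "(\<lambda>x. h x * f x) \<in> L2 U"
proof (rule L2_I_bound[where g = "\<lambda>x. B\<^sup>2 * (norm (f x))\<^sup>2"])
  have "(norm (h x * f x))\<^sup>2 \<le> B\<^sup>2 * (norm (f x))\<^sup>2" if "x \<in> U" for x
    unfolding norm_mult power_mult_distrib
    by (intro mult_right_mono power_mono) (use assms(3)[OF that] in auto)
  then show "AE x in lebesgue_on U. (norm (h x * f x))\<^sup>2 \<le> B\<^sup>2 * (norm (f x))\<^sup>2"
    by (intro AE_I2) simp
qed (use L2D[OF assms(1)] assms(2) in auto)

lemma L2_scale [intro]: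
  assumes "f \<in> L2 U"
  shows "(\<lambda>x. c * f x) \<in> L2 U"
  by (rule L2_bounded_mult[OF assms, where B = "norm c"]) auto

lemma L2_diff [intro]:
  assumes "f \<in> L2 U" "g \<in> L2 U"
  shows "(\<lambda>x. f x - g x) \<in> L2 U"
  using L2_add[OF assms(1) L2_scale[OF assms(2), of "-1"]] by simp

lemma L2_cnj:
  assumes "f \<in> L2 U"
  shows "(\<lambda>x. cnj (f x)) \<in> L2 U"
proof -
  have "(\<lambda>x. cnj (f x)) \<in> borel_measurable (lebesgue_on U)"
    by (rule measurable_compose[OF L2D(1)[OF assms] borel_measurable_continuous_onI])
       (intro continuous_intros)
  with L2D(2)[OF assms] show ?thesis unfolding L2_def by simp
qed

lemma L2_subset:
  assumes "f \<in> L2 U" "V \<subseteq> U" "V \<in> sets lebesgue" "U \<in> sets lebesgue"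
  shows "f \<in> L2 V"
proof -
  have "integrable (lebesgue_on V) (\<lambda>x. (norm (f x))\<^sup>2)"
    using set_integrable_subset[of lebesgue U "\<lambda>x. (norm (f x))\<^sup>2" V] L2D(2)[OF assms(1)] assms(2-4)
    by (simp add: set_integrable_def integrable_restrict_space)
  moreover have "f \<in> borel_measurable (lebesgue_on V)"
    using L2D(1)[OF assms(1)] assms(2) measurable_restrict_mono by blast
  ultimately show ?thesis by (simp add: L2_def)
qed

lemma L2_norm_mono:
  assumes "f \<in> L2 U" "V \<subseteq> U" "V \<in> sets lebesgue" "U \<in> sets lebesgue"
  shows "L2_norm V f \<le> L2_norm U f"
  unfolding L2_norm_def
proof (rule real_sqrt_le_mono)
  have "(LINT x|lebesgue_on V. (norm (f x))\<^sup>2) = (LINT x|lebesgue. indicator V x *\<^sub>R (norm (f x))\<^sup>2)"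
    using assms(3) by (simp add: integral_restrict_space)
  also have "\<dots> \<le> (LINT x|lebesgue. indicator U x *\<^sub>R (norm (f x))\<^sup>2)"
    using L2D(2)[OF assms(1)] L2D(2)[OF L2_subset[OF assms]] assms(2-4)
    by (intro integral_mono) (auto simp: integrable_restrict_space indicator_def)
  also have "\<dots> = (LINT x|lebesgue_on U. (norm (f x))\<^sup>2)"
    using assms(4) by (simp add: integral_restrict_space)
  finally show "(LINT x|lebesgue_on V. (norm (f x))\<^sup>2) \<le> (LINT x|lebesgue_on U. (norm (f x))\<^sup>2)" .
qed

lemma L2_mult_integrable:
  assumes "f \<in> L2 U" "g \<in> L2 U"
  shows "integrable (lebesgue_on U) (\<lambda>x. f x * g x)"
proof (rule Bochner_Integration.integrable_bound[where f = "\<lambda>x. (norm (f x))\<^sup>2 + (norm (g x))\<^sup>2"])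
  have "norm (f x * g x) \<le> norm ((norm (f x))\<^sup>2 + (norm (g x))\<^sup>2)" for x
    using sum_squares_bound[of "norm (f x)" "norm (g x)"]
      mult_nonneg_nonneg[OF norm_ge_zero[of "f x"] norm_ge_zero[of "g x"]]
    unfolding norm_mult real_norm_def by linarith
  then show "AE x in lebesgue_on U. norm (f x * g x) \<le> norm ((norm (f x))\<^sup>2 + (norm (g x))\<^sup>2)"
    by simp
qed (use L2D[OF assms(1)] L2D[OF assms(2)] in auto)

lemma L2_integral_mult_add:
  assumes "p \<in> L2 U" "q \<in> L2 U" "\<psi> \<in> L2 U"
  shows "(LINT x|lebesgue_on U. (p x + c * q x) * \<psi> x)
     = (LINT x|lebesgue_on U. p x * \<psi> x) + c * (LINT x|lebesgue_on U. q x * \<psi> x)"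
proof -
  have "(LINT x|lebesgue_on U. (p x + c * q x) * \<psi> x) = (LINT x|lebesgue_on U. p x * \<psi> x + c * (q x * \<psi> x))"
    by (simp add: algebra_simps)
  also have "\<dots> = (LINT x|lebesgue_on U. p x * \<psi> x) + (LINT x|lebesgue_on U. c * (q x * \<psi> x))"
    by (intro Bochner_Integration.integral_add integrable_mult_right L2_mult_integrable assms)
  finally show ?thesis by simp
qed

lemma L2_inner_integrable:
  assumes "f \<in> L2 U" "g \<in> L2 U"
  shows "integrable (lebesgue_on U) (\<lambda>x. f x * cnj (g x))"
  using L2_mult_integrable[OF assms(1) L2_cnj[OF assms(2)]] .

lemma L2_inner_add_left:
  assumes "f \<in> L2 U" "g \<in> L2 U" "h \<in> L2 U"
  shows "L2_inner U (\<lambda>x. f x + c * g x) h = L2_inner U f h + c * L2_inner U g h"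
  unfolding L2_inner_def by (rule L2_integral_mult_add[OF assms(1,2) L2_cnj[OF assms(3)]])

lemma L2_inner_commute:
  "L2_inner U g f = cnj (L2_inner U f g)"
  unfolding L2_inner_def by (subst Bochner_Integration.integral_cnj[symmetric]) (simp add: mult.commute)

lemma L2_inner_add_right:
  assumes "f \<in> L2 U" "g \<in> L2 U" "h \<in> L2 U"
  shows "L2_inner U h (\<lambda>x. f x + c * g x) = L2_inner U h f + cnj c * L2_inner U h g"
  unfolding L2_inner_commute[of U h] L2_inner_add_left[OF assms] by simp

lemma L2_norm_nonneg [simp]: "0 \<le> L2_norm U f"
  by (simp add: L2_norm_def)

lemma L2_norm_power2: "(L2_norm U f)\<^sup>2 = (LINT x|lebesgue_on U. (norm (f x))\<^sup>2)"
  by (simp add: L2_norm_def)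

lemma L2_inner_self: "L2_inner U f f = of_real ((L2_norm U f)\<^sup>2)"
  unfolding L2_norm_power2 L2_inner_def
  by (simp only: complex_norm_square[symmetric] integral_complex_of_real)

lemma L2_norm_eq_0_iff:
  assumes "f \<in> L2 U"
  shows "L2_norm U f = 0 \<longleftrightarrow> (AE x in lebesgue_on U. f x = 0)"
  unfolding L2_norm_def using integral_nonneg_eq_0_iff_AE[OF L2D(2)[OF assms]] by simp

lemma L2_norm_cong_AE:
  assumes "f \<in> borel_measurable (lebesgue_on U)" "g \<in> borel_measurable (lebesgue_on U)"
    "AE x in lebesgue_on U. f x = g x"
  shows "L2_norm U f = L2_norm U g"
  unfolding L2_norm_def using assms
  by (auto intro!: arg_cong[where f = sqrt] integral_cong_AE)

lemma L2_inner_cong_AE: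
  assumes "f \<in> L2 U" "f' \<in> L2 U" "g \<in> L2 U" "g' \<in> L2 U"
    "AE x in lebesgue_on U. f x = f' x" "AE x in lebesgue_on U. g x = g' x"
  shows "L2_inner U f g = L2_inner U f' g'"
  unfolding L2_inner_def
  by (rule integral_cong_AE)
     (use assms L2_inner_integrable in \<open>auto intro: borel_measurable_integrable\<close>)

text \<open>Carried over from the inequality for nonnegative integrals; the integrability of the
  product allows the return to real integrals.\<close>

lemma L2_Cauchy_Schwarz:
  assumes "f \<in> L2 U" "g \<in> L2 U"
  shows "(LINT x|lebesgue_on U. norm (f x) * norm (g x)) \<le> L2_norm U f * L2_norm U g"
proof -
  let ?M = "lebesgue_on U"
  note m = L2D[OF assms(1)] L2D[OF assms(2)]
  have i: "integrable ?M (\<lambda>x. norm (f x) * norm (g x))"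
    using integrable_norm[OF L2_mult_integrable[OF assms]] by (simp add: norm_mult)
  let ?F = "LINT x|?M. (norm (f x))\<^sup>2" and ?G = "LINT x|?M. (norm (g x))\<^sup>2"
    and ?H = "LINT x|?M. norm (f x) * norm (g x)"
  have nn: "0 \<le> ?F" "0 \<le> ?G" "0 \<le> ?H" by auto
  have "(\<integral>\<^sup>+x. ennreal (norm (f x)) * ennreal (norm (g x)) \<partial>?M)\<^sup>2
      \<le> (\<integral>\<^sup>+x. ennreal (norm (f x)) ^ 2 \<partial>?M) * (\<integral>\<^sup>+x. ennreal (norm (g x)) ^ 2 \<partial>?M)"
    by (rule Cauchy_Schwarz_nn_integral) (use m in auto)
  also have "(\<integral>\<^sup>+x. ennreal (norm (f x)) ^ 2 \<partial>?M) = ennreal ?F"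
    using nn_integral_eq_integral[OF m(2)] by (simp add: ennreal_power)
  also have "(\<integral>\<^sup>+x. ennreal (norm (g x)) ^ 2 \<partial>?M) = ennreal ?G"
    using nn_integral_eq_integral[OF m(4)] by (simp add: ennreal_power)
  also have "(\<integral>\<^sup>+x. ennreal (norm (f x)) * ennreal (norm (g x)) \<partial>?M) = ennreal ?H"
    using nn_integral_eq_integral[OF i] by (simp add: ennreal_mult)
  finally have "?H\<^sup>2 \<le> ?F * ?G"
    using nn by (simp add: ennreal_power flip: ennreal_mult)
  then have "sqrt (?H\<^sup>2) \<le> sqrt (?F * ?G)" by (rule real_sqrt_le_mono)
  then show ?thesis
    using nn by (simp add: L2_norm_def real_sqrt_mult)
qed

lemma L2_Cauchy_Schwarz_mult:
  assumes "f \<in> L2 U" "g \<in> L2 U"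
  shows "norm (LINT x|lebesgue_on U. f x * g x) \<le> L2_norm U f * L2_norm U g"
proof -
  have "norm (LINT x|lebesgue_on U. f x * g x) \<le> (LINT x|lebesgue_on U. norm (f x * g x))"
    by (rule integral_norm_bound)
  with L2_Cauchy_Schwarz[OF assms] show ?thesis by (simp add: norm_mult)
qed

lemma L2_norm_scale: "L2_norm U (\<lambda>x. c * f x) = norm c * L2_norm U f"
  by (simp add: L2_norm_def norm_mult power_mult_distrib real_sqrt_mult)

lemma L2_norm_triangle:
  assumes "f \<in> L2 U" "g \<in> L2 U"
  shows "L2_norm U (\<lambda>x. f x + g x) \<le> L2_norm U f + L2_norm U g"
proof -
  let ?M = "lebesgue_on U"
  note m = L2D[OF assms(1)] L2D[OF assms(2)]
  have i: "integrable ?M (\<lambda>x. norm (f x) * norm (g x))"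
    using integrable_norm[OF L2_mult_integrable[OF assms]] by (simp add: norm_mult)
  have "(L2_norm U (\<lambda>x. f x + g x))\<^sup>2
     \<le> (LINT x|?M. (norm (f x))\<^sup>2 + 2 * (norm (f x) * norm (g x)) + (norm (g x))\<^sup>2)"
    unfolding L2_norm_power2
  proof (rule integral_mono)
    show "(norm (f x + g x))\<^sup>2 \<le> (norm (f x))\<^sup>2 + 2 * (norm (f x) * norm (g x)) + (norm (g x))\<^sup>2" for x
      using power_mono[OF norm_triangle_ineq[of "f x" "g x"], of 2] by (simp add: power2_sum)
  qed (use L2D(2)[OF L2_add[OF assms]] m i in auto)
  also have "\<dots> = (LINT x|?M. (norm (f x))\<^sup>2) + 2 * (LINT x|?M. norm (f x) * norm (g x))
      + (LINT x|?M. (norm (g x))\<^sup>2)"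
    using m i by simp
  also have "\<dots> \<le> (L2_norm U f + L2_norm U g)\<^sup>2"
    using L2_Cauchy_Schwarz[OF assms] by (simp add: L2_norm_power2[symmetric] power2_sum)
  finally show ?thesis
    by (rule power2_le_imp_le) simp
qed

lemma L2_norm_minus_commute: "L2_norm U (\<lambda>x. f x - g x) = L2_norm U (\<lambda>x. g x - f x)"
  by (simp add: L2_norm_def norm_minus_commute)

lemma L2_norm_triangle_diff:
  assumes "f \<in> L2 U" "g \<in> L2 U" "h \<in> L2 U"
  shows "L2_norm U (\<lambda>x. f x - h x) \<le> L2_norm U (\<lambda>x. f x - g x) + L2_norm U (\<lambda>x. g x - h x)"
  using L2_norm_triangle[OF L2_diff[OF assms(1,2)] L2_diff[OF assms(2,3)]] by simp

lemma L2_norm_le_diff: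
  assumes "f \<in> L2 U" "g \<in> L2 U"
  shows "L2_norm U f \<le> L2_norm U g + L2_norm U (\<lambda>x. f x - g x)"
  using L2_norm_triangle[OF assms(2) L2_diff[OF assms]] by simp

lemma L2_norm_tendsto:
  assumes "\<And>k. f k \<in> L2 U" "g \<in> L2 U" "(\<lambda>k. L2_norm U (\<lambda>x. f k x - g x)) \<longlonglongrightarrow> 0"
  shows "(\<lambda>k. L2_norm U (f k)) \<longlonglongrightarrow> L2_norm U g"
proof -
  have "\<bar>L2_norm U (f k) - L2_norm U g\<bar> \<le> L2_norm U (\<lambda>x. f k x - g x)" for k
    using L2_norm_le_diff[OF assms(1)[of k] assms(2)] L2_norm_le_diff[OF assms(2) assms(1)[of k]]
      L2_norm_minus_commute[of U "f k" g] by linarith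
  then have "(\<lambda>k. L2_norm U (f k) - L2_norm U g) \<longlonglongrightarrow> 0"
    by (intro Lim_null_comparison[OF _ assms(3)]) auto
  then show ?thesis by (simp add: LIM_zero_iff)
qed

lemma L2_integral_mult_tendsto:
  assumes "\<And>k. f k \<in> L2 U" "g \<in> L2 U" "h \<in> L2 U" "(\<lambda>k. L2_norm U (\<lambda>x. f k x - g x)) \<longlonglongrightarrow> 0"
  shows "(\<lambda>k. LINT x|lebesgue_on U. f k x * h x) \<longlonglongrightarrow> (LINT x|lebesgue_on U. g x * h x)"
proof -
  have "(LINT x|lebesgue_on U. f k x * h x) - (LINT x|lebesgue_on U. g x * h x)
      = (LINT x|lebesgue_on U. (f k x - g x) * h x)" for k
    using L2_mult_integrable[OF assms(1,3), of k] L2_mult_integrable[OF assms(2,3)]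
    by (simp add: algebra_simps)
  then have "norm ((LINT x|lebesgue_on U. f k x * h x) - (LINT x|lebesgue_on U. g x * h x))
      \<le> L2_norm U (\<lambda>x. f k x - g x) * L2_norm U h" for k
    using L2_Cauchy_Schwarz_mult[OF L2_diff[OF assms(1,2)] assms(3), of k] by simp
  moreover have "(\<lambda>k. L2_norm U (\<lambda>x. f k x - g x) * L2_norm U h) \<longlonglongrightarrow> 0"
    using tendsto_mult_left_zero[OF assms(4)] by simp
  ultimately show ?thesis
    by (rule LIM_zero_cancel[OF Lim_null_comparison[OF always_eventually[OF allI]]])
qed

section \<open>Completeness of \<open>L2\<close>\<close>

lemma ennreal_le_suminf: "(f k :: ennreal) \<le> (\<Sum>i. f i)"
  using sum_le_suminf[OF summableI, of "{k}" f] by simp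

text \<open>Along a fast subsequence \<open>\<Sum> 2^k |f\<^sub>k\<^sub>+\<^sub>1 - f\<^sub>k|\<^sup>2\<close> is integrable, which gives almost everywhere
  convergence; Fatou's lemma then identifies the limit in the norm.\<close>

lemma L2_complete:
  fixes f :: "nat \<Rightarrow> 'a::euclidean_space \<Rightarrow> complex"
  assumes f: "\<And>k. f k \<in> L2 U"
    and C: "\<And>e. e > 0 \<Longrightarrow> \<exists>N. \<forall>j\<ge>N. \<forall>k\<ge>N. L2_norm U (\<lambda>x. f j x - f k x) < e"
  obtains g where "g \<in> L2 U" "(\<lambda>k. L2_norm U (\<lambda>x. f k x - g x)) \<longlonglongrightarrow> 0"
proof -
  let ?M = "lebesgue_on U"
  have [measurable]: "f k \<in> borel_measurable ?M" for k using L2D(1)[OF f] .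
  have "\<exists>N. \<forall>k. \<forall>j\<ge>N k. \<forall>i\<ge>N k. L2_norm U (\<lambda>x. f j x - f i x) < (1/2)^k"
    using C by (intro choice) auto
  then obtain N where N: "\<And>k i j. j \<ge> N k \<Longrightarrow> i \<ge> N k \<Longrightarrow> L2_norm U (\<lambda>x. f j x - f i x) < (1/2)^k"
    by blast
  \<comment> \<open>The sum makes \<open>r k\<close> at least \<open>N k\<close>; the summand
    \<open>k\<close> makes \<open>r\<close> strictly increasing.\<close>
  define r where "r k = (\<Sum>i\<le>k. N i) + k" for k
  have rN: "r k \<ge> N k" for k
    using member_le_sum[of k "{..k}" N] by (simp add: r_def)
  have r: "strict_mono r"
    unfolding strict_mono_Suc_iff r_def by simp
  have rS: "r (Suc k) \<ge> N k" for k
    using rN[of k] strict_mono_less[OF r, of k "Suc k"] by simp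
  define d where "d k x = f (r (Suc k)) x - f (r k) x" for k x
  have [measurable]: "d k \<in> borel_measurable ?M" for k unfolding d_def by measurable
  have d2: "d k \<in> L2 U" for k unfolding d_def using f by auto
  have dn: "(L2_norm U (d k))\<^sup>2 \<le> ((1/2)^k)\<^sup>2" for k
    using N[OF rS rN, of k] unfolding d_def by (intro power_mono) auto
  have "(\<integral>\<^sup>+x. (\<Sum>k. ennreal (2^k * (norm (d k x))\<^sup>2)) \<partial>?M) = (\<Sum>k. \<integral>\<^sup>+x. ennreal (2^k * (norm (d k x))\<^sup>2) \<partial>?M)"
    by (rule nn_integral_suminf) measurable
  also have "\<dots> = (\<Sum>k. ennreal (2^k * (L2_norm U (d k))\<^sup>2))"
    using L2D(2)[OF d2] by (subst nn_integral_eq_integral) (auto simp: L2_norm_power2)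
  also have "\<dots> \<le> (\<Sum>k. ennreal ((1/2)^k))"
  proof (intro suminf_le ennreal_leI allI)
    fix k
    have "2^k * (L2_norm U (d k))\<^sup>2 \<le> 2^k * ((1/2)^k)\<^sup>2" using dn by simp
    also have "\<dots> = (1/2)^k" by (simp add: power2_eq_square power_one_over field_simps)
    finally show "2^k * (L2_norm U (d k))\<^sup>2 \<le> (1/2)^k" .
  qed auto
  also have "\<dots> = ennreal (\<Sum>k. (1/2)^k)"
    by (rule suminf_ennreal2) (auto simp: summable_geometric)
  also have "\<dots> < \<infinity>" by simp
  finally have "AE x in ?M. (\<Sum>k. ennreal (2^k * (norm (d k x))\<^sup>2)) \<noteq> \<infinity>"
    by (intro nn_integral_noteq_infinite) auto
  then have conv: "AE x in ?M. convergent (\<lambda>k. f (r k) x)"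
  proof (rule eventually_mono)
    fix x assume fin: "(\<Sum>k. ennreal (2^k * (norm (d k x))\<^sup>2)) \<noteq> \<infinity>"
    have "\<exists>B\<ge>0. s = ennreal B" if "s \<noteq> \<infinity>" for s :: ennreal
      using that by (cases s) auto
    from this[OF fin] obtain B
      where B: "B \<ge> 0" "(\<Sum>k. ennreal (2^k * (norm (d k x))\<^sup>2)) = ennreal B"
      by blast
    have b: "norm (d k x) \<le> sqrt B * (sqrt (1/2))^k" for k
    proof -
      have "ennreal (2^k * (norm (d k x))\<^sup>2) \<le> ennreal B"
        unfolding B(2)[symmetric] by (rule ennreal_le_suminf)
      then have "2^k * (norm (d k x))\<^sup>2 \<le> B" using B(1) by simp
      then have "(norm (d k x))\<^sup>2 \<le> B * (1/2)^k" by (simp add: field_simps power_one_over)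
      then have "sqrt ((norm (d k x))\<^sup>2) \<le> sqrt (B * (1/2)^k)" by (rule real_sqrt_le_mono)
      then show ?thesis by (simp add: real_sqrt_mult real_sqrt_power)
    qed
    have "summable (\<lambda>k. sqrt B * (sqrt (1/2))^k)"
      by (intro summable_mult summable_geometric) (simp add: real_sqrt_divide)
    then have "summable (\<lambda>k. d k x)"
      by (rule summable_comparison_test[rotated]) (use b in auto)
    moreover have "(\<Sum>i<k. d i x) = f (r k) x - f (r 0) x" for k
      unfolding d_def by (rule sum_lessThan_telescope)
    ultimately have "convergent (\<lambda>k. f (r k) x - f (r 0) x)"
      by (simp add: summable_iff_convergent)
    then have "convergent (\<lambda>k. (f (r k) x - f (r 0) x) + f (r 0) x)"
      by (intro convergent_add convergent_const)
    then show "convergent (\<lambda>k. f (r k) x)" by simp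
  qed
  \<comment> \<open>Where the subsequence diverges, which happens on a null set only,
    \<open>lim\<close> is an unspecified value.\<close>
  define g where "g x = lim (\<lambda>k. f (r k) x)" for x
  have g[measurable]: "g \<in> borel_measurable ?M"
    unfolding g_def by (rule borel_measurable_lim_metric) measurable
  have fg: "(\<integral>\<^sup>+x. ennreal ((norm (f j x - g x))\<^sup>2) \<partial>?M) \<le> ennreal (e\<^sup>2)"
    if e: "e > 0" and M: "\<And>k. k \<ge> M \<Longrightarrow> L2_norm U (\<lambda>x. f j x - f k x) < e" for e j M
  proof -
    have "(\<integral>\<^sup>+x. ennreal ((norm (f j x - g x))\<^sup>2) \<partial>?M)
       = (\<integral>\<^sup>+x. liminf (\<lambda>k. ennreal ((norm (f j x - f (r k) x))\<^sup>2)) \<partial>?M)"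
    proof (rule nn_integral_cong_AE, rule eventually_mono[OF conv])
      fix x assume "convergent (\<lambda>k. f (r k) x)"
      then have "(\<lambda>k. f (r k) x) \<longlonglongrightarrow> g x"
        unfolding g_def by (simp add: convergent_LIMSEQ_iff)
      then have "(\<lambda>k. ennreal ((norm (f j x - f (r k) x))\<^sup>2)) \<longlonglongrightarrow> ennreal ((norm (f j x - g x))\<^sup>2)"
        by (intro tendsto_intros)
      then show "ennreal ((norm (f j x - g x))\<^sup>2) = liminf (\<lambda>k. ennreal ((norm (f j x - f (r k) x))\<^sup>2))"
        using lim_imp_Liminf trivial_limit_sequentially by metis
    qed
    also have "\<dots> \<le> liminf (\<lambda>k. \<integral>\<^sup>+x. ennreal ((norm (f j x - f (r k) x))\<^sup>2) \<partial>?M)"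
      by (rule nn_integral_liminf) measurable
    also have "\<dots> \<le> ennreal (e\<^sup>2)"
    proof (rule Liminf_le[OF sequentially_bot], rule eventually_sequentiallyI)
      fix k assume "M \<le> k"
      then have "r k \<ge> M" using seq_suble[OF r, of k] by simp
      then have "(L2_norm U (\<lambda>x. f j x - f (r k) x))\<^sup>2 \<le> e\<^sup>2"
        using M[of "r k"] by (intro power_mono) auto
      then show "(\<integral>\<^sup>+x. ennreal ((norm (f j x - f (r k) x))\<^sup>2) \<partial>?M) \<le> ennreal (e\<^sup>2)"
        using L2D(2)[OF L2_diff[OF f f, of j "r k"]]
        by (subst nn_integral_eq_integral) (auto simp: L2_norm_power2 ennreal_leI)
    qed
    finally show ?thesis .
  qed
  have fgL2: "(\<lambda>x. f j x - g x) \<in> L2 U \<and> L2_norm U (\<lambda>x. f j x - g x) \<le> e"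
    if e: "e > 0" and M: "\<And>k. k \<ge> M \<Longrightarrow> L2_norm U (\<lambda>x. f j x - f k x) < e" for e j M
  proof -
    have i: "integrable ?M (\<lambda>x. (norm (f j x - g x))\<^sup>2)"
      using fg[OF e M] by (intro integrableI_bounded) (auto simp: less_top[symmetric] top_unique)
    have "ennreal (LINT x|?M. (norm (f j x - g x))\<^sup>2) \<le> ennreal (e\<^sup>2)"
      using fg[OF e M] nn_integral_eq_integral[OF i] by simp
    then have "(L2_norm U (\<lambda>x. f j x - g x))\<^sup>2 \<le> e\<^sup>2"
      by (simp add: L2_norm_power2)
    then show ?thesis using i e unfolding L2_def by (auto intro: power2_le_imp_le)
  qed
  show thesis
  proof
    obtain N1 where N1: "\<forall>j\<ge>N1. \<forall>k\<ge>N1. L2_norm U (\<lambda>x. f j x - f k x) < 1"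
      using C[of 1] by auto
    then have "(\<lambda>x. f N1 x - g x) \<in> L2 U" using fgL2[of 1 N1 N1] by auto
    from L2_diff[OF f[of N1] this] show "g \<in> L2 U" by simp
    show "(\<lambda>k. L2_norm U (\<lambda>x. f k x - g x)) \<longlonglongrightarrow> 0"
    proof (rule LIMSEQ_I)
      fix e :: real assume "e > 0"
      then obtain N2 where N2: "\<forall>j\<ge>N2. \<forall>k\<ge>N2. L2_norm U (\<lambda>x. f j x - f k x) < e/2"
        using C[of "e/2"] by auto
      have "L2_norm U (\<lambda>x. f j x - g x) \<le> e/2" if "j \<ge> N2" for j
        using fgL2[of "e/2" N2 j] N2 that \<open>e > 0\<close> by auto
      then show "\<exists>no. \<forall>n\<ge>no. norm (L2_norm U (\<lambda>x. f n x - g x) - 0) < e"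
        using \<open>e > 0\<close> by (intro exI[of _ N2]) force
    qed
  qed
qed

section \<open>Smooth functions\<close>

lemma Ck_on_UNIV_Suc:
  "Ck_on (Suc k) UNIV f \<longleftrightarrow> (\<forall>x. f differentiable (at x)) \<and>
     (\<forall>b\<in>Basis. Ck_on k UNIV (\<lambda>x. frechet_derivative f (at x) b))"
  by simp

declare Ck_on.simps(2) [simp del]

text \<open>Derivatives are unique, so any explicitly computed derivative may stand in for
  \<open>frechet_derivative\<close>. The inductions over the order of smoothness below all pass
  through this rule.\<close>

lemma Ck_on_SucI:
  assumes "\<And>x. (f has_derivative f' x) (at x)" "\<And>b. b \<in> Basis \<Longrightarrow> Ck_on k UNIV (\<lambda>x. f' x b)"
  shows "Ck_on (Suc k) UNIV f"
proof -
  have "frechet_derivative f (at x) = f' x" for x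
    using frechet_derivative_at[OF assms(1)] by simp
  with assms show ?thesis
    unfolding Ck_on_UNIV_Suc by (auto simp: differentiable_def)
qed

lemma Ck_on_SucD:
  assumes "Ck_on (Suc k) UNIV f"
  shows "(f has_derivative frechet_derivative f (at x)) (at x)"
    "b \<in> Basis \<Longrightarrow> Ck_on k UNIV (\<lambda>x. frechet_derivative f (at x) b)"
  using assms frechet_derivative_works by (auto simp: Ck_on_UNIV_Suc)

lemma Ck_on_imp_continuous_on:
  assumes "Ck_on k UNIV f" shows "continuous_on UNIV f"
proof (cases k)
  case (Suc j)
  then show ?thesis using assms
    by (auto simp: Ck_on_UNIV_Suc continuous_on_eq_continuous_at differentiable_imp_continuous_within)
qed (use assms in simp)

lemma Ck_on_Suc_imp: "Ck_on (Suc k) UNIV f \<Longrightarrow> Ck_on k UNIV f"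
proof (induction k arbitrary: f)
  case 0
  then show ?case using Ck_on_imp_continuous_on by auto
next
  case (Suc k)
  then show ?case unfolding Ck_on_UNIV_Suc[of "Suc k"] by (subst Ck_on_UNIV_Suc) blast
qed

lemma Ck_on_const: "Ck_on k UNIV (\<lambda>x. c)"
proof (induction k arbitrary: c)
  case (Suc k)
  show ?case by (rule Ck_on_SucI[where f' = "\<lambda>_ _. 0"]) (use Suc in auto)
qed auto

lemma Ck_on_bounded_linear:
  assumes "bounded_linear T" shows "Ck_on k UNIV T"
proof (cases k)
  case 0
  then show ?thesis using linear_continuous_on[OF assms] by simp
next
  case (Suc j)
  then show ?thesis
    using Ck_on_SucI[of T "\<lambda>_. T"] Ck_on_const bounded_linear_imp_has_derivative[OF assms] by auto
qed

lemma Ck_on_add: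
  "Ck_on k UNIV f \<Longrightarrow> Ck_on k UNIV g \<Longrightarrow> Ck_on k UNIV (\<lambda>x. f x + g x)"
proof (induction k arbitrary: f g)
  case (Suc k)
  note f = Ck_on_SucD[OF Suc.prems(1)] and g = Ck_on_SucD[OF Suc.prems(2)]
  show ?case
    by (rule Ck_on_SucI[OF has_derivative_add[OF f(1) g(1)]]) (intro Suc.IH f(2) g(2))
qed (auto intro: continuous_intros)

lemma Ck_on_sum:
  "(\<And>i. i \<in> I \<Longrightarrow> Ck_on k UNIV (f i)) \<Longrightarrow> Ck_on k UNIV (\<lambda>x. \<Sum>i\<in>I. f i x)"
  by (induction I rule: infinite_finite_induct) (auto intro: Ck_on_add Ck_on_const)

text \<open>The product rule gives two terms of the same shape with one order of smoothness less,
  hence an induction generalized over both factors. Products, scalar multiples and inner products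
  are covered at once.\<close>

lemma Ck_on_bilinear:
  assumes "bounded_bilinear P"
  shows "Ck_on k UNIV f \<Longrightarrow> Ck_on k UNIV g \<Longrightarrow> Ck_on k UNIV (\<lambda>x. P (f x) (g x))"
proof (induction k arbitrary: f g)
  case 0
  then show ?case using bounded_bilinear.continuous_on[OF assms] by auto
next
  case (Suc k)
  note f = Ck_on_SucD[OF Suc.prems(1)] and g = Ck_on_SucD[OF Suc.prems(2)]
  show ?case
    by (rule Ck_on_SucI[OF bounded_bilinear.FDERIV[OF assms f(1) g(1)]])
       (intro Ck_on_add Suc.IH f(2) g(2) Suc.prems[THEN Ck_on_Suc_imp])
qed

lemma Ck_on_linear_compose:
  assumes "bounded_linear L"
  shows "Ck_on k UNIV f \<Longrightarrow> Ck_on k UNIV (\<lambda>x. L (f x))"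
proof (induction k arbitrary: f)
  case 0
  then show ?case using bounded_linear.continuous_on[OF assms] by auto
next
  case (Suc k)
  note f = Ck_on_SucD[OF Suc.prems(1)]
  show ?case
    by (rule Ck_on_SucI[OF bounded_linear.has_derivative[OF assms f(1)]]) (intro Suc.IH f(2))
qed

lemma Ck_on_compose:
  "Ck_on k UNIV f \<Longrightarrow> Ck_on k UNIV T \<Longrightarrow> Ck_on k UNIV (\<lambda>x. f (T x))"
proof (induction k arbitrary: f)
  case 0
  then show ?case by (auto intro: continuous_on_compose2)
next
  case (Suc k)
  note f = Ck_on_SucD[OF Suc.prems(1)] and T = Ck_on_SucD[OF Suc.prems(2)]
  let ?f = "\<lambda>x. frechet_derivative f (at x)" and ?T = "\<lambda>x. frechet_derivative T (at x)"
  \<comment> \<open>Smoothness is known only for derivatives along basis vectors, so the derivative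
    in the varying direction \<open>?T x b\<close> is expanded in the basis; each term is then a
    product to which the induction hypothesis applies.\<close>
  have eq: "?f (T x) (?T x b) = (\<Sum>c\<in>Basis. (?T x b \<bullet> c) *\<^sub>R ?f (T x) c)" for x b
  proof -
    interpret linear "?f (T x)"
      using has_derivative_bounded_linear[OF f(1)] bounded_linear.linear by blast
    have "?f (T x) (?T x b) = ?f (T x) (\<Sum>c\<in>Basis. (?T x b \<bullet> c) *\<^sub>R c)"
      by (simp add: euclidean_representation)
    then show ?thesis by (simp add: sum scale)
  qed
  have c: "Ck_on k UNIV (\<lambda>x. (?T x b \<bullet> c) *\<^sub>R ?f (T x) c)" if "b \<in> Basis" "c \<in> Basis" for b c
    using Suc.IH[OF f(2)[OF that(2)] Ck_on_Suc_imp[OF Suc.prems(2)]]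
      Ck_on_linear_compose[OF bounded_linear_inner_left T(2)[OF that(1)]]
    by (rule Ck_on_bilinear[OF bounded_bilinear_scaleR, rotated])
  show ?case
    by (rule Ck_on_SucI[OF has_derivative_compose[OF T(1) f(1)]]) (use c in \<open>simp add: eq Ck_on_sum\<close>)
qed

lemma smooth_on_const: "smooth_on UNIV (\<lambda>x. c)"
  by (simp add: smooth_on_def Ck_on_const)

lemma smooth_on_bounded_linear: "bounded_linear T \<Longrightarrow> smooth_on UNIV T"
  by (simp add: smooth_on_def Ck_on_bounded_linear)

lemma smooth_on_add: "smooth_on UNIV f \<Longrightarrow> smooth_on UNIV g \<Longrightarrow> smooth_on UNIV (\<lambda>x. f x + g x)"
  by (simp add: smooth_on_def Ck_on_add)

lemma smooth_on_sum:
  "(\<And>i. i \<in> I \<Longrightarrow> smooth_on UNIV (f i)) \<Longrightarrow> smooth_on UNIV (\<lambda>x. \<Sum>i\<in>I. f i x)"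
  by (simp add: smooth_on_def Ck_on_sum)

lemma smooth_on_bilinear:
  "bounded_bilinear P \<Longrightarrow> smooth_on UNIV f \<Longrightarrow> smooth_on UNIV g \<Longrightarrow> smooth_on UNIV (\<lambda>x. P (f x) (g x))"
  by (simp add: smooth_on_def Ck_on_bilinear)

lemma smooth_on_linear_compose:
  "bounded_linear L \<Longrightarrow> smooth_on UNIV f \<Longrightarrow> smooth_on UNIV (\<lambda>x. L (f x))"
  by (simp add: smooth_on_def Ck_on_linear_compose)

lemma smooth_on_compose:
  "smooth_on UNIV f \<Longrightarrow> smooth_on UNIV T \<Longrightarrow> smooth_on UNIV (\<lambda>x. f (T x))"
  by (simp add: smooth_on_def Ck_on_compose)

lemmas smooth_on_mult = smooth_on_bilinear[OF bounded_bilinear_mult]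
lemmas smooth_on_scaleR = smooth_on_bilinear[OF bounded_bilinear_scaleR]

lemma smooth_on_prod:
  fixes f :: "'i \<Rightarrow> 'a::euclidean_space \<Rightarrow> real"
  shows "(\<And>i. i \<in> I \<Longrightarrow> smooth_on UNIV (f i)) \<Longrightarrow> smooth_on UNIV (\<lambda>x. \<Prod>i\<in>I. f i x)"
  by (induction I rule: infinite_finite_induct) (auto intro: smooth_on_mult smooth_on_const)

lemma smooth_on_has_derivative:
  assumes "smooth_on UNIV f"
  shows "(f has_derivative frechet_derivative f (at x)) (at x)"
proof -
  have "Ck_on (Suc 0) UNIV f" using assms unfolding smooth_on_def by blast
  then show ?thesis by (rule Ck_on_SucD)
qed

lemma smooth_on_frechet_derivative:
  assumes "smooth_on UNIV f" "b \<in> Basis"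
  shows "smooth_on UNIV (\<lambda>x. frechet_derivative f (at x) b)"
  unfolding smooth_on_def
proof
  fix k
  have "Ck_on (Suc k) UNIV f" using assms(1) unfolding smooth_on_def by blast
  then show "Ck_on k UNIV (\<lambda>x. frechet_derivative f (at x) b)" by (rule Ck_on_SucD(2)[OF _ assms(2)])
qed

lemma smooth_on_continuous_on:
  assumes "smooth_on UNIV f" shows "continuous_on S f"
  using assms Ck_on_imp_continuous_on continuous_on_subset unfolding smooth_on_def by blast

lemma frechet_derivative_Basis:
  assumes "smooth_on UNIV f"
  shows "frechet_derivative f (at x) h = (\<Sum>b\<in>Basis. (h \<bullet> b) *\<^sub>R frechet_derivative f (at x) b)"
proof -
  interpret linear "frechet_derivative f (at x)"
    by (rule has_derivative_linear[OF smooth_on_has_derivative[OF assms]])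
  have "frechet_derivative f (at x) h = frechet_derivative f (at x) (\<Sum>b\<in>Basis. (h \<bullet> b) *\<^sub>R b)"
    by (simp add: euclidean_representation)
  then show ?thesis by (simp add: sum scale)
qed

lemma smooth_on_frechet_derivative_continuous_on:
  assumes "smooth_on UNIV f"
  shows "continuous_on S (\<lambda>x. frechet_derivative f (at x) h)"
  unfolding frechet_derivative_Basis[OF assms, of _ h]
  by (intro continuous_intros smooth_on_continuous_on[OF smooth_on_frechet_derivative[OF assms]])

subsection \<open>Smooth cutoff functions\<close>

text \<open>The polynomial makes the family closed under differentiation: with y = 1/x the
  derivative of p(y) exp(-y) is y^2 (p - p')(y) exp(-y), again a member. Smoothness at 0 to all
  orders is then a single induction.\<close>

definition flat_exp :: "real poly \<Rightarrow> real \<Rightarrow> real" where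
  "flat_exp p x = (if x > 0 then poly p (1/x) * exp (- (1/x)) else 0)"

lemma poly_exp_tendsto_0: "((\<lambda>y::real. poly p y * exp (- y)) \<longlongrightarrow> 0) at_top"
proof -
  have m: "((\<lambda>y::real. y ^ k * exp (- y)) \<longlongrightarrow> 0) at_top" for k
    using tendsto_power_div_exp_0[of k] by (simp add: exp_minus field_simps)
  have "((\<lambda>y::real. \<Sum>i\<le>degree p. coeff p i * (y ^ i * exp (- y))) \<longlongrightarrow> (\<Sum>i\<le>degree p. coeff p i * 0)) at_top"
    by (intro tendsto_sum tendsto_mult tendsto_const m)
  then show ?thesis by (simp add: poly_altdef sum_distrib_right mult.assoc)
qed

lemma flat_exp_has_derivative:
  "(flat_exp p has_real_derivative flat_exp (monom 1 2 * (p - pderiv p)) x) (at x)"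
proof -
  consider "x > 0" | "x < 0" | "x = 0" by linarith
  then show ?thesis
  proof cases
    case 1
    have "((\<lambda>x. poly p (1/x) * exp (- (1/x))) has_real_derivative
        flat_exp (monom 1 2 * (p - pderiv p)) x) (at x)"
      using 1 by (auto intro!: derivative_eq_intros poly_DERIV[THEN DERIV_chain2]
          simp: flat_exp_def poly_monom field_simps power2_eq_square)
    then show ?thesis
      by (rule has_field_derivative_transform_within_open[of _ _ _ "{0<..}"])
         (use 1 in \<open>auto simp: flat_exp_def\<close>)
  next
    case 2
    have "((\<lambda>x. 0) has_real_derivative flat_exp (monom 1 2 * (p - pderiv p)) x) (at x)"
      using 2 by (simp add: flat_exp_def)
    then show ?thesis
      by (rule has_field_derivative_transform_within_open[of _ _ _ "{..<0}"])
         (use 2 in \<open>auto simp: flat_exp_def\<close>)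
  next
    case 3
    have "((\<lambda>h. flat_exp p h / h) \<longlongrightarrow> 0) (at 0)"
    proof (rule filterlim_split_at)
      \<comment> \<open>Dividing by \<open>h\<close> multiplies the polynomial in \<open>1/h\<close>
        by its variable, which is \<open>pCons 0 p\<close>; the exponential still wins.\<close>
      have "((\<lambda>h. poly (pCons 0 p) (inverse h) * exp (- inverse h)) \<longlongrightarrow> 0) (at_right (0::real))"
        by (rule filterlim_compose[OF poly_exp_tendsto_0 filterlim_inverse_at_top_right])
      then show "((\<lambda>h. flat_exp p h / h) \<longlongrightarrow> 0) (at_right 0)"
        by (rule Lim_transform_eventually)
           (auto simp: eventually_at_right_less flat_exp_def field_simps
             intro!: eventually_mono[OF eventually_at_right_less])
      show "((\<lambda>h. flat_exp p h / h) \<longlongrightarrow> 0) (at_left 0)"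
        by (rule Lim_transform_eventually[OF tendsto_const])
           (auto simp: flat_exp_def eventually_at_filter)
    qed
    then show ?thesis
      using 3 by (simp add: has_field_derivative_iff flat_exp_def)
  qed
qed

lemma smooth_on_flat_exp: "smooth_on UNIV (flat_exp p)"
  unfolding smooth_on_def
proof
  fix k show "Ck_on k UNIV (flat_exp p)"
  proof (induction k arbitrary: p)
    case 0
    have "isCont (flat_exp p) x" for x
      using flat_exp_has_derivative DERIV_isCont by blast
    then show ?case by (simp add: continuous_on_eq_continuous_at)
  next
    case (Suc k)
    show ?case
    proof (rule Ck_on_SucI)
      show "(flat_exp p has_derivative (\<lambda>h. flat_exp (monom 1 2 * (p - pderiv p)) x * h)) (at x)" for x
        using flat_exp_has_derivative[of p x] by (simp add: has_field_derivative_def)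
      show "Ck_on k UNIV (\<lambda>x. flat_exp (monom 1 2 * (p - pderiv p)) x * b)" if "b \<in> Basis" for b
        using that Suc.IH[of "monom 1 2 * (p - pderiv p)"] by simp
    qed
  qed
qed

definition cutoff :: "real \<Rightarrow> real" where
  "cutoff = flat_exp 1"

lemma smooth_on_cutoff: "smooth_on UNIV cutoff"
  by (simp add: cutoff_def smooth_on_flat_exp)

lemma cutoff_eq: "cutoff x = (if x > 0 then exp (- (1/x)) else 0)"
  by (simp add: cutoff_def flat_exp_def)

lemma cutoff_bounds: "0 \<le> cutoff x" "cutoff x \<le> 1"
  by (auto simp: cutoff_eq)

lemma cutoff_pos_iff: "0 < cutoff x \<longleftrightarrow> 0 < x"
  by (auto simp: cutoff_eq)

lemma cutoff_mono: "x \<le> y \<Longrightarrow> cutoff x \<le> cutoff y"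
  by (auto simp: cutoff_eq frac_le)

lemma cutoff_scaled_tendsto:
  "(\<lambda>k. cutoff (real (Suc k) * x)) \<longlonglongrightarrow> (if x > 0 then 1 else 0)"
proof (cases "x > 0")
  case True
  have "(\<lambda>k. exp (- (inverse (real (Suc k)) * (1 / x)))) \<longlonglongrightarrow> exp (- (0 * (1/x)))"
    by (intro tendsto_intros LIMSEQ_inverse_real_of_nat)
  moreover have "cutoff (real (Suc k) * x) = exp (- (inverse (real (Suc k)) * (1 / x)))" for k
    using True by (simp add: cutoff_eq zero_less_mult_iff divide_simps del: of_nat_Suc)
  ultimately show ?thesis using True by simp
next
  case False
  then show ?thesis by (simp add: cutoff_eq mult_le_0_iff zero_less_mult_iff del: of_nat_Suc)
qed

text \<open>The squared distance is written as an inner product, which is smooth at the centre as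
  well. The function is positive exactly on the open ball.\<close>

definition ball_bump :: "'a::euclidean_space \<Rightarrow> real \<Rightarrow> 'a \<Rightarrow> real" where
  "ball_bump p r x = cutoff (r\<^sup>2 - (x - p) \<bullet> (x - p))"

lemma smooth_on_ball_bump: "smooth_on UNIV (ball_bump p r)"
proof -
  have d: "smooth_on UNIV (\<lambda>x. x - p)"
    using smooth_on_add[OF smooth_on_bounded_linear[OF bounded_linear_ident] smooth_on_const[of "-p"]]
    by simp
  have "smooth_on UNIV (\<lambda>x. r\<^sup>2 + (- 1) * ((x - p) \<bullet> (x - p)))"
    by (intro smooth_on_add smooth_on_const smooth_on_mult smooth_on_bilinear[OF bounded_bilinear_inner] d)
  from smooth_on_compose[OF smooth_on_cutoff this] show ?thesis
    by (simp add: ball_bump_def[abs_def])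
qed

lemma ball_bump_bounds: "0 \<le> ball_bump p r x" "ball_bump p r x \<le> 1"
  by (simp_all add: ball_bump_def cutoff_bounds)

lemma ball_bump_pos_iff: "r > 0 \<Longrightarrow> 0 < ball_bump p r x \<longleftrightarrow> dist x p < r"
  unfolding ball_bump_def cutoff_pos_iff dist_norm power2_norm_eq_inner[symmetric]
  by (auto intro: power2_less_imp_less power_strict_mono)

text \<open>One-sided cutoffs at every face, stretched by \<open>Suc k\<close> so that they tend
  pointwise, from below, to the indicator of the open box; the successor keeps the factor positive
  at \<open>k = 0\<close>.\<close>

definition box_bump :: "'a::euclidean_space \<Rightarrow> 'a \<Rightarrow> nat \<Rightarrow> 'a \<Rightarrow> real" where
  "box_bump a c k x =
     (\<Prod>b\<in>Basis. cutoff (real (Suc k) * ((x - a) \<bullet> b)) * cutoff (real (Suc k) * ((c - x) \<bullet> b)))"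

lemma smooth_on_box_bump: "smooth_on UNIV (box_bump a c k)"
proof -
  have *: "smooth_on UNIV (\<lambda>x. real (Suc k) * ((x - a) \<bullet> b))" for a b
  proof -
    have "smooth_on UNIV (\<lambda>x. (real (Suc k) *\<^sub>R b) \<bullet> x + (- (real (Suc k) * (a \<bullet> b))))"
      by (intro smooth_on_add smooth_on_const smooth_on_bounded_linear bounded_linear_inner_right)
    then show ?thesis by (simp add: algebra_simps inner_commute)
  qed
  have **: "smooth_on UNIV (\<lambda>x. real (Suc k) * ((c - x) \<bullet> b))" for b
    using *[of c "-b"] by (simp add: algebra_simps)
  show ?thesis
    unfolding box_bump_def[abs_def]
    by (intro smooth_on_prod smooth_on_mult smooth_on_compose[OF smooth_on_cutoff] * **)
qed

lemma box_bump_bounds: "0 \<le> box_bump a c k x" "box_bump a c k x \<le> 1"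
  unfolding box_bump_def
  by (auto intro!: prod_nonneg prod_le_1 mult_nonneg_nonneg mult_le_one simp: cutoff_bounds)

lemma box_bump_nonzero_imp: "box_bump a c k x \<noteq> 0 \<Longrightarrow> x \<in> box a c"
proof -
  assume "box_bump a c k x \<noteq> 0"
  then have "cutoff (real (Suc k) * ((x - a) \<bullet> b)) \<noteq> 0 \<and> cutoff (real (Suc k) * ((c - x) \<bullet> b)) \<noteq> 0"
    if "b \<in> Basis" for b
    using that unfolding box_bump_def by auto
  then have "0 < real (Suc k) * ((x - a) \<bullet> b) \<and> 0 < real (Suc k) * ((c - x) \<bullet> b)" if "b \<in> Basis" for b
    using that cutoff_pos_iff cutoff_bounds by (metis less_eq_real_def)
  then show ?thesis
    by (simp add: mem_box zero_less_mult_iff inner_diff_left del: of_nat_Suc)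
qed

lemma box_bump_tendsto: "(\<lambda>k. box_bump a c k x) \<longlonglongrightarrow> indicator (box a c) x"
proof -
  have "(\<lambda>k. box_bump a c k x) \<longlonglongrightarrow>
      (\<Prod>b\<in>Basis. (if (x - a) \<bullet> b > 0 then 1 else 0) * (if (c - x) \<bullet> b > 0 then 1 else 0))"
    unfolding box_bump_def by (intro tendsto_prod tendsto_mult cutoff_scaled_tendsto)
  also have "(\<Prod>b\<in>Basis. (if (x - a) \<bullet> b > 0 then 1 else 0) * (if (c - x) \<bullet> b > 0 then 1 else 0))
      = indicat_real (box a c) x"
  proof (cases "x \<in> box a c")
    case True
    then show ?thesis by (auto simp: mem_box inner_diff_left intro!: prod.neutral)
  next
    case False
    then show ?thesis by (auto simp: mem_box inner_diff_left indicator_def)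
  qed
  finally show ?thesis .
qed

section \<open>Test functions\<close>

lemma test_functionsD:
  assumes "\<phi> \<in> test_functions U"
  shows "smooth_on UNIV \<phi>" "compact (closure {x. \<phi> x \<noteq> 0})" "closure {x. \<phi> x \<noteq> 0} \<subseteq> U"
  using assms by (auto simp: test_functions_def)

lemma test_functionsI:
  assumes "smooth_on UNIV \<phi>" "compact K" "K \<subseteq> U" "\<And>x. x \<notin> K \<Longrightarrow> \<phi> x = 0"
  shows "\<phi> \<in> test_functions U"
proof -
  have "closure {x. \<phi> x \<noteq> 0} \<subseteq> K"
    using assms(2,4) by (intro closure_minimal compact_imp_closed) auto
  with assms show ?thesis
    unfolding test_functions_def
    using compact_Int_closed[OF assms(2), of "closure {x. \<phi> x \<noteq> 0}"]
    by (simp only: Int_absorb1 closed_closure) (use assms in auto)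
qed

lemma test_functions_outside:
  assumes "\<phi> \<in> test_functions U" "x \<notin> U"
  shows "\<phi> x = 0"
  using test_functionsD(3)[OF assms(1)] assms(2) closure_subset[of "{x. \<phi> x \<noteq> 0}"] by blast

lemma test_functions_mono: "U \<subseteq> V \<Longrightarrow> test_functions U \<subseteq> test_functions V"
  by (auto simp: test_functions_def)

lemma test_functions_support:
  assumes "\<phi> \<in> test_functions U"
  shows "\<exists>K. compact K \<and> K \<subseteq> U \<and> (\<forall>x. x \<notin> K \<longrightarrow> \<phi> x = 0)"
  using test_functionsD(2,3)[OF assms] closure_subset[of "{x. \<phi> x \<noteq> 0}"]
  by (intro exI[of _ "closure {x. \<phi> x \<noteq> 0}"]) auto

lemma test_functions_add:
  assumes "\<phi> \<in> test_functions U" "\<psi> \<in> test_functions U"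
  shows "(\<lambda>x. \<phi> x + c * \<psi> x) \<in> test_functions U"
proof -
  obtain K where K: "compact K" "K \<subseteq> U" "\<And>x. x \<notin> K \<Longrightarrow> \<phi> x = 0"
    using test_functions_support[OF assms(1)] by blast
  obtain L where L: "compact L" "L \<subseteq> U" "\<And>x. x \<notin> L \<Longrightarrow> \<psi> x = 0"
    using test_functions_support[OF assms(2)] by blast
  show ?thesis
    using K L test_functionsD(1)[OF assms(1)] test_functionsD(1)[OF assms(2)]
    by (intro test_functionsI[where K = "K \<union> L"] smooth_on_add smooth_on_mult smooth_on_const) auto
qed

lemma test_functions_mult:
  assumes "\<phi> \<in> test_functions U" "smooth_on UNIV \<psi>"
  shows "(\<lambda>x. \<phi> x * \<psi> x) \<in> test_functions U"
proof -
  obtain K where K: "compact K" "K \<subseteq> U" "\<And>x. x \<notin> K \<Longrightarrow> \<phi> x = 0"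
    using test_functions_support[OF assms(1)] by blast
  then show ?thesis
    using test_functionsD(1)[OF assms(1)] assms(2)
    by (intro test_functionsI[where K = K] smooth_on_mult) auto
qed

lemma frechet_derivative_eq_0_outside:
  assumes "closed K" "\<And>x. x \<notin> K \<Longrightarrow> \<phi> x = 0" "x \<notin> K"
  shows "frechet_derivative \<phi> (at x) h = 0"
proof -
  have "((\<lambda>x. 0) has_derivative (\<lambda>h. 0)) (at x)" by simp
  then have "(\<phi> has_derivative (\<lambda>h. 0)) (at x)"
    by (rule has_derivative_transform_within_open[where s = "- K"]) (use assms in auto)
  from frechet_derivative_at[OF this] show ?thesis by metis
qed

lemma test_functions_partial:
  assumes "\<phi> \<in> test_functions U" "b \<in> Basis"
  shows "partial b \<phi> \<in> test_functions U"
proof -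
  obtain K where K: "compact K" "K \<subseteq> U" "\<And>x. x \<notin> K \<Longrightarrow> \<phi> x = 0"
    using test_functions_support[OF assms(1)] by blast
  show ?thesis
    using K frechet_derivative_eq_0_outside[OF compact_imp_closed[OF K(1)] K(3)]
      smooth_on_frechet_derivative[OF test_functionsD(1)[OF assms(1)] assms(2)]
    by (intro test_functionsI[where K = K]) (auto simp: partial_def[abs_def])
qed

lemma test_functions_zero: "(\<lambda>x. 0) \<in> test_functions U"
  by (rule test_functionsI[where K = "{}"]) (auto intro: smooth_on_const)

lemma test_functions_sum:
  "(\<And>i. i \<in> I \<Longrightarrow> f i \<in> test_functions U) \<Longrightarrow> (\<lambda>x. \<Sum>i\<in>I. f i x) \<in> test_functions U"
proof (induction I rule: infinite_finite_induct)
  case (insert i I)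
  then show ?case using test_functions_add[of "f i" U "\<lambda>x. \<Sum>i\<in>I. f i x" 1] by simp
qed (auto intro: test_functions_zero)

lemma test_functions_laplacian:
  "\<phi> \<in> test_functions U \<Longrightarrow> laplacian \<phi> \<in> test_functions U"
  unfolding laplacian_def[abs_def] by (intro test_functions_sum test_functions_partial)

lemma test_functions_box_bump:
  assumes "cbox a c \<subseteq> U"
  shows "(\<lambda>x. complex_of_real (box_bump a c k x)) \<in> test_functions U"
proof (rule test_functionsI[where K = "cbox a c"])
  show "smooth_on UNIV (\<lambda>x. complex_of_real (box_bump a c k x))"
    by (rule smooth_on_linear_compose[OF bounded_linear_of_real smooth_on_box_bump])
  show "complex_of_real (box_bump a c k x) = 0" if "x \<notin> cbox a c" for x
    using box_bump_nonzero_imp[of a c k x] box_subset_cbox[of a c] that by auto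
qed (use assms in auto)

lemma test_functions_continuous_on: "\<phi> \<in> test_functions U \<Longrightarrow> continuous_on S \<phi>"
  using smooth_on_continuous_on test_functionsD(1) by blast

section \<open>Integrals of test functions and of their difference quotients\<close>

lemma continuous_compact_support_integrable:
  fixes f :: "'a::euclidean_space \<Rightarrow> 'b::{banach,second_countable_topology}"
  assumes "continuous_on UNIV f" "compact K" "\<And>x. x \<notin> K \<Longrightarrow> f x = 0"
  shows "integrable lborel f"
proof -
  have "integrable lborel (\<lambda>x. indicator K x *\<^sub>R f x)"
    using assms continuous_on_subset[OF assms(1)] by (intro borel_integrable_compact) auto
  moreover have "(\<lambda>x. indicator K x *\<^sub>R f x) = f"
    using assms(3) by (auto simp: indicator_def)
  ultimately show ?thesis by simp
qed

lemma test_functions_integrable: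
  assumes "\<phi> \<in> test_functions U"
  shows "integrable lborel \<phi>" "integrable lborel (\<lambda>x. (norm (\<phi> x))\<^sup>2)"
proof -
  obtain K where K: "compact K" "\<And>x. x \<notin> K \<Longrightarrow> \<phi> x = 0"
    using test_functions_support[OF assms] by blast
  note c = test_functions_continuous_on[OF assms]
  show "integrable lborel \<phi>" by (rule continuous_compact_support_integrable[OF c K])
  show "integrable lborel (\<lambda>x. (norm (\<phi> x))\<^sup>2)"
    by (rule continuous_compact_support_integrable[OF _ K(1)]) (auto intro!: continuous_intros c simp: K(2))
qed

lemma continuous_borel_measurable_lebesgue_on:
  assumes "continuous_on UNIV f"
  shows "f \<in> borel_measurable (lebesgue_on U)"
  by (rule measurable_restrict_space1[OF measurable_completion])
     (simp add: borel_measurable_continuous_onI[OF assms])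

lemma integrable_lborel_imp_lebesgue_on:
  fixes f :: "'a::euclidean_space \<Rightarrow> 'b::{banach,second_countable_topology}"
  assumes "integrable lborel f" "U \<in> sets lebesgue"
  shows "integrable (lebesgue_on U) f"
proof -
  have "integrable lebesgue f"
    using assms(1) integrable_completion[of f lborel] borel_measurable_integrable[OF assms(1)] by simp
  then show ?thesis
    using assms(2) integrable_mult_indicator[of U lebesgue f] by (simp add: integrable_restrict_space)
qed

lemma integral_lebesgue_on_eq_lborel:
  fixes f :: "'a::euclidean_space \<Rightarrow> 'b::{banach,second_countable_topology}"
  assumes "f \<in> borel_measurable borel" "U \<in> sets lebesgue" "\<And>x. x \<notin> U \<Longrightarrow> f x = 0"
  shows "(LINT x|lebesgue_on U. f x) = (LINT x|lborel. f x)"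
proof -
  have "(\<lambda>x. indicator U x *\<^sub>R f x) = f"
    using assms(3) by (auto simp: indicator_def)
  then show ?thesis
    using assms integral_completion[of f lborel] by (simp add: integral_restrict_space)
qed

lemma test_functions_L2:
  assumes "\<phi> \<in> test_functions V" "U \<in> sets lebesgue"
  shows "\<phi> \<in> L2 U"
  unfolding L2_def
  using integrable_lborel_imp_lebesgue_on[OF test_functions_integrable(2)[OF assms(1)] assms(2)]
    continuous_borel_measurable_lebesgue_on[OF test_functions_continuous_on[OF assms(1)]] by auto

lemma integral_lborel_translate:
  fixes f :: "'a::euclidean_space \<Rightarrow> 'b::{banach,second_countable_topology}"
  assumes "f \<in> borel_measurable borel"
  shows "(LINT x|lborel. f (x + h)) = (LINT x|lborel. f x)"
proof -
  have "(LINT x|lborel. f x) = (LINT x|distr lborel borel ((+) h). f x)"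
    by (simp add: lborel_distr_plus)
  also have "\<dots> = (LINT x|lborel. f (h + x))"
    using assms by (subst integral_distr) auto
  finally show ?thesis by (simp add: add.commute)
qed

lemma smooth_on_derivative_bound:
  fixes f :: "'a::euclidean_space \<Rightarrow> 'b::real_normed_vector"
  assumes "smooth_on UNIV f" "compact K"
  shows "\<exists>B\<ge>0. \<forall>x\<in>K. \<forall>h. norm (frechet_derivative f (at x) h) \<le> B * norm h"
proof -
  let ?D = "\<lambda>x. frechet_derivative f (at x)"
  have "\<exists>B\<ge>0. \<forall>x\<in>K. norm (?D x b) \<le> B" for b
  proof -
    have "bounded ((\<lambda>x. ?D x b) ` K)"
      by (intro compact_imp_bounded compact_continuous_image assms(2)
          smooth_on_frechet_derivative_continuous_on assms(1))
    then show ?thesis by (auto simp: bounded_pos intro: less_imp_le)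
  qed
  then obtain B where B: "\<And>b. B b \<ge> 0" "\<And>x b. x \<in> K \<Longrightarrow> norm (?D x b) \<le> B b" by metis
  have "norm (?D x h) \<le> (\<Sum>b\<in>Basis. B b) * norm h" if "x \<in> K" for x h
  proof -
    have "?D x h = (\<Sum>b\<in>Basis. (h \<bullet> b) *\<^sub>R ?D x b)" by (rule frechet_derivative_Basis[OF assms(1)])
    also have "norm \<dots> \<le> (\<Sum>b\<in>Basis. norm h * B b)"
      by (intro sum_norm_le) (auto intro!: mult_mono B that Basis_le_norm)
    finally show ?thesis by (simp add: sum_distrib_left mult.commute)
  qed
  moreover have "(\<Sum>b\<in>Basis. B b) \<ge> 0" by (intro sum_nonneg B)
  ultimately show ?thesis by blast
qed

lemma smooth_on_Lipschitz_convex: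
  assumes "smooth_on UNIV f" "convex S"
    and "\<And>x h. x \<in> S \<Longrightarrow> norm (frechet_derivative f (at x) h) \<le> B * norm h" "x \<in> S" "y \<in> S"
  shows "norm (f x - f y) \<le> B * norm (x - y)"
  by (rule differentiable_bound[OF assms(2) _ onorm_le assms(4,5)])
     (auto intro: has_derivative_at_withinI smooth_on_has_derivative assms(1,3))

lemma smooth_on_derivative_bound_compact_support:
  fixes f :: "'a::euclidean_space \<Rightarrow> 'b::real_normed_vector"
  assumes "smooth_on UNIV f" "compact K" "\<And>x. x \<notin> K \<Longrightarrow> f x = 0"
  shows "\<exists>B\<ge>0. \<forall>x h. norm (frechet_derivative f (at x) h) \<le> B * norm h"
proof -
  obtain B where B: "B \<ge> 0" "\<And>x h. x \<in> K \<Longrightarrow> norm (frechet_derivative f (at x) h) \<le> B * norm h"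
    using smooth_on_derivative_bound[OF assms(1,2)] by blast
  have "norm (frechet_derivative f (at x) h) \<le> B * norm h" for x h
    using B frechet_derivative_eq_0_outside[OF compact_imp_closed[OF assms(2)] assms(3), where x = x and h = h]
    by (cases "x \<in> K") auto
  with B(1) show ?thesis by blast
qed

lemma test_functions_Lipschitz:
  assumes "\<phi> \<in> test_functions U"
  shows "\<exists>B\<ge>0. \<forall>x y. norm (\<phi> x - \<phi> y) \<le> B * norm (x - y)"
proof -
  obtain K where K: "compact K" "\<And>x. x \<notin> K \<Longrightarrow> \<phi> x = 0"
    using test_functions_support[OF assms] by blast
  obtain B where B: "B \<ge> 0" "\<And>x h. norm (frechet_derivative \<phi> (at x) h) \<le> B * norm h"
    using smooth_on_derivative_bound_compact_support[OF test_functionsD(1)[OF assms] K] by blast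
  have "norm (\<phi> x - \<phi> y) \<le> B * norm (x - y)" for x y
    by (rule smooth_on_Lipschitz_convex[OF test_functionsD(1)[OF assms] convex_UNIV B(2)]) auto
  with B(1) show ?thesis by blast
qed

lemma test_functions_translate:
  assumes "\<phi> \<in> test_functions U"
  shows "(\<lambda>x. \<phi> (x + h)) \<in> test_functions UNIV"
proof -
  obtain K where K: "compact K" "\<And>x. x \<notin> K \<Longrightarrow> \<phi> x = 0"
    using test_functions_support[OF assms] by blast
  have s: "smooth_on UNIV (\<lambda>x::'a. x + h)"
    by (rule smooth_on_add[OF smooth_on_bounded_linear[OF bounded_linear_ident] smooth_on_const])
  show ?thesis
  proof (rule test_functionsI[where K = "(\<lambda>x. x - h) ` K"])
    show "smooth_on UNIV (\<lambda>x. \<phi> (x + h))"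
      by (rule smooth_on_compose[OF test_functionsD(1)[OF assms] s])
    show "compact ((\<lambda>x. x - h) ` K)"
      by (intro compact_continuous_image K(1) continuous_intros)
    show "\<phi> (x + h) = 0" if "x \<notin> (\<lambda>x. x - h) ` K" for x
      using that by (intro K(2)) (auto simp: image_iff)
  qed simp
qed

lemma has_vector_derivative_difference_quotient:
  fixes f :: "'a::real_normed_vector \<Rightarrow> 'b::real_normed_vector"
  assumes "((\<lambda>t. f (x + t *\<^sub>R h)) has_vector_derivative D) (at 0)"
  shows "((\<lambda>t. (f (x + t *\<^sub>R h) - f x) /\<^sub>R t) \<longlongrightarrow> D) (at 0)"
proof -
  have "((\<lambda>t. norm (f (x + t *\<^sub>R h) - f x - t *\<^sub>R D) / norm t) \<longlongrightarrow> 0) (at 0)"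
    using assms by (simp add: has_vector_derivative_def has_derivative_at)
  moreover have "\<forall>\<^sub>F t in at 0. norm (f (x + t *\<^sub>R h) - f x - t *\<^sub>R D) / norm t
      = norm ((f (x + t *\<^sub>R h) - f x) /\<^sub>R t - D)"
  proof (rule eventually_at_filter[THEN iffD2], rule always_eventually, intro allI impI)
    fix t :: real assume "t \<noteq> 0"
    then have "(f (x + t *\<^sub>R h) - f x) /\<^sub>R t - D = (f (x + t *\<^sub>R h) - f x - t *\<^sub>R D) /\<^sub>R t"
      by (simp add: scaleR_diff_right)
    then show "norm (f (x + t *\<^sub>R h) - f x - t *\<^sub>R D) / norm t
      = norm ((f (x + t *\<^sub>R h) - f x) /\<^sub>R t - D)"
      by (simp add: divide_inverse mult.commute)
  qed
  ultimately have "((\<lambda>t. norm ((f (x + t *\<^sub>R h) - f x) /\<^sub>R t - D)) \<longlongrightarrow> 0) (at 0)"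
    by (rule Lim_transform_eventually)
  then show ?thesis
    by (rule LIM_zero_cancel[OF tendsto_norm_zero_cancel])
qed

text \<open>Prepared for dominated convergence: the Lipschitz bound and the compact support give one
  integrable majorant for the quotients of all steps \<open>h /\<^sub>R real (Suc k)\<close>. These
  steps are no longer than \<open>h\<close>, so a ball enlarged by \<open>norm h\<close> contains
  all supports.\<close>

lemma test_functions_difference_quotient:
  fixes h :: "'a::euclidean_space"
  assumes "\<phi> \<in> test_functions U"
  defines "d \<equiv> \<lambda>k x. of_nat (Suc k) * (\<phi> (x + h /\<^sub>R real (Suc k)) - \<phi> x)"
  shows "\<exists>B\<ge>0. \<exists>R. \<forall>k x. norm (d k x) \<le> B * indicator (cball 0 R) x"
    and "(\<lambda>k. d k x) \<longlonglongrightarrow> frechet_derivative \<phi> (at x) h"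
proof -
  obtain K where K: "compact K" "\<And>x. x \<notin> K \<Longrightarrow> \<phi> x = 0"
    using test_functions_support[OF assms(1)] by blast
  obtain R where R: "\<And>x. x \<in> K \<Longrightarrow> norm x \<le> R"
    using compact_imp_bounded[OF K(1)] by (auto simp: bounded_iff)
  obtain B where B: "B \<ge> 0" "\<And>x y. norm (\<phi> x - \<phi> y) \<le> B * norm (x - y)"
    using test_functions_Lipschitz[OF assms(1)] by blast
  have "norm (d k x) \<le> B * norm h * indicator (cball 0 (R + norm h)) x" for k x
  proof (cases "x \<in> cball 0 (R + norm h)")
    case True
    have "norm (d k x) = real (Suc k) * norm (\<phi> (x + h /\<^sub>R real (Suc k)) - \<phi> x)"
      unfolding d_def norm_mult norm_of_nat ..
    also have "\<dots> \<le> real (Suc k) * (B * norm (h /\<^sub>R real (Suc k)))"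
      using B(2)[of "x + h /\<^sub>R real (Suc k)" x] by (intro mult_left_mono) auto
    also have "\<dots> = B * norm h" by simp
    finally show ?thesis using True by simp
  next
    case False
    have "norm (h /\<^sub>R real (Suc k)) \<le> norm h"
      by (simp add: divide_simps mult_le_cancel_left1 del: of_nat_Suc)
    then have "norm (x + h /\<^sub>R real (Suc k)) > R"
      using False norm_diff_ineq[of x "h /\<^sub>R real (Suc k)"] by (simp del: norm_scaleR)
    moreover have "norm x > R" using False by (smt (verit) mem_cball_0 norm_ge_zero)
    ultimately have "\<phi> (x + h /\<^sub>R real (Suc k)) = 0" "\<phi> x = 0"
      using R by (auto intro!: K(2) dest!: R)
    then show ?thesis using False by (simp add: d_def)
  qed
  with B(1) show "\<exists>B\<ge>0. \<exists>R. \<forall>k x. norm (d k x) \<le> B * indicator (cball 0 R) x"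
    by (intro exI[of _ "B * norm h"] conjI exI[of _ "R + norm h"]) auto
  have D: "(\<phi> has_derivative frechet_derivative \<phi> (at x)) (at (x + 0 *\<^sub>R h))"
    using smooth_on_has_derivative[OF test_functionsD(1)[OF assms(1)]] by simp
  have "((\<lambda>t. x + t *\<^sub>R h) has_derivative (\<lambda>t. t *\<^sub>R h)) (at 0)"
    by (auto intro!: derivative_eq_intros)
  from has_derivative_compose[OF this D]
  have "((\<lambda>t. \<phi> (x + t *\<^sub>R h)) has_vector_derivative frechet_derivative \<phi> (at x) h) (at 0)"
    unfolding has_vector_derivative_def using linear_cmul[OF has_derivative_linear[OF D]] by simp
  then have "((\<lambda>t. (\<phi> (x + t *\<^sub>R h) - \<phi> x) /\<^sub>R t) \<longlongrightarrow> frechet_derivative \<phi> (at x) h) (at 0)"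
    by (rule has_vector_derivative_difference_quotient)
  then have "(\<lambda>k. (\<phi> (x + inverse (real (Suc k)) *\<^sub>R h) - \<phi> x) /\<^sub>R inverse (real (Suc k)))
      \<longlonglongrightarrow> frechet_derivative \<phi> (at x) h"
    by (rule tendsto_at_iff_sequentially[THEN iffD1, rule_format, unfolded o_def])
       (auto simp del: of_nat_Suc intro: LIMSEQ_inverse_real_of_nat)
  then show "(\<lambda>k. d k x) \<longlonglongrightarrow> frechet_derivative \<phi> (at x) h"
    by (simp add: d_def scaleR_conv_of_real)
qed

text \<open>By translation invariance every difference quotient integrates to 0, and the integral
  passes to the limit. Neither Fubini nor a one-dimensional fundamental theorem enters.\<close>

lemma integral_partial_test_function:
  assumes "\<phi> \<in> test_functions U"
  shows "(LINT x|lborel. partial b \<phi> x) = 0"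
proof -
  let ?d = "\<lambda>k x. of_nat (Suc k) * (\<phi> (x + b /\<^sub>R real (Suc k)) - \<phi> x)"
  obtain B R where BR: "B \<ge> 0" "\<And>k x. norm (?d k x) \<le> B * indicator (cball 0 R) x"
    using test_functions_difference_quotient(1)[OF assms, of b] by blast
  note lim = test_functions_difference_quotient(2)[OF assms, of _ b]
  note int = test_functions_integrable(1)[OF assms]
    and int' = test_functions_integrable(1)[OF test_functions_translate[OF assms]]
  have zero: "(LINT x|lborel. ?d k x) = 0" for k
    using int int' integral_lborel_translate[OF borel_measurable_integrable[OF int, simplified], of "b /\<^sub>R real (Suc k)"]
    by (simp del: of_nat_Suc)
  have "(\<lambda>k. LINT x|lborel. ?d k x) \<longlonglongrightarrow> (LINT x|lborel. frechet_derivative \<phi> (at x) b)"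
  proof (rule integral_dominated_convergence)
    show "integrable lborel (\<lambda>x. B * indicator (cball 0 R) x)"
      using emeasure_lborel_cball_finite[of 0 R]
      by (intro integrable_mult_right) (simp add: integrable_indicator_iff)
    show "(\<lambda>x. frechet_derivative \<phi> (at x) b) \<in> borel_measurable lborel"
      using smooth_on_frechet_derivative_continuous_on[OF test_functionsD(1)[OF assms]]
      by (simp add: borel_measurable_continuous_onI)
    show "?d k \<in> borel_measurable lborel" for k
      using int int' borel_measurable_integrable by (intro borel_measurable_times borel_measurable_diff) auto
  qed (use BR lim in auto)
  then show ?thesis
    unfolding zero partial_def using LIMSEQ_unique tendsto_const by metis
qed

lemma partial_mult:
  assumes "smooth_on UNIV \<phi>" "smooth_on UNIV \<psi>"
  shows "partial b (\<lambda>x. \<phi> x * \<psi> x) x = \<phi> x * partial b \<psi> x + partial b \<phi> x * \<psi> x"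
  unfolding partial_def
  using frechet_derivative_at[OF has_derivative_mult[OF smooth_on_has_derivative[OF assms(1)]
      smooth_on_has_derivative[OF assms(2)]], of x, symmetric] by simp

lemma partial_add:
  assumes "smooth_on UNIV \<phi>" "smooth_on UNIV \<psi>"
  shows "partial b (\<lambda>x. \<phi> x + c * \<psi> x) x = partial b \<phi> x + c * partial b \<psi> x"
  unfolding partial_def
  using frechet_derivative_at[OF has_derivative_add[OF smooth_on_has_derivative[OF assms(1)]
      has_derivative_mult_right[OF smooth_on_has_derivative[OF assms(2)]]], of x, symmetric] by simp

lemma integration_by_parts_test:
  assumes "\<phi> \<in> test_functions U" "\<psi> \<in> test_functions V" "b \<in> Basis"
  shows "(LINT x|lborel. \<phi> x * partial b \<psi> x) = - (LINT x|lborel. partial b \<phi> x * \<psi> x)"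
proof -
  note \<phi> = test_functionsD(1)[OF assms(1)] and \<psi> = test_functionsD(1)[OF assms(2)]
  have "0 = (LINT x|lborel. \<phi> x * partial b \<psi> x + partial b \<phi> x * \<psi> x)"
    using integral_partial_test_function[OF test_functions_mult[OF assms(1) \<psi>], of b]
    by (simp add: partial_mult[OF \<phi> \<psi>])
  also have "\<dots> = (LINT x|lborel. \<phi> x * partial b \<psi> x) + (LINT x|lborel. partial b \<phi> x * \<psi> x)"
    by (rule Bochner_Integration.integral_add[OF
          test_functions_integrable(1)[OF test_functions_mult[OF assms(1) test_functionsD(1)[OF test_functions_partial[OF assms(2,3)]]]]
          test_functions_integrable(1)[OF test_functions_mult[OF test_functions_partial[OF assms(1,3)] \<psi>]]])
  finally show ?thesis by (simp add: eq_neg_iff_add_eq_0)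
qed

section \<open>Weak derivatives\<close>

text \<open>Open boxes are an intersection-stable generator of the Borel sets, so a Dynkin argument
  reaches all Borel sets; the vanishing of the total integral handles complements. A Lebesgue set
  differs from a Borel set by a null set.\<close>

lemma lebesgue_set_integral_zero_of_boxes:
  fixes f :: "'a::euclidean_space \<Rightarrow> 'b::{banach,second_countable_topology}"
  assumes f: "integrable lebesgue f" and zero: "(LINT x|lebesgue. f x) = 0"
    and box: "\<And>a c. (LINT x:box a c|lebesgue. f x) = 0" and "A \<in> sets lebesgue"
  shows "(LINT x:A|lebesgue. f x) = 0"
proof -
  let ?G = "range (\<lambda>(a, c). box a c :: 'a set)"
  have si: "set_integrable lebesgue A f" if "A \<in> sets lebesgue" for A
    using f that unfolding set_integrable_def by (simp add: integrable_mult_indicator)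
  have G: "B \<in> sets lebesgue" if "B \<in> sigma_sets UNIV ?G" for B
  proof -
    have "B \<in> sets borel" using that by (simp add: borel_eq_box)
    then show ?thesis by simp
  qed
  have borel: "(LINT x:B|lebesgue. f x) = 0" if "B \<in> sigma_sets UNIV ?G" for B
  proof -
    have "Int_stable ?G"
      by (auto simp: Int_stable_def box_Int_box)
    moreover have "?G \<subseteq> Pow UNIV" by simp
    moreover note that
    ultimately show ?thesis
    proof (induction rule: sigma_sets_induct_disjoint)
      case (basic A)
      then show ?case using box by auto
    next
      case empty
      show ?case by (simp add: set_lebesgue_integral_def)
    next
      case (compl A)
      have A: "A \<in> sets lebesgue"
        using compl(1) by (rule G)
      have "(LINT x:UNIV|lebesgue. f x) = (LINT x:(UNIV - A) \<union> A|lebesgue. f x)"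
        by simp
      also have "\<dots> = (LINT x:UNIV - A|lebesgue. f x) + (LINT x:A|lebesgue. f x)"
        using A by (intro set_integral_Un si) auto
      finally show ?case using compl(2) zero by (simp add: set_lebesgue_integral_def)
    next
      case (union A)
      have A: "A i \<in> sets lebesgue" for i
        using union(2) by (intro G) auto
      have "(LINT x:(\<Union>i. A i)|lebesgue. f x) = (\<Sum>i. (LINT x:(A i)|lebesgue. f x))"
        using A union(1) by (intro lebesgue_integral_countable_add si) (auto simp: disjoint_family_on_def)
      then show ?case using union(3) by simp
    qed
  qed
  obtain S N N' where A: "A = S \<union> N" "N \<subseteq> N'" "N' \<in> null_sets lborel" "S \<in> sets lborel"
    using sets_completionE[OF assms(4)] .
  have S: "S \<in> sigma_sets UNIV ?G"
    using A(4) by (simp add: borel_eq_box)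
  have "AE x in lebesgue. x \<notin> N'"
    using AE_completion[OF AE_not_in[OF A(3)]] .
  then have "AE x in lebesgue. indicator A x *\<^sub>R f x = indicator S x *\<^sub>R f x"
    by (rule eventually_mono) (use A in \<open>auto simp: indicator_def\<close>)
  then have "(LINT x:A|lebesgue. f x) = (LINT x:S|lebesgue. f x)"
    unfolding set_lebesgue_integral_def
  proof (intro integral_cong_AE)
    show "(\<lambda>x. indicator A x *\<^sub>R f x) \<in> borel_measurable lebesgue"
      using borel_measurable_integrable[OF si[OF assms(4), unfolded set_integrable_def]] .
    have "S \<in> sets lebesgue" using A(4) by simp
    from borel_measurable_integrable[OF si[OF this, unfolded set_integrable_def]]
    show "(\<lambda>x. indicator S x *\<^sub>R f x) \<in> borel_measurable lebesgue" .
  qed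
  with borel[OF S] show ?thesis by simp
qed

lemma sigma_finite_measure_lebesgue: "sigma_finite_measure (lebesgue :: 'a::euclidean_space measure)"
proof
  obtain A :: "'a set set" where A: "countable A" "A \<subseteq> sets lborel" "\<Union>A = space lborel"
    "\<forall>a\<in>A. emeasure lborel a \<noteq> \<infinity>"
    using lborel.sigma_finite_countable by blast
  then show "\<exists>A::'a set set. countable A \<and> A \<subseteq> sets lebesgue \<and> \<Union>A = space lebesgue \<and>
    (\<forall>a\<in>A. emeasure lebesgue a \<noteq> \<infinity>)"
    by (intro exI[of _ A]) auto
qed

lemma open_sets_lebesgue: "open (U::'a::euclidean_space set) \<Longrightarrow> U \<in> sets lebesgue"
  by (simp add: borel_open)

text \<open>Smooth functions approximating the indicators of boxes reduce the fundamental lemma of the calculus of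
  variations to the vanishing of an integrable function whose integral over every box is zero.\<close>

lemma fundamental_lemma:
  fixes g :: "'a::euclidean_space \<Rightarrow> complex"
  assumes U: "open U" and g: "g \<in> L2 U"
    and zero: "\<And>\<phi>. \<phi> \<in> test_functions U \<Longrightarrow> (LINT x|lebesgue_on U. g x * \<phi> x) = 0"
  shows "AE x in lebesgue_on U. g x = 0"
proof -
  note Us = open_sets_lebesgue[OF U]
  have box: "(LINT x|lebesgue. indicator (box a c) x *\<^sub>R g x) = 0"
    and box_int: "integrable lebesgue (\<lambda>x. indicator (box a c) x *\<^sub>R g x)"
    if "cbox a c \<subseteq> U" for a c
  proof -
    have one: "(\<lambda>x. indicator (box a c) x) \<in> L2 U"
    proof -
      have "integrable (lebesgue_on U) (\<lambda>x. indicat_real (box a c) x)"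
        using emeasure_lborel_box_finite[of a c]
        by (intro integrable_lborel_imp_lebesgue_on Us) (simp add: integrable_indicator_iff)
      moreover have "(\<lambda>x. indicator (box a c) x) \<in> borel_measurable (lebesgue_on U)"
        by (intro measurable_restrict_space1 measurable_completion borel_measurable_indicator) simp
      ultimately show ?thesis
        by (intro L2_I_bound) (auto simp: indicator_def)
    qed
    have int: "integrable (lebesgue_on U) (\<lambda>x. g x * indicator (box a c) x)"
      by (rule L2_mult_integrable[OF g one])
    have "(\<lambda>k. LINT x|lebesgue_on U. g x * complex_of_real (box_bump a c k x))
       \<longlonglongrightarrow> (LINT x|lebesgue_on U. g x * indicator (box a c) x)"
    proof (rule integral_dominated_convergence)
      show "integrable (lebesgue_on U) (\<lambda>x. norm (g x * indicator (box a c) x))"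
        using int by simp
      show "AE x in lebesgue_on U. (\<lambda>k. g x * complex_of_real (box_bump a c k x)) \<longlonglongrightarrow> g x * indicator (box a c) x"
      proof (intro AE_I2 tendsto_mult tendsto_const)
        fix x
        have "complex_of_real (indicator (box a c) x) = indicator (box a c) x"
          by (simp add: indicator_def)
        then show "(\<lambda>k. complex_of_real (box_bump a c k x)) \<longlonglongrightarrow> indicator (box a c) x"
          using tendsto_of_real[OF box_bump_tendsto, of a c x] by metis
      qed
      show "AE x in lebesgue_on U. norm (g x * complex_of_real (box_bump a c k x)) \<le> norm (g x * indicator (box a c) x)" for k
      proof (intro AE_I2)
        fix x
        show "norm (g x * complex_of_real (box_bump a c k x)) \<le> norm (g x * indicator (box a c) x)"
        proof (cases "x \<in> box a c")
          case True
          have "norm (g x) * \<bar>box_bump a c k x\<bar> \<le> norm (g x) * 1"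
            using box_bump_bounds[of a c k x] by (intro mult_left_mono) auto
          then show ?thesis using True by (simp add: norm_mult)
        next
          case False
          then have "box_bump a c k x = 0" using box_bump_nonzero_imp[of a c k x] by auto
          then show ?thesis by simp
        qed
      qed
      show "(\<lambda>x. g x * complex_of_real (box_bump a c k x)) \<in> borel_measurable (lebesgue_on U)" for k
        using L2_mult_integrable[OF g test_functions_L2[OF test_functions_box_bump[OF that] Us]]
        by (rule borel_measurable_integrable)
      show "(\<lambda>x. g x * indicator (box a c) x) \<in> borel_measurable (lebesgue_on U)"
        using int by (rule borel_measurable_integrable)
    qed
    moreover have "(LINT x|lebesgue_on U. g x * complex_of_real (box_bump a c k x)) = 0" for k
      by (rule zero[OF test_functions_box_bump[OF that]])
    ultimately have z: "(LINT x|lebesgue_on U. g x * indicator (box a c) x) = 0"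
      using LIMSEQ_unique[OF _ tendsto_const] by simp
    have eq: "(\<lambda>x. indicator U x *\<^sub>R (g x * indicator (box a c) x)) = (\<lambda>x. indicator (box a c) x *\<^sub>R g x)"
    proof
      fix x
      show "indicator U x *\<^sub>R (g x * indicator (box a c) x) = indicator (box a c) x *\<^sub>R g x"
      proof (cases "x \<in> box a c")
        case True
        then have "x \<in> U" using that box_subset_cbox[of a c] by blast
        then show ?thesis using True by simp
      qed simp
    qed
    show "(LINT x|lebesgue. indicator (box a c) x *\<^sub>R g x) = 0"
      using z Us by (simp add: integral_restrict_space eq)
    show "integrable lebesgue (\<lambda>x. indicator (box a c) x *\<^sub>R g x)"
      using int Us by (simp add: integrable_restrict_space eq)
  qed
  have AEbox: "AE x in lebesgue. x \<in> cbox p q \<longrightarrow> g x = 0" if "cbox p q \<subseteq> U" for p q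
  proof -
    \<comment> \<open>Restricting to a fixed box makes the function integrable on the whole space,
      while its integral over another box is an integral of \<open>g\<close> over the intersection,
      which is again a box inside \<open>U\<close>.\<close>
    let ?f = "\<lambda>x. indicator (box p q) x *\<^sub>R g x"
    have "(LINT x:box a c|lebesgue. ?f x) = 0" for a c
    proof -
      obtain a' c' where ac: "box a c \<inter> box p q = box a' c'" "cbox a c \<inter> cbox p q = cbox a' c'"
        using that[OF box_Int_box Int_interval] .
      have "(LINT x:box a c|lebesgue. ?f x) = (LINT x|lebesgue. indicator (box a' c') x *\<^sub>R g x)"
        unfolding set_lebesgue_integral_def
        by (intro Bochner_Integration.integral_cong) (auto simp: ac(1)[symmetric] indicator_def)
      also have "\<dots> = 0" using ac(2) that by (intro box) blast
      finally show ?thesis .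
    qed
    then have "(LINT x:A|lebesgue. ?f x) = 0" if "A \<in> sets lebesgue" for A
      by (rule lebesgue_set_integral_zero_of_boxes[OF box_int[OF \<open>cbox p q \<subseteq> U\<close>] box[OF \<open>cbox p q \<subseteq> U\<close>] _ that])
    then have "AE x in lebesgue. ?f x = 0"
      by (rule sigma_finite_measure.density_zero[OF sigma_finite_measure_lebesgue box_int[OF that]])
    moreover have "AE x in lebesgue. x \<notin> cbox p q - box p q"
      using negligible_frontier_interval[of p q] by (intro AE_not_in) (simp add: negligible_iff_null_sets)
    ultimately show ?thesis
      by eventually_elim (auto simp: indicator_def split: if_splits)
  qed
  obtain D where D: "countable D" "D \<subseteq> Pow U" "\<And>X. X \<in> D \<Longrightarrow> \<exists>a b. X = cbox a b" "\<Union>D = U"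
    using open_countable_Union_open_cbox[OF U] by metis
  have "AE x in lebesgue. \<forall>X\<in>D. x \<in> X \<longrightarrow> g x = 0"
  proof (subst AE_ball_countable[OF D(1)], intro ballI)
    fix X assume "X \<in> D"
    with D(2,3) obtain a b where "X = cbox a b" "cbox a b \<subseteq> U" by blast
    then show "AE x in lebesgue. x \<in> X \<longrightarrow> g x = 0" using AEbox by simp
  qed
  then have "AE x in lebesgue. x \<in> U \<longrightarrow> g x = 0"
    by (rule eventually_mono) (use D(4) in blast)
  then show ?thesis using Us by (simp add: AE_restrict_space_iff)
qed

text \<open>The common shape of the definitions of weak partial derivatives (\<open>s = -1\<close>) and of the weak
  Laplacian (\<open>s = 1\<close>).\<close>

definition weak_op ::
    "'a::euclidean_space set \<Rightarrow> (('a \<Rightarrow> complex) \<Rightarrow> 'a \<Rightarrow> complex) \<Rightarrow> complex \<Rightarrow> ('a \<Rightarrow> complex) \<Rightarrow> ('a \<Rightarrow> complex) \<Rightarrow> bool"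
  where "weak_op U D s u g \<longleftrightarrow> g \<in> L2 U \<and>
     (\<forall>\<phi>\<in>test_functions U. (LINT x|lebesgue_on U. u x * D \<phi> x) = s * (LINT x|lebesgue_on U. g x * \<phi> x))"

lemma is_weak_partial_iff: "is_weak_partial U b u g \<longleftrightarrow> weak_op U (partial b) (-1) u g"
  by (simp add: is_weak_partial_def weak_op_def)

lemma is_weak_laplacian_iff: "is_weak_laplacian U u g \<longleftrightarrow> weak_op U laplacian 1 u g"
  by (simp add: is_weak_laplacian_def weak_op_def)

lemma weak_op_unique:
  assumes "open U" "s \<noteq> 0" "weak_op U D s u g" "weak_op U D s u g'"
  shows "AE x in lebesgue_on U. g x = g' x"
proof -
  have g: "g \<in> L2 U" "g' \<in> L2 U" using assms(3,4) by (auto simp: weak_op_def)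
  have "AE x in lebesgue_on U. g x - g' x = 0"
  proof (rule fundamental_lemma[OF assms(1) L2_diff[OF g]])
    fix \<phi> assume \<phi>: "\<phi> \<in> test_functions U"
    note t = test_functions_L2[OF \<phi> open_sets_lebesgue[OF assms(1)]]
    have "(LINT x|lebesgue_on U. g x * \<phi> x) = (LINT x|lebesgue_on U. g' x * \<phi> x)"
      using assms \<phi> by (auto simp: weak_op_def)
    then show "(LINT x|lebesgue_on U. (g x - g' x) * \<phi> x) = 0"
      using L2_mult_integrable[OF g(1) t] L2_mult_integrable[OF g(2) t]
      by (simp add: left_diff_distrib)
  qed
  then show ?thesis by simp
qed

lemma weak_op_add:
  assumes "open U" "\<And>\<phi>. \<phi> \<in> test_functions U \<Longrightarrow> D \<phi> \<in> test_functions U"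
    and "u \<in> L2 U" "v \<in> L2 U" "weak_op U D s u g" "weak_op U D s v h"
  shows "weak_op U D s (\<lambda>x. u x + c * v x) (\<lambda>x. g x + c * h x)"
  unfolding weak_op_def
proof (intro conjI ballI)
  have gh: "g \<in> L2 U" "h \<in> L2 U" using assms by (auto simp: weak_op_def)
  then show "(\<lambda>x. g x + c * h x) \<in> L2 U" by (intro L2_add L2_scale)
  fix \<phi> assume \<phi>: "\<phi> \<in> test_functions U"
  note t = test_functions_L2[OF _ open_sets_lebesgue[OF assms(1)]]
  show "(LINT x|lebesgue_on U. (u x + c * v x) * D \<phi> x) = s * (LINT x|lebesgue_on U. (g x + c * h x) * \<phi> x)"
    using assms(5,6) \<phi>
    unfolding L2_integral_mult_add[OF assms(3,4) t[OF assms(2)[OF \<phi>]]] L2_integral_mult_add[OF gh t[OF \<phi>]]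
    by (simp add: weak_op_def algebra_simps)
qed

text \<open>Weak differential operators are closed: \<open>D \<phi>\<close> and
  \<open>\<phi>\<close> are both in \<open>L2 U\<close>, so by Cauchy-Schwarz both sides of the
  defining identity are continuous in the norm.\<close>

lemma weak_op_limit:
  assumes "open U" "\<And>\<phi>. \<phi> \<in> test_functions U \<Longrightarrow> D \<phi> \<in> test_functions U"
    and "\<And>k. u k \<in> L2 U" "v \<in> L2 U" "(\<lambda>k. L2_norm U (\<lambda>x. u k x - v x)) \<longlonglongrightarrow> 0"
    and "h \<in> L2 U" "(\<lambda>k. L2_norm U (\<lambda>x. g k x - h x)) \<longlonglongrightarrow> 0"
    and w: "\<And>k. weak_op U D s (u k) (g k)"
  shows "weak_op U D s v h"
  unfolding weak_op_def
proof (intro conjI ballI assms(6))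
  fix \<phi> assume \<phi>: "\<phi> \<in> test_functions U"
  note t = test_functions_L2[OF \<phi> open_sets_lebesgue[OF assms(1)]]
    test_functions_L2[OF assms(2)[OF \<phi>] open_sets_lebesgue[OF assms(1)]]
  have g: "g k \<in> L2 U" for k using w by (simp add: weak_op_def)
  have "(\<lambda>k. LINT x|lebesgue_on U. u k x * D \<phi> x) \<longlonglongrightarrow> (LINT x|lebesgue_on U. v x * D \<phi> x)"
    by (rule L2_integral_mult_tendsto[OF assms(3,4) t(2) assms(5)])
  moreover have "(LINT x|lebesgue_on U. u k x * D \<phi> x) = s * (LINT x|lebesgue_on U. g k x * \<phi> x)" for k
    using w \<phi> by (simp add: weak_op_def)
  moreover have "(\<lambda>k. s * (LINT x|lebesgue_on U. g k x * \<phi> x)) \<longlonglongrightarrow> s * (LINT x|lebesgue_on U. h x * \<phi> x)"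
    by (intro tendsto_mult tendsto_const L2_integral_mult_tendsto[OF g assms(6) t(1) assms(7)])
  ultimately show "(LINT x|lebesgue_on U. v x * D \<phi> x) = s * (LINT x|lebesgue_on U. h x * \<phi> x)"
    using LIMSEQ_unique by simp
qed

lemma is_weak_partial_weak_partial:
  "is_weak_partial U b u g \<Longrightarrow> is_weak_partial U b u (weak_partial U b u)"
  unfolding weak_partial_def by (rule someI[of "is_weak_partial U b u"])

lemma is_weak_laplacian_weak_laplacian:
  "is_weak_laplacian U u g \<Longrightarrow> is_weak_laplacian U u (weak_laplacian U u)"
  unfolding weak_laplacian_def by (rule someI[of "is_weak_laplacian U u"])

lemma weak_partial_AE_eq:
  assumes "open U" "is_weak_partial U b u g"
  shows "AE x in lebesgue_on U. weak_partial U b u x = g x"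
  using weak_op_unique[of U "-1" "partial b" u] is_weak_partial_weak_partial[OF assms(2)] assms
  by (simp add: is_weak_partial_iff)

lemma weak_laplacian_AE_eq:
  assumes "open U" "is_weak_laplacian U u g"
  shows "AE x in lebesgue_on U. weak_laplacian U u x = g x"
  using weak_op_unique[of U 1 laplacian u] is_weak_laplacian_weak_laplacian[OF assms(2)] assms
  by (simp add: is_weak_laplacian_iff)

lemma is_weak_partial_test_function:
  assumes "\<phi> \<in> test_functions V" "open U" "b \<in> Basis"
  shows "is_weak_partial U b \<phi> (partial b \<phi>)"
  unfolding is_weak_partial_def
proof (intro conjI ballI)
  note Us = open_sets_lebesgue[OF assms(2)]
  show "partial b \<phi> \<in> L2 U"
    by (rule test_functions_L2[OF test_functions_partial[OF assms(1,3)] Us])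
  fix \<psi> assume \<psi>: "\<psi> \<in> test_functions U"
  have m: "f \<in> borel_measurable borel" if "f \<in> test_functions W" for f :: "'a \<Rightarrow> complex" and W
    by (rule borel_measurable_continuous_onI[OF test_functions_continuous_on[OF that]])
  note p = test_functions_partial[OF \<psi> assms(3)] and q = test_functions_partial[OF assms(1,3)]
  have "(LINT x|lebesgue_on U. \<phi> x * partial b \<psi> x) = (LINT x|lborel. \<phi> x * partial b \<psi> x)"
    by (intro integral_lebesgue_on_eq_lborel borel_measurable_times m[OF assms(1)] m[OF p] Us)
       (simp add: test_functions_outside[OF p])
  moreover have "(LINT x|lebesgue_on U. partial b \<phi> x * \<psi> x) = (LINT x|lborel. partial b \<phi> x * \<psi> x)"
    by (intro integral_lebesgue_on_eq_lborel borel_measurable_times m[OF q] m[OF \<psi>] Us)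
       (simp add: test_functions_outside[OF \<psi>])
  ultimately show "(LINT x|lebesgue_on U. \<phi> x * partial b \<psi> x) = - (LINT x|lebesgue_on U. partial b \<phi> x * \<psi> x)"
    using integration_by_parts_test[OF assms(1) \<psi> assms(3)] by simp
qed

section \<open>The space \<open>H\<^sup>1\<^sub>0\<close>\<close>

lemma H10_L2: "u \<in> H10 U \<Longrightarrow> u \<in> L2 U"
  by (simp add: H10_def H1_def)

lemma H10_weak_partial:
  assumes "u \<in> H10 U" "b \<in> Basis"
  shows "is_weak_partial U b u (weak_partial U b u)" "weak_partial U b u \<in> L2 U"
proof -
  show "is_weak_partial U b u (weak_partial U b u)"
    using assms is_weak_partial_weak_partial unfolding H10_def H1_def by blast
  then show "weak_partial U b u \<in> L2 U" by (simp add: is_weak_partial_def)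
qed

lemma H10_approx:
  fixes u :: "'a::euclidean_space \<Rightarrow> complex"
  assumes "u \<in> H10 U" "e > 0"
  shows "\<exists>\<phi>\<in>test_functions U. L2_norm U (\<lambda>x. \<phi> x - u x) < e \<and>
    (\<forall>b\<in>Basis. L2_norm U (\<lambda>x. partial b \<phi> x - weak_partial U b u x) < e)"
proof -
  from assms obtain \<phi> where \<phi>: "\<And>k. \<phi> k \<in> test_functions U" and lim:
    "(\<lambda>k. (LINT x|lebesgue_on U. (norm (\<phi> k x - u x))\<^sup>2) +
        (\<Sum>b\<in>Basis. LINT x|lebesgue_on U. (norm (partial b (\<phi> k) x - weak_partial U b u x))\<^sup>2)) \<longlonglongrightarrow> 0"
    unfolding H10_def by blast
  have "e\<^sup>2 > 0" using assms(2) by simp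
  from order_tendstoD(2)[OF lim this] obtain k where k:
    "(LINT x|lebesgue_on U. (norm (\<phi> k x - u x))\<^sup>2) +
        (\<Sum>b\<in>Basis. LINT x|lebesgue_on U. (norm (partial b (\<phi> k) x - weak_partial U b u x))\<^sup>2) < e\<^sup>2"
    by (metis (lifting) eventually_sequentially order_refl)
  let ?S = "\<Sum>b\<in>(Basis::'a set). LINT x|lebesgue_on U. (norm (partial b (\<phi> k) x - weak_partial U b u x))\<^sup>2"
  have lt: "L2_norm U f < e" if "(LINT x|lebesgue_on U. (norm (f x))\<^sup>2) < e\<^sup>2" for f
    using that assms(2) by (intro power2_less_imp_less[of "L2_norm U f" e]) (auto simp: L2_norm_power2)
  have S: "?S \<ge> 0" by (intro sum_nonneg) simp
  have 1: "(LINT x|lebesgue_on U. (norm (\<phi> k x - u x))\<^sup>2) < e\<^sup>2" using k S by linarith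
  have 2: "(LINT x|lebesgue_on U. (norm (partial b (\<phi> k) x - weak_partial U b u x))\<^sup>2) < e\<^sup>2" if "b \<in> Basis" for b
  proof -
    have "(LINT x|lebesgue_on U. (norm (partial b (\<phi> k) x - weak_partial U b u x))\<^sup>2) \<le> ?S"
      using that by (intro member_le_sum) auto
    moreover have "0 \<le> (LINT x|lebesgue_on U. (norm (\<phi> k x - u x))\<^sup>2)" by simp
    ultimately show ?thesis using k by linarith
  qed
  show ?thesis using \<phi> lt[OF 1] lt[OF 2] by blast
qed

text \<open>Frees membership from the representatives selected by \<open>weak_partial\<close>: any
  weak derivatives \<open>g b\<close> serve, and approximation to every accuracy replaces the
  sequence.\<close>

lemma H10_I:
  fixes u :: "'a::euclidean_space \<Rightarrow> complex"
  assumes U: "open U" and u: "u \<in> L2 U" and g: "\<And>b. b \<in> Basis \<Longrightarrow> is_weak_partial U b u (g b)"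
    and approx: "\<And>e. e > 0 \<Longrightarrow> \<exists>\<phi>\<in>test_functions U. L2_norm U (\<lambda>x. \<phi> x - u x) \<le> e \<and>
    (\<forall>b\<in>Basis. L2_norm U (\<lambda>x. partial b \<phi> x - g b x) \<le> e)"
  shows "u \<in> H10 U"
proof -
  note Us = open_sets_lebesgue[OF U]
  have "u \<in> H1 U" using u g unfolding H1_def by blast
  moreover have "\<exists>\<phi> :: nat \<Rightarrow> 'a \<Rightarrow> complex. (\<forall>k. \<phi> k \<in> test_functions U) \<and>
     (\<lambda>k. (LINT x|lebesgue_on U. (norm (\<phi> k x - u x))\<^sup>2) +
        (\<Sum>b\<in>Basis. LINT x|lebesgue_on U. (norm (partial b (\<phi> k) x - weak_partial U b u x))\<^sup>2))
       \<longlonglongrightarrow> 0"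
  proof -
    have "\<exists>\<phi>. \<forall>k. \<phi> k \<in> test_functions U \<and> L2_norm U (\<lambda>x. \<phi> k x - u x) \<le> inverse (real (Suc k)) \<and>
      (\<forall>b\<in>Basis. L2_norm U (\<lambda>x. partial b (\<phi> k) x - g b x) \<le> inverse (real (Suc k)))"
    proof (intro choice allI)
      fix k
      have "inverse (real (Suc k)) > 0" by simp
      from approx[OF this] show "\<exists>\<phi>. \<phi> \<in> test_functions U \<and> L2_norm U (\<lambda>x. \<phi> x - u x) \<le> inverse (real (Suc k)) \<and>
      (\<forall>b\<in>Basis. L2_norm U (\<lambda>x. partial b \<phi> x - g b x) \<le> inverse (real (Suc k)))"
        by blast
    qed
    then obtain \<phi> where \<phi>: "\<And>k. \<phi> k \<in> test_functions U"
      and a: "\<And>k. L2_norm U (\<lambda>x. \<phi> k x - u x) \<le> inverse (real (Suc k))"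
      and b: "\<And>k b. b \<in> Basis \<Longrightarrow> L2_norm U (\<lambda>x. partial b (\<phi> k) x - g b x) \<le> inverse (real (Suc k))"
      by blast
    have a': "(\<lambda>k. L2_norm U (\<lambda>x. \<phi> k x - u x)) \<longlonglongrightarrow> 0"
      by (rule tendsto_sandwich[OF _ _ tendsto_const LIMSEQ_inverse_real_of_nat])
         (use a in \<open>auto intro: always_eventually\<close>)
    have b': "(\<lambda>k. L2_norm U (\<lambda>x. partial b (\<phi> k) x - weak_partial U b u x)) \<longlonglongrightarrow> 0" if "b \<in> Basis" for b
    proof (rule tendsto_sandwich[OF _ _ tendsto_const LIMSEQ_inverse_real_of_nat])
      have "L2_norm U (\<lambda>x. partial b (\<phi> k) x - weak_partial U b u x) = L2_norm U (\<lambda>x. partial b (\<phi> k) x - g b x)" for k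
      proof (rule L2_norm_cong_AE)
        note p = test_functions_L2[OF test_functions_partial[OF \<phi>[of k] that] Us]
        have gb: "g b \<in> L2 U" and wb: "weak_partial U b u \<in> L2 U"
          using g[OF that] is_weak_partial_weak_partial[OF g[OF that]] by (auto simp: is_weak_partial_def)
        show "(\<lambda>x. partial b (\<phi> k) x - weak_partial U b u x) \<in> borel_measurable (lebesgue_on U)"
          by (rule L2D(1)[OF L2_diff[OF p wb]])
        show "(\<lambda>x. partial b (\<phi> k) x - g b x) \<in> borel_measurable (lebesgue_on U)"
          by (rule L2D(1)[OF L2_diff[OF p gb]])
        show "AE x in lebesgue_on U. partial b (\<phi> k) x - weak_partial U b u x = partial b (\<phi> k) x - g b x"
          using weak_partial_AE_eq[OF U g[OF that]] by (rule eventually_mono) simp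
      qed
      then show "\<forall>\<^sub>F k in sequentially. L2_norm U (\<lambda>x. partial b (\<phi> k) x - weak_partial U b u x) \<le> inverse (real (Suc k))"
        using b[OF that] by (auto intro: always_eventually)
    qed auto
    have "(\<lambda>k. (L2_norm U (\<lambda>x. \<phi> k x - u x))\<^sup>2 +
        (\<Sum>b\<in>Basis. (L2_norm U (\<lambda>x. partial b (\<phi> k) x - weak_partial U b u x))\<^sup>2)) \<longlonglongrightarrow> 0\<^sup>2 + (\<Sum>b\<in>(Basis::'a set). 0\<^sup>2)"
      by (intro tendsto_add tendsto_sum tendsto_power a' b')
    then show ?thesis using \<phi> by (intro exI[of _ \<phi>]) (simp add: L2_norm_power2)
  qed
  ultimately show ?thesis unfolding H10_def by simp
qed

lemma test_functions_subset_H10: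
  assumes "open U" "\<phi> \<in> test_functions U"
  shows "\<phi> \<in> H10 U"
proof (rule H10_I[OF assms(1) test_functions_L2[OF assms(2) open_sets_lebesgue[OF assms(1)]]])
  show "is_weak_partial U b \<phi> (partial b \<phi>)" if "b \<in> Basis" for b
    by (rule is_weak_partial_test_function[OF assms(2,1) that])
  show "\<exists>\<phi>'\<in>test_functions U. L2_norm U (\<lambda>x. \<phi>' x - \<phi> x) \<le> e \<and>
    (\<forall>b\<in>Basis. L2_norm U (\<lambda>x. partial b \<phi>' x - partial b \<phi> x) \<le> e)" if "e > 0" for e
    using that assms(2) by (intro bexI[of _ \<phi>]) (auto simp: L2_norm_def)
qed

lemma H10_add:
  fixes u v :: "'a::euclidean_space \<Rightarrow> complex"
  assumes U: "open U" and u: "u \<in> H10 U" and v: "v \<in> H10 U"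
  shows "(\<lambda>x. u x + c * v x) \<in> H10 U"
    and "b \<in> Basis \<Longrightarrow> is_weak_partial U b (\<lambda>x. u x + c * v x) (\<lambda>x. weak_partial U b u x + c * weak_partial U b v x)"
proof -
  note Us = open_sets_lebesgue[OF U]
  show *: "is_weak_partial U b (\<lambda>x. u x + c * v x) (\<lambda>x. weak_partial U b u x + c * weak_partial U b v x)"
    if "b \<in> Basis" for b
    using weak_op_add[OF U test_functions_partial[OF _ that] H10_L2[OF u] H10_L2[OF v]]
      H10_weak_partial(1)[OF u that] H10_weak_partial(1)[OF v that]
    by (simp add: is_weak_partial_iff)
  show "(\<lambda>x. u x + c * v x) \<in> H10 U"
  proof (rule H10_I[OF U _ *])
    show "(\<lambda>x. u x + c * v x) \<in> L2 U" using H10_L2[OF u] H10_L2[OF v] by (intro L2_add L2_scale)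
    fix e :: real assume "e > 0"
    \<comment> \<open>The \<open>+ 1\<close> keeps the denominator positive when
      \<open>c = 0\<close>.\<close>
    then have e: "e/2 > 0" "e / (2 * (norm c + 1)) > 0"
      by (simp_all add: add_nonneg_pos)
    from H10_approx[OF u e(1)] obtain \<phi> where \<phi>: "\<phi> \<in> test_functions U" "L2_norm U (\<lambda>x. \<phi> x - u x) < e/2"
      "\<And>b. b \<in> Basis \<Longrightarrow> L2_norm U (\<lambda>x. partial b \<phi> x - weak_partial U b u x) < e/2" by blast
    from H10_approx[OF v e(2)] obtain \<psi> where \<psi>: "\<psi> \<in> test_functions U" "L2_norm U (\<lambda>x. \<psi> x - v x) < e / (2 * (norm c + 1))"
      "\<And>b. b \<in> Basis \<Longrightarrow> L2_norm U (\<lambda>x. partial b \<psi> x - weak_partial U b v x) < e / (2 * (norm c + 1))" by blast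
    have est: "L2_norm U (\<lambda>x. (p x + c * q x) - (r x + c * s x)) \<le> e"
      if "p \<in> L2 U" "q \<in> L2 U" "r \<in> L2 U" "s \<in> L2 U" "L2_norm U (\<lambda>x. p x - r x) < e/2"
        "L2_norm U (\<lambda>x. q x - s x) < e / (2 * (norm c + 1))" for p q r s
    proof -
      have "L2_norm U (\<lambda>x. (p x + c * q x) - (r x + c * s x)) = L2_norm U (\<lambda>x. (p x - r x) + c * (q x - s x))"
        by (simp add: algebra_simps)
      also have "\<dots> \<le> L2_norm U (\<lambda>x. p x - r x) + L2_norm U (\<lambda>x. c * (q x - s x))"
        using that by (intro L2_norm_triangle L2_scale L2_diff)
      also have "L2_norm U (\<lambda>x. c * (q x - s x)) = norm c * L2_norm U (\<lambda>x. q x - s x)"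
        by (rule L2_norm_scale)
      also have "\<dots> \<le> (norm c + 1) * (e / (2 * (norm c + 1)))"
        using that(6) by (intro mult_mono) auto
      also have "\<dots> = e / 2"
      proof -
        have "w * (e / (2 * w)) = e / 2" if "w \<noteq> 0" for w :: real
          using that by simp
        moreover have "norm c + 1 \<noteq> 0" using norm_ge_zero[of c] by linarith
        ultimately show ?thesis by blast
      qed
      finally show ?thesis using that(5) by simp
    qed
    show "\<exists>\<phi>\<in>test_functions U. L2_norm U (\<lambda>x. \<phi> x - (u x + c * v x)) \<le> e \<and>
      (\<forall>b\<in>Basis. L2_norm U (\<lambda>x. partial b \<phi> x - (weak_partial U b u x + c * weak_partial U b v x)) \<le> e)"
    proof (intro bexI conjI ballI)
      show "(\<lambda>x. \<phi> x + c * \<psi> x) \<in> test_functions U" by (rule test_functions_add[OF \<phi>(1) \<psi>(1)])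
      show "L2_norm U (\<lambda>x. (\<phi> x + c * \<psi> x) - (u x + c * v x)) \<le> e"
        by (intro est \<phi>(2) \<psi>(2) test_functions_L2[OF \<phi>(1) Us] test_functions_L2[OF \<psi>(1) Us] H10_L2 u v)
      fix b :: 'a assume b: "b \<in> Basis"
      show "L2_norm U (\<lambda>x. partial b (\<lambda>x. \<phi> x + c * \<psi> x) x - (weak_partial U b u x + c * weak_partial U b v x)) \<le> e"
        unfolding partial_add[OF test_functionsD(1)[OF \<phi>(1)] test_functionsD(1)[OF \<psi>(1)]]
        by (intro est \<phi>(3) \<psi>(3) test_functions_L2[OF test_functions_partial[OF \<phi>(1)] Us]
            test_functions_L2[OF test_functions_partial[OF \<psi>(1)] Us] H10_weak_partial(2) u v b)
    qed
  qed
qed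

text \<open>Closedness of \<open>H10\<close> under convergence of functions and derivatives: one
  \<open>u k\<close> close to \<open>v\<close> is itself approximated by a test function, each with
  half of the error.\<close>

lemma H10_limit:
  fixes u :: "nat \<Rightarrow> 'a::euclidean_space \<Rightarrow> complex"
  assumes U: "open U" and u: "\<And>k. u k \<in> H10 U" and v: "v \<in> L2 U"
    and lim: "(\<lambda>k. L2_norm U (\<lambda>x. u k x - v x)) \<longlonglongrightarrow> 0"
    and g: "\<And>b. b \<in> Basis \<Longrightarrow> g b \<in> L2 U"
    and glim: "\<And>b. b \<in> Basis \<Longrightarrow> (\<lambda>k. L2_norm U (\<lambda>x. weak_partial U b (u k) x - g b x)) \<longlonglongrightarrow> 0"
  shows "v \<in> H10 U" "b \<in> Basis \<Longrightarrow> is_weak_partial U b v (g b)"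
proof -
  note Us = open_sets_lebesgue[OF U]
  show *: "is_weak_partial U b v (g b)" if "b \<in> Basis" for b
    using weak_op_limit[OF U test_functions_partial[OF _ that] H10_L2[OF u] v lim g[OF that] glim[OF that]]
      H10_weak_partial(1)[OF u that] by (simp add: is_weak_partial_iff)
  show "v \<in> H10 U"
  proof (rule H10_I[OF U v *])
    fix e :: real assume "e > 0"
    then have e: "e/2 > 0" by simp
    have "\<forall>\<^sub>F k in sequentially. L2_norm U (\<lambda>x. u k x - v x) < e/2 \<and>
        (\<forall>b\<in>Basis. L2_norm U (\<lambda>x. weak_partial U b (u k) x - g b x) < e/2)"
      using order_tendstoD(2)[OF lim e] order_tendstoD(2)[OF glim e]
      by (intro eventually_conj eventually_ball_finite) auto
    then obtain k where k: "L2_norm U (\<lambda>x. u k x - v x) < e/2"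
        "\<And>b. b \<in> Basis \<Longrightarrow> L2_norm U (\<lambda>x. weak_partial U b (u k) x - g b x) < e/2"
      using eventually_happens'[OF sequentially_bot] by blast
    from H10_approx[OF u e, of k] obtain \<phi> where \<phi>: "\<phi> \<in> test_functions U" "L2_norm U (\<lambda>x. \<phi> x - u k x) < e/2"
      "\<And>b. b \<in> Basis \<Longrightarrow> L2_norm U (\<lambda>x. partial b \<phi> x - weak_partial U b (u k) x) < e/2" by blast
    show "\<exists>\<phi>\<in>test_functions U. L2_norm U (\<lambda>x. \<phi> x - v x) \<le> e \<and>
      (\<forall>b\<in>Basis. L2_norm U (\<lambda>x. partial b \<phi> x - g b x) \<le> e)"
    proof (intro bexI[of _ \<phi>] conjI ballI \<phi>(1))
      show "L2_norm U (\<lambda>x. \<phi> x - v x) \<le> e"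
        using L2_norm_triangle_diff[OF test_functions_L2[OF \<phi>(1) Us] H10_L2[OF u] v, of k] \<phi>(2) k(1) by simp
      fix b :: 'a assume b: "b \<in> Basis"
      show "L2_norm U (\<lambda>x. partial b \<phi> x - g b x) \<le> e"
        using L2_norm_triangle_diff[OF test_functions_L2[OF test_functions_partial[OF \<phi>(1) b] Us]
            H10_weak_partial(2)[OF u b] g[OF b], of k] \<phi>(3)[OF b] k(2)[OF b] by simp
    qed
  qed
qed

section \<open>The Poincare inequality and Rellich compactness\<close>

text \<open>The Dirichlet energy, taken over the whole space so that a test function has the same
  energy whether it is regarded on the domain or on the inner domain.\<close>

definition grad_norm2 :: "('a::euclidean_space \<Rightarrow> complex) \<Rightarrow> real" where
  "grad_norm2 \<phi> = (\<Sum>b\<in>Basis. (L2_norm UNIV (partial b \<phi>))\<^sup>2)"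

lemma grad_norm2_nonneg: "0 \<le> grad_norm2 \<phi>"
  unfolding grad_norm2_def by (intro sum_nonneg) simp

lemma L2_norm_test_eq:
  assumes "\<phi> \<in> test_functions U" "open U"
  shows "L2_norm U \<phi> = L2_norm UNIV \<phi>"
proof -
  have m: "(\<lambda>x. (norm (\<phi> x))\<^sup>2) \<in> borel_measurable borel"
    by (intro borel_measurable_continuous_onI continuous_intros test_functions_continuous_on[OF assms(1)])
  have "(LINT x|lebesgue_on U. (norm (\<phi> x))\<^sup>2) = (LINT x|lborel. (norm (\<phi> x))\<^sup>2)"
    by (rule integral_lebesgue_on_eq_lborel[OF m open_sets_lebesgue[OF assms(2)]])
       (simp add: test_functions_outside[OF assms(1)])
  moreover have "(LINT x|lebesgue_on UNIV. (norm (\<phi> x))\<^sup>2) = (LINT x|lborel. (norm (\<phi> x))\<^sup>2)"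
    by (rule integral_lebesgue_on_eq_lborel[OF m]) auto
  ultimately show ?thesis by (simp add: L2_norm_def)
qed

lemma L2_norm_UNIV_lborel:
  assumes "continuous_on UNIV f"
  shows "(L2_norm UNIV f)\<^sup>2 = (LINT x|lborel. (norm (f x))\<^sup>2)"
  unfolding L2_norm_power2
  by (rule integral_lebesgue_on_eq_lborel) (auto intro!: borel_measurable_continuous_onI continuous_intros assms)

lemma test_functions_UNIV: "\<phi> \<in> test_functions U \<Longrightarrow> \<phi> \<in> test_functions UNIV"
  using test_functions_mono[of U UNIV] by blast

lemma test_functions_diff:
  assumes "\<phi> \<in> test_functions U" "\<psi> \<in> test_functions U"
  shows "(\<lambda>x. \<phi> x - \<psi> x) \<in> test_functions U"
  using test_functions_add[OF assms, of "-1"] by simp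

lemma test_functions_L2_UNIV: "\<phi> \<in> test_functions U \<Longrightarrow> \<phi> \<in> L2 UNIV"
  by (rule test_functions_L2) auto

section \<open>Translation estimates\<close>

lemma L2_norm_translate:
  assumes "\<phi> \<in> test_functions U"
  shows "L2_norm UNIV (\<lambda>x. \<phi> (x + h)) = L2_norm UNIV \<phi>"
proof -
  note c = test_functions_continuous_on[OF assms]
    and c' = test_functions_continuous_on[OF test_functions_translate[OF assms]]
  have "(LINT x|lborel. (norm (\<phi> (x + h)))\<^sup>2) = (LINT x|lborel. (norm (\<phi> x))\<^sup>2)"
    by (rule integral_lborel_translate[of "\<lambda>x. (norm (\<phi> x))\<^sup>2"])
       (intro borel_measurable_continuous_onI continuous_intros c)
  then have "(L2_norm UNIV (\<lambda>x. \<phi> (x + h)))\<^sup>2 = (L2_norm UNIV \<phi>)\<^sup>2"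
    unfolding L2_norm_UNIV_lborel[OF c] L2_norm_UNIV_lborel[OF c'] .
  then show ?thesis by simp
qed

lemma L2_norm_iterated_translate:
  assumes "\<phi> \<in> test_functions U"
  shows "L2_norm UNIV (\<lambda>x. \<phi> (x + real j *\<^sub>R s) - \<phi> x) \<le> real j * L2_norm UNIV (\<lambda>x. \<phi> (x + s) - \<phi> x)"
proof (induction j)
  case 0
  then show ?case by (simp add: L2_norm_def)
next
  case (Suc j)
  let ?t = "real j *\<^sub>R s"
  note T = test_functions_translate[OF assms]
  have "L2_norm UNIV (\<lambda>x. \<phi> (x + real (Suc j) *\<^sub>R s) - \<phi> x)
     \<le> L2_norm UNIV (\<lambda>x. \<phi> (x + real (Suc j) *\<^sub>R s) - \<phi> (x + s)) + L2_norm UNIV (\<lambda>x. \<phi> (x + s) - \<phi> x)"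
    by (intro L2_norm_triangle_diff test_functions_L2_UNIV[OF T] test_functions_L2_UNIV[OF assms])
  also have "L2_norm UNIV (\<lambda>x. \<phi> (x + real (Suc j) *\<^sub>R s) - \<phi> (x + s)) = L2_norm UNIV (\<lambda>x. \<phi> (x + ?t) - \<phi> x)"
    using L2_norm_translate[OF test_functions_diff[OF T[of ?t] test_functions_UNIV[OF assms]], of s]
    by (simp add: algebra_simps)
  finally show ?case using Suc by (simp add: algebra_simps)
qed

text \<open>The translation by \<open>h\<close> is split into \<open>Suc k\<close> equal steps,
  which all cost the same by translation invariance. The resulting bound is the norm of a difference
  quotient, and it tends to the norm of the directional derivative.\<close>

lemma L2_norm_translate_le:
  assumes "\<phi> \<in> test_functions U"
  shows "L2_norm UNIV (\<lambda>x. \<phi> (x + h) - \<phi> x) \<le> L2_norm UNIV (\<lambda>x. frechet_derivative \<phi> (at x) h)"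
proof -
  let ?d = "\<lambda>k x. of_nat (Suc k) * (\<phi> (x + h /\<^sub>R real (Suc k)) - \<phi> x)"
  obtain B R where BR: "B \<ge> 0" "\<And>k x. norm (?d k x) \<le> B * indicator (cball 0 R) x"
    using test_functions_difference_quotient(1)[OF assms, of h] by blast
  note lim = test_functions_difference_quotient(2)[OF assms, of _ h]
  note c = test_functions_continuous_on[OF assms]
    and cT = test_functions_continuous_on[OF test_functions_translate[OF assms]]
  have cd: "continuous_on UNIV (?d k)" for k
    by (intro continuous_intros c cT)
  have cD: "continuous_on UNIV (\<lambda>x. frechet_derivative \<phi> (at x) h)"
    by (rule smooth_on_frechet_derivative_continuous_on[OF test_functionsD(1)[OF assms]])
  have le: "L2_norm UNIV (\<lambda>x. \<phi> (x + h) - \<phi> x) \<le> L2_norm UNIV (?d k)" for k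
  proof -
    have "L2_norm UNIV (?d k) = real (Suc k) * L2_norm UNIV (\<lambda>x. \<phi> (x + h /\<^sub>R real (Suc k)) - \<phi> x)"
      using L2_norm_scale[of UNIV "of_nat (Suc k)"] by (simp only: norm_of_nat)
    also have "\<dots> \<ge> L2_norm UNIV (\<lambda>x. \<phi> (x + real (Suc k) *\<^sub>R (h /\<^sub>R real (Suc k))) - \<phi> x)"
      by (rule L2_norm_iterated_translate[OF assms])
    finally show ?thesis by (simp del: of_nat_Suc)
  qed
  have "(\<lambda>k. LINT x|lborel. (norm (?d k x))\<^sup>2) \<longlonglongrightarrow> (LINT x|lborel. (norm (frechet_derivative \<phi> (at x) h))\<^sup>2)"
  proof (rule integral_dominated_convergence)
    show "integrable lborel (\<lambda>x::'a. B\<^sup>2 * indicator (cball 0 R) x)"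
      using emeasure_lborel_cball_finite[of "0::'a" R]
      by (intro integrable_mult_right) (simp add: integrable_indicator_iff)
    show "(\<lambda>x. (norm (frechet_derivative \<phi> (at x) h))\<^sup>2) \<in> borel_measurable lborel"
      unfolding measurable_lborel2 by (intro borel_measurable_continuous_onI continuous_intros cD)
    show "(\<lambda>x. (norm (?d k x))\<^sup>2) \<in> borel_measurable lborel" for k
      unfolding measurable_lborel2 by (intro borel_measurable_continuous_onI continuous_on_power continuous_on_norm cd)
    show "AE x in lborel. (\<lambda>k. (norm (?d k x))\<^sup>2) \<longlonglongrightarrow> (norm (frechet_derivative \<phi> (at x) h))\<^sup>2"
      by (intro AE_I2 tendsto_power tendsto_norm lim)
    show "AE x in lborel. norm ((norm (?d k x))\<^sup>2) \<le> B\<^sup>2 * indicator (cball 0 R) x" for k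
    proof (rule AE_I2)
      fix x
      have "(norm (?d k x))\<^sup>2 \<le> (B * indicator (cball 0 R) x)\<^sup>2"
        by (intro power_mono BR) auto
      also have "\<dots> = B\<^sup>2 * indicator (cball 0 R) x" by (simp add: indicator_def)
      finally show "norm ((norm (?d k x))\<^sup>2) \<le> B\<^sup>2 * indicator (cball 0 R) x" by simp
    qed
  qed
  then have "(\<lambda>k. (L2_norm UNIV (?d k))\<^sup>2) \<longlonglongrightarrow> (L2_norm UNIV (\<lambda>x. frechet_derivative \<phi> (at x) h))\<^sup>2"
    unfolding L2_norm_UNIV_lborel[OF cd] L2_norm_UNIV_lborel[OF cD] .
  then have "(L2_norm UNIV (\<lambda>x. \<phi> (x + h) - \<phi> x))\<^sup>2 \<le> (L2_norm UNIV (\<lambda>x. frechet_derivative \<phi> (at x) h))\<^sup>2"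
    by (rule LIMSEQ_le_const) (use le in \<open>auto intro!: power_mono exI[of _ 0]\<close>)
  then show ?thesis by (rule power2_le_imp_le) simp
qed

lemma directional_derivative_bound:
  fixes \<phi> :: "'a::euclidean_space \<Rightarrow> complex"
  assumes "smooth_on UNIV \<phi>"
  shows "(norm (frechet_derivative \<phi> (at x) h))\<^sup>2 \<le> (norm h)\<^sup>2 * (\<Sum>b\<in>Basis. (norm (frechet_derivative \<phi> (at x) b))\<^sup>2)"
proof -
  have "frechet_derivative \<phi> (at x) h = (\<Sum>b\<in>Basis. (h \<bullet> b) *\<^sub>R frechet_derivative \<phi> (at x) b)"
    by (rule frechet_derivative_Basis[OF assms])
  also have "norm \<dots> \<le> (\<Sum>b\<in>Basis. \<bar>h \<bullet> b\<bar> * norm (frechet_derivative \<phi> (at x) b))"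
    by (intro sum_norm_le) simp
  finally have "(norm (frechet_derivative \<phi> (at x) h))\<^sup>2 \<le> (\<Sum>b\<in>Basis. \<bar>h \<bullet> b\<bar> * norm (frechet_derivative \<phi> (at x) b))\<^sup>2"
    by (intro power_mono) auto
  also have "\<dots> \<le> (\<Sum>b\<in>Basis. \<bar>h \<bullet> b\<bar>\<^sup>2) * (\<Sum>b\<in>Basis. (norm (frechet_derivative \<phi> (at x) b))\<^sup>2)"
    by (rule Cauchy_Schwarz_ineq_sum)
  also have "(\<Sum>b\<in>Basis. \<bar>h \<bullet> b\<bar>\<^sup>2) = (norm h)\<^sup>2"
    unfolding power2_norm_eq_inner euclidean_inner[of h h] by (simp add: power2_eq_square)
  finally show ?thesis .
qed

lemma L2_norm_directional_le:
  assumes "\<phi> \<in> test_functions U"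
  shows "(L2_norm UNIV (\<lambda>x. frechet_derivative \<phi> (at x) h))\<^sup>2 \<le> (norm h)\<^sup>2 * grad_norm2 \<phi>"
proof -
  note sm = test_functionsD(1)[OF assms]
  have cD: "continuous_on UNIV (\<lambda>x. frechet_derivative \<phi> (at x) h)" for h
    by (rule smooth_on_frechet_derivative_continuous_on[OF sm])
  obtain K where K: "compact K" "\<And>x. x \<notin> K \<Longrightarrow> \<phi> x = 0"
    using test_functions_support[OF assms] by blast
  have z: "frechet_derivative \<phi> (at x) h = 0" if "x \<notin> K" for x h
    by (rule frechet_derivative_eq_0_outside[OF compact_imp_closed[OF K(1)] K(2) that])
  have int: "integrable lborel (\<lambda>x. (norm (frechet_derivative \<phi> (at x) h))\<^sup>2)" for h
    by (rule continuous_compact_support_integrable[OF _ K(1)]) (auto intro!: continuous_intros cD simp: z)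
  note pt = directional_derivative_bound[OF sm, of _ h]
  have "(L2_norm UNIV (\<lambda>x. frechet_derivative \<phi> (at x) h))\<^sup>2 = (LINT x|lborel. (norm (frechet_derivative \<phi> (at x) h))\<^sup>2)"
    by (rule L2_norm_UNIV_lborel[OF cD])
  also have "\<dots> \<le> (LINT x|lborel. (norm h)\<^sup>2 * (\<Sum>b\<in>Basis. (norm (frechet_derivative \<phi> (at x) b))\<^sup>2))"
    by (intro integral_mono int integrable_mult_right Bochner_Integration.integrable_sum pt)
  also have "\<dots> = (norm h)\<^sup>2 * (\<Sum>b\<in>Basis. LINT x|lborel. (norm (frechet_derivative \<phi> (at x) b))\<^sup>2)"
    by (simp add: int)
  also have "(\<Sum>b\<in>Basis. LINT x|lborel. (norm (frechet_derivative \<phi> (at x) b))\<^sup>2) = grad_norm2 \<phi>"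
    unfolding grad_norm2_def partial_def[abs_def] L2_norm_UNIV_lborel[OF cD] ..
  finally show ?thesis .
qed

lemma L2_norm_translate_grad:
  assumes "\<phi> \<in> test_functions U"
  shows "L2_norm UNIV (\<lambda>x. \<phi> (x + h) - \<phi> x) \<le> norm h * sqrt (grad_norm2 \<phi>)"
proof -
  have "(L2_norm UNIV (\<lambda>x. \<phi> (x + h) - \<phi> x))\<^sup>2 \<le> (norm h * sqrt (grad_norm2 \<phi>))\<^sup>2"
    using order_trans[OF power_mono[OF L2_norm_translate_le[OF assms, of h] L2_norm_nonneg, of 2]
      L2_norm_directional_le[OF assms, of h]]
    by (simp add: power_mult_distrib grad_norm2_nonneg)
  then show ?thesis by (rule power2_le_imp_le) (simp add: grad_norm2_nonneg)
qed

text \<open>For a translation by the diameter the supports of \<open>\<phi>\<close> and of its translate are disjoint, so the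
  translation estimate is already the Poincare inequality.\<close>

lemma Poincare_test:
  fixes \<phi> :: "'a::euclidean_space \<Rightarrow> complex"
  assumes "\<phi> \<in> test_functions U" "U \<subseteq> ball 0 R" "R > 0"
  shows "(L2_norm UNIV \<phi>)\<^sup>2 \<le> 2 * R\<^sup>2 * grad_norm2 \<phi>"
proof -
  obtain b :: 'a where b: "b \<in> Basis" using nonempty_Basis by blast
  define h where "h = (2 * R) *\<^sub>R b"
  have nh: "norm h = 2 * R" using b assms(3) by (simp add: h_def)
  have disj: "\<phi> (x + h) = 0 \<or> \<phi> x = 0" for x
  proof (rule ccontr)
    assume "\<not> ?thesis"
    then have "x + h \<in> U" "x \<in> U" using test_functions_outside[OF assms(1)] by auto
    then have "norm (x + h) < R" "norm x < R" using assms(2) by auto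
    moreover have "norm h \<le> norm (x + h) + norm x"
      using norm_triangle_ineq4[of "x + h" x] by simp
    ultimately show False using nh by linarith
  qed
  note c = test_functions_continuous_on[OF assms(1)]
    and T = test_functions_translate[OF assms(1), of h]
  note cT = test_functions_continuous_on[OF T]
  have "(L2_norm UNIV (\<lambda>x. \<phi> (x + h) - \<phi> x))\<^sup>2 = (LINT x|lborel. (norm (\<phi> (x + h) - \<phi> x))\<^sup>2)"
    by (intro L2_norm_UNIV_lborel continuous_intros c cT)
  also have "\<dots> = (LINT x|lborel. (norm (\<phi> (x + h)))\<^sup>2 + (norm (\<phi> x))\<^sup>2)"
  proof (rule Bochner_Integration.integral_cong)
    show "(norm (\<phi> (x + h) - \<phi> x))\<^sup>2 = (norm (\<phi> (x + h)))\<^sup>2 + (norm (\<phi> x))\<^sup>2" for x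
      using disj[of x] by auto
  qed simp
  also have "\<dots> = (LINT x|lborel. (norm (\<phi> (x + h)))\<^sup>2) + (LINT x|lborel. (norm (\<phi> x))\<^sup>2)"
    by (rule Bochner_Integration.integral_add[OF test_functions_integrable(2)[OF T] test_functions_integrable(2)[OF assms(1)]])
  also have "\<dots> = (L2_norm UNIV (\<lambda>x. \<phi> (x + h)))\<^sup>2 + (L2_norm UNIV \<phi>)\<^sup>2"
    unfolding L2_norm_UNIV_lborel[OF c] L2_norm_UNIV_lborel[OF cT] ..
  also have "\<dots> = 2 * (L2_norm UNIV \<phi>)\<^sup>2"
    unfolding L2_norm_translate[OF assms(1)] by simp
  finally have "2 * (L2_norm UNIV \<phi>)\<^sup>2 = (L2_norm UNIV (\<lambda>x. \<phi> (x + h) - \<phi> x))\<^sup>2" by simp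
  also have "\<dots> \<le> (2 * R * sqrt (grad_norm2 \<phi>))\<^sup>2"
    using L2_norm_translate_grad[OF assms(1), of h] nh by (intro power_mono) auto
  also have "\<dots> = 4 * R\<^sup>2 * grad_norm2 \<phi>"
    by (simp add: power_mult_distrib grad_norm2_nonneg)
  finally show ?thesis by (simp add: algebra_simps)
qed

subsection \<open>Averages over small balls\<close>

text \<open>Convolution with the normalized indicator of a ball. The increment is the variable of
  integration, so that translating the argument amounts to translating
  \<open>\<phi>\<close>.\<close>

definition ball_average :: "real \<Rightarrow> ('a::euclidean_space \<Rightarrow> complex) \<Rightarrow> 'a \<Rightarrow> complex" where
  "ball_average e \<phi> x = (LINT z|lebesgue_on (cball 0 e). \<phi> (x + z)) / of_real (measure lborel (cball 0 e :: 'a set))"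

lemma continuous_L2_cball:
  fixes g :: "'a::euclidean_space \<Rightarrow> complex"
  assumes "continuous_on UNIV g"
  shows "g \<in> L2 (cball 0 e)"
proof -
  have "integrable lborel (\<lambda>x. indicator (cball 0 e) x *\<^sub>R (norm (g x))\<^sup>2)"
    using continuous_on_subset[OF assms] by (intro borel_integrable_compact continuous_intros) auto
  then have "integrable (lebesgue_on (cball 0 e)) (\<lambda>x. indicator (cball 0 e) x *\<^sub>R (norm (g x))\<^sup>2)"
    by (rule integrable_lborel_imp_lebesgue_on) simp
  then have "integrable (lebesgue_on (cball 0 e)) (\<lambda>x. (norm (g x))\<^sup>2)"
    by (rule Bochner_Integration.integrable_cong[THEN iffD1, rotated 2]) auto
  then show ?thesis
    using continuous_borel_measurable_lebesgue_on[OF assms] by (simp add: L2_def)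
qed

lemma measure_cball_pos: "e > 0 \<Longrightarrow> measure lborel (cball (0::'a::euclidean_space) e) > 0"
  using content_cball_pos[of e "0::'a"] by simp

lemma integral_cball_Cauchy_Schwarz:
  fixes g :: "'a::euclidean_space \<Rightarrow> complex"
  assumes "continuous_on UNIV g"
  shows "norm (LINT z|lebesgue_on (cball 0 e). g z) \<le> L2_norm (cball 0 e) g * sqrt (measure lborel (cball (0::'a) e))"
proof -
  have "norm (LINT z|lebesgue_on (cball 0 e). g z * 1) \<le> L2_norm (cball 0 e) g * L2_norm (cball 0 e) (\<lambda>z::'a. 1)"
    by (rule L2_Cauchy_Schwarz_mult[of g _ "\<lambda>z. 1"])
       (intro continuous_L2_cball assms continuous_on_const)+
  moreover have "L2_norm (cball 0 e) (\<lambda>z::'a. 1) = sqrt (measure lborel (cball (0::'a) e))"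
    by (simp add: L2_norm_def measure_restrict_space)
  ultimately show ?thesis by simp
qed

lemma ball_average_bound:
  fixes \<phi> :: "'a::euclidean_space \<Rightarrow> complex"
  assumes "\<phi> \<in> test_functions U" "e > 0"
  shows "norm (ball_average e \<phi> x) \<le> L2_norm UNIV \<phi> / sqrt (measure lborel (cball (0::'a) e))"
proof -
  let ?v = "measure lborel (cball (0::'a) e)"
  note v = measure_cball_pos[OF assms(2), where 'a = 'a]
  have T: "(\<lambda>z. \<phi> (z + x)) \<in> test_functions UNIV" by (rule test_functions_translate[OF assms(1)])
  have "norm (LINT z|lebesgue_on (cball 0 e). \<phi> (z + x)) \<le> L2_norm (cball 0 e) (\<lambda>z. \<phi> (z + x)) * sqrt ?v"
    by (rule integral_cball_Cauchy_Schwarz[OF test_functions_continuous_on[OF T]])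
  also have "\<dots> \<le> L2_norm UNIV (\<lambda>z. \<phi> (z + x)) * sqrt ?v"
    by (intro mult_right_mono L2_norm_mono test_functions_L2_UNIV[OF T]) auto
  also have "\<dots> = L2_norm UNIV \<phi> * sqrt ?v" by (simp add: L2_norm_translate[OF assms(1)])
  finally have "norm (ball_average e \<phi> x) \<le> L2_norm UNIV \<phi> * sqrt ?v / ?v"
    using v by (simp add: ball_average_def norm_divide divide_right_mono add.commute)
  also have "\<dots> = L2_norm UNIV \<phi> / sqrt ?v"
    using v by (simp add: field_simps)
  finally show ?thesis .
qed

lemma ball_average_diff:
  assumes "\<phi> \<in> test_functions U" "\<psi> \<in> test_functions V"
  shows "ball_average e (\<lambda>x. \<phi> x - \<psi> x) x = ball_average e \<phi> x - ball_average e \<psi> x"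
proof -
  have i: "integrable (lebesgue_on (cball 0 e)) (\<lambda>z. f (x + z))" if "f \<in> test_functions W" for f and W :: "'a set"
  proof -
    have T: "(\<lambda>z. f (z + x)) \<in> test_functions UNIV" by (rule test_functions_translate[OF that])
    have "integrable (lebesgue_on (cball 0 e)) (\<lambda>z. f (z + x) * 1)"
      by (intro L2_mult_integrable continuous_L2_cball test_functions_continuous_on[OF T] continuous_on_const)
    then show ?thesis by (simp add: add.commute)
  qed
  show ?thesis
    unfolding ball_average_def using i[OF assms(1)] i[OF assms(2)] by (simp add: diff_divide_distrib)
qed

lemma ball_average_translate: "ball_average e \<phi> (x + h) = ball_average e (\<lambda>x. \<phi> (x + h)) x"
  by (simp add: ball_average_def algebra_simps)

text \<open>The difference of two averages is the average of \<open>\<phi>\<close> translated minus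
  \<open>\<phi>\<close>, which the translation estimate controls. For fixed \<open>e\<close> an
  energy bound therefore makes a family of averages equicontinuous.\<close>

lemma ball_average_Lipschitz:
  fixes \<phi> :: "'a::euclidean_space \<Rightarrow> complex"
  assumes "\<phi> \<in> test_functions U" "e > 0"
  shows "norm (ball_average e \<phi> x - ball_average e \<phi> y)
    \<le> norm (x - y) * sqrt (grad_norm2 \<phi>) / sqrt (measure lborel (cball (0::'a) e))"
proof -
  let ?v = "measure lborel (cball (0::'a) e)"
  let ?h = "x - y"
  note T = test_functions_translate[OF assms(1), of ?h]
  have "ball_average e \<phi> x - ball_average e \<phi> y = ball_average e (\<lambda>y. \<phi> (y + ?h) - \<phi> y) y"
    using ball_average_translate[of e \<phi> y ?h] ball_average_diff[OF T assms(1), of e y] by simp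
  also have "norm \<dots> \<le> L2_norm UNIV (\<lambda>y. \<phi> (y + ?h) - \<phi> y) / sqrt ?v"
    by (rule ball_average_bound[OF test_functions_diff[OF T test_functions_UNIV[OF assms(1)]] assms(2)])
  also have "\<dots> \<le> norm ?h * sqrt (grad_norm2 \<phi>) / sqrt ?v"
    by (intro divide_right_mono L2_norm_translate_grad[OF assms(1)]) simp
  finally show ?thesis .
qed

text \<open>By Cauchy-Schwarz the squared deviation at \<open>x\<close> is at most the mean over the
  increments \<open>z\<close> of |\<phi>(x + z) - \<phi>(x)|^2. After exchanging the integrals, each
  \<open>z\<close> contributes at most e^2 times the energy.\<close>

lemma nn_integral_ball_average_diff:
  fixes \<phi> :: "'a::euclidean_space \<Rightarrow> complex"
  assumes "\<phi> \<in> test_functions U" "e > 0"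
  shows "(\<integral>\<^sup>+x. ennreal ((norm (ball_average e \<phi> x - \<phi> x))\<^sup>2) \<partial>lborel) \<le> ennreal (e\<^sup>2 * grad_norm2 \<phi>)"
proof -
  let ?B = "cball (0::'a) e"
  let ?v = "measure lborel ?B"
  note v = measure_cball_pos[OF assms(2), where 'a = 'a]
  note c = test_functions_continuous_on[OF assms(1)]
  have [measurable]: "\<phi> \<in> borel_measurable borel" by (rule borel_measurable_continuous_onI[OF c])
  have pt: "ennreal ((norm (ball_average e \<phi> x - \<phi> x))\<^sup>2)
      \<le> ennreal (1 / ?v) * (\<integral>\<^sup>+z. indicator ?B z * ennreal ((norm (\<phi> (x + z) - \<phi> x))\<^sup>2) \<partial>lborel)" for x
  proof -
    let ?g = "\<lambda>z. \<phi> (z + x) - \<phi> x"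
    have cT: "continuous_on UNIV (\<lambda>z. \<phi> (z + x))"
      by (rule test_functions_continuous_on[OF test_functions_translate[OF assms(1)]])
    have cg: "continuous_on UNIV ?g" by (intro continuous_intros cT)
    have g: "?g \<in> L2 ?B" by (rule continuous_L2_cball[OF cg])
    have "integrable (lebesgue_on ?B) (\<lambda>z. \<phi> (z + x) * 1)"
      by (intro L2_mult_integrable continuous_L2_cball cT continuous_on_const)
    moreover have "integrable (lebesgue_on ?B) (\<lambda>z. \<phi> x * 1)"
      by (rule L2_mult_integrable[where f = "\<lambda>z. \<phi> x" and g = "\<lambda>z. 1"])
         (intro continuous_L2_cball continuous_on_const)+
    ultimately have "(LINT z|lebesgue_on ?B. ?g z) = (LINT z|lebesgue_on ?B. \<phi> (z + x)) - of_real ?v * \<phi> x"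
      by (simp add: measure_restrict_space scaleR_conv_of_real)
    then have "ball_average e \<phi> x - \<phi> x = (LINT z|lebesgue_on ?B. ?g z) / of_real ?v"
      using v by (simp add: ball_average_def add.commute diff_divide_distrib)
    then have "norm (ball_average e \<phi> x - \<phi> x) \<le> L2_norm ?B ?g * sqrt ?v / ?v"
      using integral_cball_Cauchy_Schwarz[OF cg, of e] v by (simp add: norm_divide divide_right_mono)
    then have "(norm (ball_average e \<phi> x - \<phi> x))\<^sup>2 \<le> (L2_norm ?B ?g * sqrt ?v / ?v)\<^sup>2"
      by (rule power_mono) simp
    also have "\<dots> = 1 / ?v * (LINT z|lebesgue_on ?B. (norm (?g z))\<^sup>2)"
    proof -
      have "(a * sqrt w / w)\<^sup>2 = 1 / w * a\<^sup>2" if "w > 0" for a w :: real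
        using that by (simp add: power_divide power_mult_distrib) (simp add: field_simps power2_eq_square)
      from this[OF v] show ?thesis unfolding L2_norm_power2[symmetric] .
    qed
    finally have "ennreal ((norm (ball_average e \<phi> x - \<phi> x))\<^sup>2)
        \<le> ennreal (1 / ?v) * ennreal (LINT z|lebesgue_on ?B. (norm (?g z))\<^sup>2)"
      using v by (simp add: ennreal_leI flip: ennreal_mult)
    also have "ennreal (LINT z|lebesgue_on ?B. (norm (?g z))\<^sup>2) = (\<integral>\<^sup>+z. ennreal ((norm (?g z))\<^sup>2) \<partial>lebesgue_on ?B)"
      using nn_integral_eq_integral[OF L2D(2)[OF g]] by simp
    also have "\<dots> = (\<integral>\<^sup>+z. ennreal ((norm (?g z))\<^sup>2) * indicator ?B z \<partial>lebesgue)"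
      by (rule nn_integral_restrict_space) simp
    also have "\<dots> = (\<integral>\<^sup>+z. ennreal ((norm (?g z))\<^sup>2) * indicator ?B z \<partial>lborel)"
      by (rule nn_integral_completion) measurable
    finally show ?thesis by (simp add: mult.commute add.commute)
  qed
  \<comment> \<open>Joint measurability for Tonelli's theorem: the product of the two Borel algebras
    is the Borel algebra of the product, where the integrand is a continuous function times an
    indicator.\<close>
  have J: "(\<lambda>(x, z). indicator ?B z * ennreal ((norm (\<phi> (x + z) - \<phi> x))\<^sup>2)) \<in> borel_measurable (lborel \<Otimes>\<^sub>M lborel)"
  proof -
    have s: "sets (lborel \<Otimes>\<^sub>M lborel) = sets (borel :: ('a \<times> 'a) measure)"
      using sets_pair_measure_cong[OF sets_lborel sets_lborel] borel_prod by metis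
    have "continuous_on UNIV (\<lambda>p::'a \<times> 'a. (norm (\<phi> (fst p + snd p) - \<phi> (fst p)))\<^sup>2)"
      by (intro continuous_intros continuous_on_compose2[OF c]) auto
    then have 1: "(\<lambda>p::'a \<times> 'a. ennreal ((norm (\<phi> (fst p + snd p) - \<phi> (fst p)))\<^sup>2)) \<in> borel_measurable borel"
      by (intro measurable_compose[OF borel_measurable_continuous_onI measurable_ennreal])
    have "(snd :: 'a \<times> 'a \<Rightarrow> 'a) \<in> borel_measurable borel"
      by (intro borel_measurable_continuous_onI continuous_intros)
    then have "(\<lambda>p::'a \<times> 'a. indicator ?B (snd p) :: ennreal) \<in> borel_measurable borel"
      by (rule measurable_compose) (rule borel_measurable_indicator, simp)
    from borel_measurable_times_ennreal[OF this 1] show ?thesis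
      unfolding measurable_cong_sets[OF s refl] by (simp add: case_prod_beta)
  qed
  have "(\<integral>\<^sup>+x. ennreal ((norm (ball_average e \<phi> x - \<phi> x))\<^sup>2) \<partial>lborel)
     \<le> (\<integral>\<^sup>+x. ennreal (1 / ?v) * (\<integral>\<^sup>+z. indicator ?B z * ennreal ((norm (\<phi> (x + z) - \<phi> x))\<^sup>2) \<partial>lborel) \<partial>lborel)"
    by (rule nn_integral_mono) (rule pt)
  also have "\<dots> = ennreal (1 / ?v) * (\<integral>\<^sup>+x. \<integral>\<^sup>+z. indicator ?B z * ennreal ((norm (\<phi> (x + z) - \<phi> x))\<^sup>2) \<partial>lborel \<partial>lborel)"
    using lborel.borel_measurable_nn_integral[OF J] by (intro nn_integral_cmult) simp
  also have "(\<integral>\<^sup>+x. \<integral>\<^sup>+z. indicator ?B z * ennreal ((norm (\<phi> (x + z) - \<phi> x))\<^sup>2) \<partial>lborel \<partial>lborel)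
     = (\<integral>\<^sup>+z. \<integral>\<^sup>+x. indicator ?B z * ennreal ((norm (\<phi> (x + z) - \<phi> x))\<^sup>2) \<partial>lborel \<partial>lborel)"
    by (rule lborel_pair.Fubini'[OF J, symmetric])
  also have "\<dots> \<le> (\<integral>\<^sup>+z. indicator ?B z * ennreal (e\<^sup>2 * grad_norm2 \<phi>) \<partial>lborel)"
  proof (rule nn_integral_mono)
    fix z :: 'a
    have "(\<integral>\<^sup>+x. ennreal ((norm (\<phi> (x + z) - \<phi> x))\<^sup>2) \<partial>lborel) \<le> ennreal (e\<^sup>2 * grad_norm2 \<phi>)" if "z \<in> ?B"
    proof -
      have d: "(\<lambda>x. \<phi> (x + z) - \<phi> x) \<in> test_functions UNIV"
        by (rule test_functions_diff[OF test_functions_translate[OF assms(1)] test_functions_UNIV[OF assms(1)]])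
      note i = test_functions_integrable(2)[OF d]
      have "(LINT x|lborel. (norm (\<phi> (x + z) - \<phi> x))\<^sup>2) = (L2_norm UNIV (\<lambda>x. \<phi> (x + z) - \<phi> x))\<^sup>2"
        by (rule L2_norm_UNIV_lborel[OF test_functions_continuous_on[OF d], symmetric])
      also have "\<dots> \<le> (e * sqrt (grad_norm2 \<phi>))\<^sup>2"
      proof (rule power_mono)
        show "L2_norm UNIV (\<lambda>x. \<phi> (x + z) - \<phi> x) \<le> e * sqrt (grad_norm2 \<phi>)"
          using L2_norm_translate_grad[OF assms(1), of z] that
            mult_right_mono[of "norm z" e "sqrt (grad_norm2 \<phi>)"] by (simp add: grad_norm2_nonneg)
      qed simp
      also have "\<dots> = e\<^sup>2 * grad_norm2 \<phi>" by (simp add: power_mult_distrib grad_norm2_nonneg)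
      finally show ?thesis
        using nn_integral_eq_integral[OF i] by (simp add: ennreal_leI)
    qed
    then show "(\<integral>\<^sup>+x. indicator ?B z * ennreal ((norm (\<phi> (x + z) - \<phi> x))\<^sup>2) \<partial>lborel)
        \<le> indicator ?B z * ennreal (e\<^sup>2 * grad_norm2 \<phi>)"
      by (cases "z \<in> ?B") (simp_all add: nn_integral_cmult)
  qed
  also have "\<dots> = ennreal (?v) * ennreal (e\<^sup>2 * grad_norm2 \<phi>)"
    using emeasure_lborel_cball_finite[of "0::'a" e]
    by (subst nn_integral_multc) (auto simp: emeasure_eq_ennreal_measure intro!: borel_measurable_indicator)
  finally have "(\<integral>\<^sup>+x. ennreal ((norm (ball_average e \<phi> x - \<phi> x))\<^sup>2) \<partial>lborel)
     \<le> ennreal (1 / ?v) * (ennreal ?v * ennreal (e\<^sup>2 * grad_norm2 \<phi>))"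
    by (simp add: mult_left_mono)
  also have "\<dots> = ennreal (e\<^sup>2 * grad_norm2 \<phi>)"
    using v by (simp add: mult.assoc[symmetric] grad_norm2_nonneg flip: ennreal_mult)
  finally show ?thesis .
qed


subsection \<open>Compactness\<close>

text \<open>Splits \<open>\<phi>\<close> into its deviation from the average, small by the energy
  bound, and the average itself, bounded by \<open>c\<close> on a ball containing the support. It
  converts uniform smallness of averages into smallness in \<open>L2\<close>.\<close>

lemma L2_norm_le_ball_average:
  fixes \<phi> :: "'a::euclidean_space \<Rightarrow> complex"
  assumes \<phi>: "\<phi> \<in> test_functions U" and "U \<subseteq> ball 0 R" "e > 0" "c \<ge> 0"
    and bound: "\<And>x. x \<in> cball 0 R \<Longrightarrow> norm (ball_average e \<phi> x) \<le> c"
  shows "(L2_norm UNIV \<phi>)\<^sup>2 \<le> 2 * e\<^sup>2 * grad_norm2 \<phi> + 2 * c\<^sup>2 * measure lborel (cball (0::'a) R)"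
proof -
  let ?A = "ball_average e \<phi>"
  let ?v = "measure lborel (cball (0::'a) R)"
  note c = test_functions_continuous_on[OF \<phi>]
  have cA: "continuous_on UNIV ?A"
    unfolding continuous_on_iff
  proof (intro ballI allI impI)
    fix x :: 'a and r :: real assume r: "r > 0"
    \<comment> \<open>The \<open>+ 1\<close> makes the Lipschitz constant positive, so that it can
      be divided by.\<close>
    let ?K = "sqrt (grad_norm2 \<phi>) / sqrt (measure lborel (cball (0::'a) e)) + 1"
    have K: "?K > 0" by (intro add_nonneg_pos divide_nonneg_nonneg) (auto simp: grad_norm2_nonneg)
    have "dist (?A y) (?A x) < r" if "dist y x < r / ?K" for y
    proof -
      have "dist (?A y) (?A x)
          \<le> norm (y - x) * sqrt (grad_norm2 \<phi>) / sqrt (measure lborel (cball (0::'a) e)) + norm (y - x)"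
        using ball_average_Lipschitz[OF \<phi> assms(3), of y x] norm_ge_zero[of "y - x"]
        unfolding dist_norm by linarith
      also have "\<dots> = dist y x * ?K" by (simp add: dist_norm algebra_simps)
      also have "\<dots> < r" using that K by (simp add: pos_less_divide_eq)
      finally show ?thesis .
    qed
    then show "\<exists>d>0. \<forall>y\<in>UNIV. dist y x < d \<longrightarrow> dist (?A y) (?A x) < r"
      using r K by (intro exI[of _ "r / ?K"]) auto
  qed
  have [measurable]: "?A \<in> borel_measurable borel" "\<phi> \<in> borel_measurable borel"
    by (auto intro!: borel_measurable_continuous_onI cA c)
  note i = test_functions_integrable(2)[OF \<phi>]
  have ind: "(\<lambda>x. indicator (cball 0 R) x :: ennreal) \<in> borel_measurable lborel"
    by (auto intro!: borel_measurable_indicator)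
  have "ennreal ((L2_norm UNIV \<phi>)\<^sup>2) = (\<integral>\<^sup>+x. ennreal ((norm (\<phi> x))\<^sup>2) \<partial>lborel)"
    unfolding L2_norm_UNIV_lborel[OF c] using nn_integral_eq_integral[OF i] by simp
  also have "\<dots> \<le> (\<integral>\<^sup>+x. 2 * ennreal ((norm (?A x - \<phi> x))\<^sup>2) + ennreal (2 * c\<^sup>2) * indicator (cball 0 R) x \<partial>lborel)"
  proof (rule nn_integral_mono)
    fix x :: 'a
    show "ennreal ((norm (\<phi> x))\<^sup>2) \<le> 2 * ennreal ((norm (?A x - \<phi> x))\<^sup>2) + ennreal (2 * c\<^sup>2) * indicator (cball 0 R) x"
    proof (cases "x \<in> cball 0 R")
      case True
      have "(norm (\<phi> x))\<^sup>2 \<le> 2 * (norm (\<phi> x - ?A x))\<^sup>2 + 2 * (norm (?A x))\<^sup>2"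
        using norm_add_sq_le[of "\<phi> x - ?A x" "?A x"] by simp
      also have "\<dots> \<le> 2 * (norm (?A x - \<phi> x))\<^sup>2 + 2 * c\<^sup>2"
        using power_mono[OF bound[OF True], of 2] by (simp add: norm_minus_commute)
      finally have "ennreal ((norm (\<phi> x))\<^sup>2) \<le> ennreal (2 * (norm (?A x - \<phi> x))\<^sup>2 + 2 * c\<^sup>2)"
        by (rule ennreal_leI)
      then show ?thesis using True by (simp add: ennreal_mult)
    next
      case False
      then have "x \<notin> U" using assms(2) by auto
      then show ?thesis using test_functions_outside[OF \<phi>] by simp
    qed
  qed
  also have "\<dots> = (\<integral>\<^sup>+x. 2 * ennreal ((norm (?A x - \<phi> x))\<^sup>2) \<partial>lborel) + (\<integral>\<^sup>+x. ennreal (2 * c\<^sup>2) * indicator (cball (0::'a) R) x \<partial>lborel)"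
    using ind by (intro nn_integral_add borel_measurable_times_ennreal) auto
  also have "(\<integral>\<^sup>+x. ennreal (2 * c\<^sup>2) * indicator (cball (0::'a) R) x \<partial>lborel) = ennreal (2 * c\<^sup>2) * ennreal ?v"
    using ind emeasure_lborel_cball_finite[of "0::'a" R]
    by (subst nn_integral_cmult) (auto simp: emeasure_eq_ennreal_measure)
  also have "(\<integral>\<^sup>+x. 2 * ennreal ((norm (?A x - \<phi> x))\<^sup>2) \<partial>lborel) = 2 * (\<integral>\<^sup>+x. ennreal ((norm (?A x - \<phi> x))\<^sup>2) \<partial>lborel)"
    by (rule nn_integral_cmult) measurable
  also have "\<dots> + ennreal (2 * c\<^sup>2) * ennreal ?v \<le> 2 * ennreal (e\<^sup>2 * grad_norm2 \<phi>) + ennreal (2 * c\<^sup>2) * ennreal ?v"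
    by (intro add_right_mono mult_left_mono nn_integral_ball_average_diff[OF \<phi> assms(3)]) simp
  also have "\<dots> = ennreal (2 * e\<^sup>2 * grad_norm2 \<phi> + 2 * c\<^sup>2 * ?v)"
    by (simp add: ennreal_mult grad_norm2_nonneg mult.assoc)
  finally show ?thesis
    by (subst (asm) ennreal_le_iff) (simp_all add: grad_norm2_nonneg)
qed

lemma partial_diff:
  assumes "smooth_on UNIV \<phi>" "smooth_on UNIV \<psi>"
  shows "partial b (\<lambda>x. \<phi> x - \<psi> x) x = partial b \<phi> x - partial b \<psi> x"
  using partial_add[OF assms, of b "-1"] by simp

lemma grad_norm2_diff_le:
  fixes \<phi> :: "'a::euclidean_space \<Rightarrow> complex"
  assumes \<phi>: "\<phi> \<in> test_functions U" and \<psi>: "\<psi> \<in> test_functions V"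
  shows "grad_norm2 (\<lambda>x. \<phi> x - \<psi> x) \<le> 2 * grad_norm2 \<phi> + 2 * grad_norm2 \<psi>"
proof -
  have "(L2_norm UNIV (partial b (\<lambda>x. \<phi> x - \<psi> x)))\<^sup>2 \<le> 2 * (L2_norm UNIV (partial b \<phi>))\<^sup>2 + 2 * (L2_norm UNIV (partial b \<psi>))\<^sup>2"
    if b: "b \<in> Basis" for b
  proof -
    note p = test_functions_L2_UNIV[OF test_functions_partial[OF \<phi> b]]
      and q = test_functions_L2_UNIV[OF test_functions_partial[OF \<psi> b]]
    have "partial b (\<lambda>x. \<phi> x - \<psi> x) = (\<lambda>x. partial b \<phi> x + (-1) * partial b \<psi> x)"
      using partial_diff[OF test_functionsD(1)[OF \<phi>] test_functionsD(1)[OF \<psi>]] by auto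
    then have "L2_norm UNIV (partial b (\<lambda>x. \<phi> x - \<psi> x)) \<le> L2_norm UNIV (partial b \<phi>) + L2_norm UNIV (partial b \<psi>)"
      using L2_norm_triangle[OF p L2_scale[OF q, of "-1"]] L2_norm_scale[of UNIV "-1" "partial b \<psi>"] by simp
    then have "(L2_norm UNIV (partial b (\<lambda>x. \<phi> x - \<psi> x)))\<^sup>2 \<le> (L2_norm UNIV (partial b \<phi>) + L2_norm UNIV (partial b \<psi>))\<^sup>2"
      by (rule power_mono) simp
    also have "\<dots> \<le> 2 * (L2_norm UNIV (partial b \<phi>))\<^sup>2 + 2 * (L2_norm UNIV (partial b \<psi>))\<^sup>2"
      using sum_squares_bound[of "L2_norm UNIV (partial b \<phi>)" "L2_norm UNIV (partial b \<psi>)"]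
      by (simp add: power2_sum)
    finally show ?thesis .
  qed
  then have "grad_norm2 (\<lambda>x. \<phi> x - \<psi> x) \<le>
     (\<Sum>b\<in>Basis. 2 * (L2_norm UNIV (partial b \<phi>))\<^sup>2 + 2 * (L2_norm UNIV (partial b \<psi>))\<^sup>2)"
    unfolding grad_norm2_def by (rule sum_mono)
  also have "\<dots> = 2 * grad_norm2 \<phi> + 2 * grad_norm2 \<psi>"
    by (simp add: grad_norm2_def sum.distrib sum_distrib_left)
  finally show ?thesis .
qed

text \<open>For one tolerance \<open>d\<close>: the radius \<open>e\<close> is fixed first, so that
  averaging costs little uniformly in the sequence; Arzela-Ascoli then applies to the averages of
  that radius.\<close>

lemma Rellich_test_step:
  fixes f :: "nat \<Rightarrow> 'a::euclidean_space \<Rightarrow> complex"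
  assumes f: "\<And>k. f k \<in> test_functions U" and "U \<subseteq> ball 0 R" "R > 0" "d > 0"
    and M: "\<And>k. L2_norm UNIV (f k) \<le> M" and G: "\<And>k. grad_norm2 (f k) \<le> G"
  shows "\<exists>r. strict_mono (r :: nat \<Rightarrow> nat) \<and>
    (\<exists>N. \<forall>j\<ge>N. \<forall>k\<ge>N. L2_norm UNIV (\<lambda>x. f (r j) x - f (r k) x) < d)"
proof -
  let ?v = "measure lborel (cball (0::'a) R)"
  have G0: "G \<ge> 0" using grad_norm2_nonneg[of "f 0"] G[of 0] by linarith
  have v0: "?v \<ge> 0" by simp
  \<comment> \<open>A difference of two members has energy at most \<open>4 * G\<close>, so
    averaging contributes \<open>2 * e\<^sup>2 * (4 * G)\<close>; this choice makes it less than
    half of \<open>d\<^sup>2\<close>.\<close>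
  define e where "e = d / sqrt (32 * (G + 1))"
  have e: "e > 0" unfolding e_def using G0 assms(4) by (intro divide_pos_pos) auto
  have e2: "8 * e\<^sup>2 * G < d\<^sup>2 / 2"
  proof -
    have "e\<^sup>2 = d\<^sup>2 / (32 * (G + 1))" using G0 by (simp add: e_def power_divide)
    moreover have "8 * (d\<^sup>2 / (32 * (G + 1))) * G < d\<^sup>2 / 2"
      using G0 assms(4) by (simp add: divide_simps; simp add: algebra_simps add_pos_nonneg)
    ultimately show ?thesis by simp
  qed
  \<comment> \<open>Two averages within \<open>c\<close> of their uniform limit differ by at most
    \<open>2 * c\<close>; the other half of \<open>d\<^sup>2\<close> pays for this on the ball of
    volume \<open>?v\<close>. The \<open>+ 1\<close> avoids a division by 0.\<close>
  define c where "c = d / sqrt (16 * (?v + 1))"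
  have c: "c > 0"
  proof -
    have "0 < 16 * (w + 1)" if "w \<ge> 0" for w :: real using that by simp
    from this[OF v0] show ?thesis unfolding c_def using assms(4) by (intro divide_pos_pos real_sqrt_gt_zero)
  qed
  have c2: "2 * (2 * c)\<^sup>2 * ?v \<le> d\<^sup>2 / 2"
  proof -
    have "(d / sqrt (16 * (w + 1)))\<^sup>2 = d\<^sup>2 / (16 * (w + 1))" if "w \<ge> 0" for w :: real
      using that by (simp add: power_divide)
    from this[OF v0] have "c\<^sup>2 = d\<^sup>2 / (16 * (?v + 1))" unfolding c_def .
    moreover have "8 * (d\<^sup>2 / (16 * (w + 1))) * w \<le> d\<^sup>2 / 2" if "w \<ge> 0" for w :: real
      using that by (simp add: divide_simps; simp add: algebra_simps)
    ultimately show ?thesis using v0 by (simp add: power_mult_distrib)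
  qed
  let ?w = "sqrt (measure lborel (cball (0::'a) e))"
  have w: "?w > 0" using measure_cball_pos[OF e, where 'a = 'a] by simp
  let ?A = "\<lambda>k. ball_average e (f k)"
  have bd: "norm (?A k x) \<le> M / ?w" for k x
    using ball_average_bound[OF f e, of k x] divide_right_mono[OF M, of ?w k] w by linarith
  have eq: "\<exists>\<delta>. 0 < \<delta> \<and> (\<forall>k y. y \<in> cball 0 R \<and> norm (x - y) < \<delta> \<longrightarrow> norm (?A k x - ?A k y) < \<epsilon>)"
    if "0 < \<epsilon>" for x \<epsilon>
  proof (intro exI[of _ "\<epsilon> * ?w / (sqrt G + 1)"] conjI allI impI)
    have sg: "sqrt G + 1 > 0" by (rule add_nonneg_pos) (use G0 in auto)
    show "0 < \<epsilon> * ?w / (sqrt G + 1)" using that w sg by simp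
    fix k y assume y: "y \<in> cball 0 R \<and> norm (x - y) < \<epsilon> * ?w / (sqrt G + 1)"
    have "norm (?A k x - ?A k y) \<le> norm (x - y) * sqrt (grad_norm2 (f k)) / ?w"
      by (rule ball_average_Lipschitz[OF f e])
    also have "\<dots> \<le> norm (x - y) * (sqrt G + 1) / ?w"
      using w add_increasing2[OF zero_le_one real_sqrt_le_mono[OF G[of k]]]
      by (intro divide_right_mono mult_left_mono) auto
    also have "\<dots> < \<epsilon>"
      using y w sg by (simp add: divide_simps)
    finally show "norm (?A k x - ?A k y) < \<epsilon>" .
  qed
  obtain g r where "strict_mono (r :: nat \<Rightarrow> nat)"
    and g: "\<And>\<epsilon>. 0 < \<epsilon> \<Longrightarrow> \<exists>N. \<forall>n x. n \<ge> N \<and> x \<in> cball 0 R \<longrightarrow> norm (?A (r n) x - g x) < \<epsilon>"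
    using Arzela_Ascoli[OF compact_cball, of 0 R ?A "M / ?w"] bd eq by metis
  from g[OF c] obtain N where N: "\<And>n x. n \<ge> N \<Longrightarrow> x \<in> cball 0 R \<Longrightarrow> norm (?A (r n) x - g x) < c"
    by blast
  have "L2_norm UNIV (\<lambda>x. f (r j) x - f (r k) x) < d" if "j \<ge> N" "k \<ge> N" for j k
  proof -
    have "norm (ball_average e (\<lambda>x. f (r j) x - f (r k) x) x) \<le> 2 * c" if x: "x \<in> cball 0 R" for x
    proof -
      have "norm (?A (r j) x - ?A (r k) x) \<le> norm (?A (r j) x - g x) + norm (?A (r k) x - g x)"
        using norm_triangle_ineq4[of "?A (r j) x - g x" "?A (r k) x - g x"] by simp
      also have "\<dots> \<le> 2 * c" using N[OF \<open>j \<ge> N\<close> x] N[OF \<open>k \<ge> N\<close> x] by simp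
      finally show ?thesis by (simp add: ball_average_diff[OF f f])
    qed
    then have "(L2_norm UNIV (\<lambda>x. f (r j) x - f (r k) x))\<^sup>2
      \<le> 2 * e\<^sup>2 * grad_norm2 (\<lambda>x. f (r j) x - f (r k) x) + 2 * (2 * c)\<^sup>2 * ?v"
      using c by (intro L2_norm_le_ball_average[OF test_functions_diff[OF f f] assms(2) e]) auto
    also have "\<dots> \<le> 2 * e\<^sup>2 * (4 * G) + 2 * (2 * c)\<^sup>2 * ?v"
      using grad_norm2_diff_le[OF f[of "r j"] f[of "r k"]] G[of "r j"] G[of "r k"]
      by (intro add_right_mono mult_left_mono) auto
    also have "\<dots> < d\<^sup>2" using e2 c2 by linarith
    finally show ?thesis
      using assms(4) by (intro power2_less_imp_less[of _ d]) auto
  qed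
  with \<open>strict_mono r\<close> show ?thesis by blast
qed

text \<open>A diagonal sequence over the tolerances 1/(n + 1). The conclusion is stated as a Cauchy
  condition, which does not mention a limit and passes to subsequences.\<close>

lemma Rellich_test:
  fixes f :: "nat \<Rightarrow> 'a::euclidean_space \<Rightarrow> complex"
  assumes f: "\<And>k. f k \<in> test_functions U" and "U \<subseteq> ball 0 R" "R > 0"
    and M: "\<And>k. L2_norm UNIV (f k) \<le> M" and G: "\<And>k. grad_norm2 (f k) \<le> G"
  shows "\<exists>r. strict_mono (r :: nat \<Rightarrow> nat) \<and>
    (\<forall>d>0. \<exists>N. \<forall>j\<ge>N. \<forall>k\<ge>N. L2_norm UNIV (\<lambda>x. f (r j) x - f (r k) x) < d)"
proof -
  let ?P = "\<lambda>n (s :: nat \<Rightarrow> nat). \<exists>N. \<forall>j\<ge>N. \<forall>k\<ge>N. L2_norm UNIV (\<lambda>x. f (s j) x - f (s k) x) < inverse (real (Suc n))"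
  interpret subseqs ?P
  proof
    fix n and s :: "nat \<Rightarrow> nat" assume "strict_mono s"
    have "0 < inverse (real (Suc n))" by simp
    from Rellich_test_step[of "\<lambda>k. f (s k)", OF f assms(2,3) this M G]
    show "\<exists>r'. strict_mono r' \<and> ?P n (s \<circ> r')" unfolding o_def .
  qed
  have st: "?P n (s \<circ> r)" if r: "strict_mono r" and P: "?P n s" for r s :: "nat \<Rightarrow> nat" and n
  proof -
    obtain N where N: "\<forall>j\<ge>N. \<forall>k\<ge>N. L2_norm UNIV (\<lambda>x. f (s j) x - f (s k) x) < inverse (real (Suc n))"
      using P by blast
    have "r j \<ge> N" if "j \<ge> N" for j using seq_suble[OF r, of j] that by linarith
    then show ?thesis using N by (auto intro!: exI[of _ N])
  qed
  have "\<exists>N. \<forall>j\<ge>N. \<forall>k\<ge>N. L2_norm UNIV (\<lambda>x. f (diagseq j) x - f (diagseq k) x) < d" if "d > 0" for d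
  proof -
    obtain n where n: "inverse (real (Suc n)) < d" using reals_Archimedean[OF \<open>d > 0\<close>] by blast
    \<comment> \<open>From index \<open>Suc n\<close> on, the diagonal sequence is a subsequence of
      the one chosen for tolerance \<open>n\<close>.\<close>
    have "?P n (diagseq \<circ> (+) (Suc n))" by (rule diagseq_holds[OF st])
    then obtain N where N: "\<And>j k. j \<ge> N \<Longrightarrow> k \<ge> N \<Longrightarrow>
       L2_norm UNIV (\<lambda>x. f (diagseq (Suc n + j)) x - f (diagseq (Suc n + k)) x) < inverse (real (Suc n))"
      unfolding o_def by blast
    show ?thesis
    proof (intro exI[of _ "Suc n + N"] allI impI)
      fix j k assume "Suc n + N \<le> j" "Suc n + N \<le> k"
      then have jk: "j - Suc n \<ge> N" "k - Suc n \<ge> N" "Suc n + (j - Suc n) = j" "Suc n + (k - Suc n) = k"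
        by linarith+
      from N[OF jk(1,2)] n show "L2_norm UNIV (\<lambda>x. f (diagseq j) x - f (diagseq k) x) < d"
        unfolding jk(3,4) by linarith
    qed
  qed
  then show ?thesis using subseq_diagseq by blast
qed

lemma L2_norm_diff_test_eq:
  assumes "\<phi> \<in> test_functions U" "\<psi> \<in> test_functions U" "open U"
  shows "L2_norm U (\<lambda>x. \<phi> x - \<psi> x) = L2_norm UNIV (\<lambda>x. \<phi> x - \<psi> x)"
  by (rule L2_norm_test_eq[OF test_functions_diff[OF assms(1,2)] assms(3)])

text \<open>Each \<open>u k\<close> is replaced by a test function at distance less than 1/(k + 1)
  in norm and derivatives. This raises the bounds by at most 1, and the replacement error vanishes
  along every subsequence.\<close>

theorem Rellich:
  fixes u :: "nat \<Rightarrow> 'a::euclidean_space \<Rightarrow> complex"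
  assumes U: "open U" "bounded U" and u: "\<And>k. u k \<in> H10 U"
    and M: "\<And>k. L2_norm U (u k) \<le> M" and G: "\<And>k b. b \<in> Basis \<Longrightarrow> L2_norm U (weak_partial U b (u k)) \<le> M"
  shows "\<exists>r. strict_mono (r :: nat \<Rightarrow> nat) \<and>
    (\<forall>d>0. \<exists>N. \<forall>j\<ge>N. \<forall>k\<ge>N. L2_norm U (\<lambda>x. u (r j) x - u (r k) x) < d)"
proof -
  note Us = open_sets_lebesgue[OF U(1)]
  obtain R where R: "R > 0" "U \<subseteq> ball 0 R" using bounded_subset_ballD[OF U(2)] by blast
  have "\<forall>k. \<exists>\<phi>. \<phi> \<in> test_functions U \<and> L2_norm U (\<lambda>x. \<phi> x - u k x) < inverse (real (Suc k)) \<and>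
    (\<forall>b\<in>Basis. L2_norm U (\<lambda>x. partial b \<phi> x - weak_partial U b (u k) x) < inverse (real (Suc k)))"
  proof
    fix k have "0 < inverse (real (Suc k))" by simp
    from H10_approx[OF u this] show "\<exists>\<phi>. \<phi> \<in> test_functions U \<and> L2_norm U (\<lambda>x. \<phi> x - u k x) < inverse (real (Suc k)) \<and>
    (\<forall>b\<in>Basis. L2_norm U (\<lambda>x. partial b \<phi> x - weak_partial U b (u k) x) < inverse (real (Suc k)))" by blast
  qed
  from choice[OF this] obtain f where f: "\<And>k. f k \<in> test_functions U"
    and fu: "\<And>k. L2_norm U (\<lambda>x. f k x - u k x) < inverse (real (Suc k))"
    and fg: "\<And>k b. b \<in> Basis \<Longrightarrow> L2_norm U (\<lambda>x. partial b (f k) x - weak_partial U b (u k) x) < inverse (real (Suc k))"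
    by blast
  have i1: "inverse (real (Suc k)) \<le> 1" for k by (simp add: inverse_eq_divide)
  note fL2 = test_functions_L2[OF f Us]
  have fM: "L2_norm UNIV (f k) \<le> M + 1" for k
    using L2_norm_le_diff[OF fL2[of k] H10_L2[OF u[of k]]] M[of k] fu[of k] i1[of k]
    by (simp add: L2_norm_test_eq[OF f U(1)])
  have fG: "L2_norm UNIV (partial b (f k)) \<le> M + 1" if b: "b \<in> Basis" for b k
  proof -
    note p = test_functions_partial[OF f[of k] b]
    show ?thesis
      using L2_norm_le_diff[OF test_functions_L2[OF p Us] H10_weak_partial(2)[OF u[of k] b]]
        G[OF b, of k] fg[OF b, of k] i1[of k]
      by (simp add: L2_norm_test_eq[OF p U(1)])
  qed
  have "grad_norm2 (f k) \<le> (\<Sum>b\<in>(Basis::'a set). (M + 1)\<^sup>2)" for k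
    unfolding grad_norm2_def by (intro sum_mono power_mono fG) auto
  from Rellich_test[of f, OF f R(2,1) fM this] obtain r where r: "strict_mono (r :: nat \<Rightarrow> nat)"
    and C: "\<And>d. d > 0 \<Longrightarrow> \<exists>N. \<forall>j\<ge>N. \<forall>k\<ge>N. L2_norm UNIV (\<lambda>x. f (r j) x - f (r k) x) < d"
    by blast
  have "\<exists>N. \<forall>j\<ge>N. \<forall>k\<ge>N. L2_norm U (\<lambda>x. u (r j) x - u (r k) x) < d" if d: "d > 0" for d
  proof -
    obtain N where N: "\<And>j k. j \<ge> N \<Longrightarrow> k \<ge> N \<Longrightarrow> L2_norm UNIV (\<lambda>x. f (r j) x - f (r k) x) < d / 3"
      using C[of "d/3"] d by auto
    obtain n where n: "inverse (real (Suc n)) < d / 3" using reals_Archimedean[of "d/3"] d by auto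
    have small: "L2_norm U (\<lambda>x. f (r j) x - u (r j) x) < d / 3" if "j \<ge> n" for j
    proof -
      have "r j \<ge> n" using seq_suble[OF r, of j] that by linarith
      then have "inverse (real (Suc (r j))) \<le> inverse (real (Suc n))"
        by (intro le_imp_inverse_le) auto
      with fu[of "r j"] n show ?thesis by linarith
    qed
    show ?thesis
    proof (intro exI[of _ "max N n"] allI impI)
      fix j k assume jk: "max N n \<le> j" "max N n \<le> k"
      have "L2_norm U (\<lambda>x. u (r j) x - u (r k) x) \<le>
         L2_norm U (\<lambda>x. u (r j) x - f (r j) x) + L2_norm U (\<lambda>x. f (r j) x - u (r k) x)"
        by (rule L2_norm_triangle_diff[OF H10_L2[OF u] fL2 H10_L2[OF u]])
      also have "L2_norm U (\<lambda>x. f (r j) x - u (r k) x) \<le>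
         L2_norm U (\<lambda>x. f (r j) x - f (r k) x) + L2_norm U (\<lambda>x. f (r k) x - u (r k) x)"
        by (rule L2_norm_triangle_diff[OF fL2 fL2 H10_L2[OF u]])
      finally show "L2_norm U (\<lambda>x. u (r j) x - u (r k) x) < d"
        using small[of j] small[of k] N[of j k] jk
          L2_norm_minus_commute[of U "f (r j)" "u (r j)"] L2_norm_diff_test_eq[OF f f U(1), of "r j" "r k"] by simp
    qed
  qed
  with r show ?thesis by blast
qed

lemma weak_partial_L2_norm_test:
  assumes "\<phi> \<in> test_functions U" "open U" "b \<in> Basis"
  shows "L2_norm U (weak_partial U b \<phi>) = L2_norm UNIV (partial b \<phi>)"
proof -
  note w = is_weak_partial_test_function[OF assms]
  have "L2_norm U (weak_partial U b \<phi>) = L2_norm U (partial b \<phi>)"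
    using w is_weak_partial_weak_partial[OF w]
    by (intro L2_norm_cong_AE weak_partial_AE_eq[OF assms(2) w]) (auto simp: is_weak_partial_def L2D)
  also have "\<dots> = L2_norm UNIV (partial b \<phi>)"
    by (rule L2_norm_test_eq[OF test_functions_partial[OF assms(1,3)] assms(2)])
  finally show ?thesis .
qed

text \<open>Convergence of the norms alone is recorded; it suffices to carry inequalities between
  norms from test functions to \<open>H10\<close>.\<close>

lemma H10_test_sequence:
  fixes u :: "'a::euclidean_space \<Rightarrow> complex"
  assumes U: "open U" and u: "u \<in> H10 U"
  shows "\<exists>f. (\<forall>k. f k \<in> test_functions U) \<and> (\<lambda>k. L2_norm U (f k)) \<longlonglongrightarrow> L2_norm U u \<and>
    (\<forall>b\<in>Basis. (\<lambda>k. L2_norm U (partial b (f k))) \<longlonglongrightarrow> L2_norm U (weak_partial U b u))"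
proof -
  note Us = open_sets_lebesgue[OF U]
  have "\<forall>k. \<exists>\<phi>. \<phi> \<in> test_functions U \<and> L2_norm U (\<lambda>x. \<phi> x - u x) < inverse (real (Suc k)) \<and>
    (\<forall>b\<in>Basis. L2_norm U (\<lambda>x. partial b \<phi> x - weak_partial U b u x) < inverse (real (Suc k)))"
  proof
    fix k have "0 < inverse (real (Suc k))" by simp
    from H10_approx[OF u this] show "\<exists>\<phi>. \<phi> \<in> test_functions U \<and> L2_norm U (\<lambda>x. \<phi> x - u x) < inverse (real (Suc k)) \<and>
    (\<forall>b\<in>Basis. L2_norm U (\<lambda>x. partial b \<phi> x - weak_partial U b u x) < inverse (real (Suc k)))" by blast
  qed
  from choice[OF this] obtain f where f: "\<And>k. f k \<in> test_functions U"
    and fu: "\<And>k. L2_norm U (\<lambda>x. f k x - u x) < inverse (real (Suc k))"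
    and fg: "\<And>k b. b \<in> Basis \<Longrightarrow> L2_norm U (\<lambda>x. partial b (f k) x - weak_partial U b u x) < inverse (real (Suc k))"
    by blast
  have 1: "(\<lambda>k. L2_norm U (f k)) \<longlonglongrightarrow> L2_norm U u"
  proof (rule L2_norm_tendsto[OF test_functions_L2[OF f Us] H10_L2[OF u]])
    show "(\<lambda>k. L2_norm U (\<lambda>x. f k x - u x)) \<longlonglongrightarrow> 0"
      by (rule tendsto_sandwich[OF _ _ tendsto_const LIMSEQ_inverse_real_of_nat];
          intro always_eventually allI L2_norm_nonneg less_imp_le[OF fu])
  qed
  have 2: "(\<lambda>k. L2_norm U (partial b (f k))) \<longlonglongrightarrow> L2_norm U (weak_partial U b u)" if b: "b \<in> Basis" for b
  proof (rule L2_norm_tendsto[OF test_functions_L2[OF test_functions_partial[OF f b] Us] H10_weak_partial(2)[OF u b]])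
    show "(\<lambda>k. L2_norm U (\<lambda>x. partial b (f k) x - weak_partial U b u x)) \<longlonglongrightarrow> 0"
      by (rule tendsto_sandwich[OF _ _ tendsto_const LIMSEQ_inverse_real_of_nat];
          intro always_eventually allI L2_norm_nonneg less_imp_le[OF fg] b)
  qed
  from f 1 2 show ?thesis by blast
qed

lemma Poincare:
  fixes U :: "'a::euclidean_space set"
  assumes U: "open U" "bounded U"
  shows "\<exists>c>0. \<forall>u\<in>H10 U. (L2_norm U u)\<^sup>2 \<le> c * (\<Sum>b\<in>Basis. (L2_norm U (weak_partial U b u))\<^sup>2)"
proof -
  obtain R where R: "R > 0" "U \<subseteq> ball 0 R" using bounded_subset_ballD[OF U(2)] by blast
  have "(L2_norm U u)\<^sup>2 \<le> 2 * R\<^sup>2 * (\<Sum>b\<in>Basis. (L2_norm U (weak_partial U b u))\<^sup>2)" if u: "u \<in> H10 U" for u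
  proof -
    obtain f where f: "\<And>k. f k \<in> test_functions U" and 1: "(\<lambda>k. L2_norm U (f k)) \<longlonglongrightarrow> L2_norm U u"
      and 2: "\<And>b. b \<in> Basis \<Longrightarrow> (\<lambda>k. L2_norm U (partial b (f k))) \<longlonglongrightarrow> L2_norm U (weak_partial U b u)"
      using H10_test_sequence[OF U(1) u] by blast
    have "(L2_norm U (f k))\<^sup>2 \<le> 2 * R\<^sup>2 * (\<Sum>b\<in>Basis. (L2_norm U (partial b (f k)))\<^sup>2)" for k
      using Poincare_test[OF f R(2,1), of k] L2_norm_test_eq[OF test_functions_partial[OF f] U(1), of _ k]
      by (simp add: grad_norm2_def L2_norm_test_eq[OF f U(1)])
    then show ?thesis
      by (intro LIMSEQ_le[OF tendsto_power[OF 1, of 2] tendsto_mult[OF tendsto_const tendsto_sum[OF tendsto_power[OF 2]]]]) auto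
  qed
  then show ?thesis using R(1) by (intro exI[of _ "2 * R\<^sup>2"]) auto
qed

section \<open>The least eigenvalue of a layer problem\<close>

lemma tendsto_0_if_power2_le:
  fixes Y T :: "'i \<Rightarrow> real"
  assumes "(T \<longlongrightarrow> 0) F" "\<And>p. 0 \<le> Y p" "\<And>p. (Y p)\<^sup>2 \<le> T p"
  shows "(Y \<longlongrightarrow> 0) F"
proof (rule tendsto_sandwich[OF _ _ tendsto_const])
  have "((\<lambda>p. sqrt (T p)) \<longlongrightarrow> sqrt 0) F" by (intro tendsto_real_sqrt assms(1))
  then show "((\<lambda>p. sqrt (T p)) \<longlongrightarrow> 0) F" by simp
  show "\<forall>\<^sub>F p in F. Y p \<le> sqrt (T p)"
    using assms(2,3) by (intro always_eventually allI real_le_rsqrt)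
qed (use assms(2) in \<open>auto intro: always_eventually\<close>)

text \<open>Cauchy sequences are expressed by convergence along pairs of indices.\<close>

lemma L2_complete_prod_filter:
  fixes f :: "nat \<Rightarrow> 'a::euclidean_space \<Rightarrow> complex"
  assumes "\<And>k. f k \<in> L2 U"
    and "((\<lambda>p. L2_norm U (\<lambda>x. f (fst p) x - f (snd p) x)) \<longlongrightarrow> 0) (sequentially \<times>\<^sub>F sequentially)"
  shows "\<exists>g\<in>L2 U. (\<lambda>k. L2_norm U (\<lambda>x. f k x - g x)) \<longlonglongrightarrow> 0"
proof -
  have "\<exists>N. \<forall>j\<ge>N. \<forall>k\<ge>N. L2_norm U (\<lambda>x. f j x - f k x) < e" if "e > 0" for e
    using order_tendstoD(2)[OF assms(2) that] unfolding eventually_prod_sequentially by auto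
  from L2_complete[of f U, OF assms(1) this] show ?thesis by blast
qed

lemma prod_filter_tendsto_add:
  fixes e :: "nat \<Rightarrow> real"
  assumes "e \<longlonglongrightarrow> 0"
  shows "((\<lambda>p. e (fst p) + e (snd p)) \<longlongrightarrow> 0) (sequentially \<times>\<^sub>F sequentially)"
  using tendsto_add[OF filterlim_compose[OF assms filterlim_fst] filterlim_compose[OF assms filterlim_snd]]
  by simp

text \<open>Common frame of both eigenvalue problems. In the transmission problem \<open>L\<close>
  is the thin layer, \<open>a\<close> is 1/(1 - n), and \<open>N\<close> consists of the functions
  against which the normal derivative is tested; the Dirichlet problem has \<open>L\<close> and
  \<open>N\<close> empty.\<close>

locale layer_problem =
  fixes \<Omega> L :: "'a::euclidean_space set" and N :: "('a \<Rightarrow> complex) set" and a :: "'a \<Rightarrow> real" and a0 a1 :: real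
  assumes open_\<Omega>: "open \<Omega>" and bounded_\<Omega>: "bounded \<Omega>" and open_L: "open L" and L_subset: "L \<subseteq> \<Omega>"
    and N_subset: "N \<subseteq> test_functions UNIV"
    and a_measurable: "a \<in> borel_measurable (lebesgue_on L)"
    and a0_pos: "0 < a0" and a_lower: "\<And>x. x \<in> L \<Longrightarrow> a0 \<le> a x" and a_upper: "\<And>x. x \<in> L \<Longrightarrow> a x \<le> a1"
begin

definition V :: "('a \<Rightarrow> complex) set" where
  "V = {u \<in> H10 \<Omega>. (\<exists>g. is_weak_laplacian L u g) \<and>
     (\<forall>\<phi>\<in>N. (LINT x|lebesgue_on L. weak_laplacian L u x * \<phi> x +
        (\<Sum>b\<in>Basis. weak_partial \<Omega> b u x * partial b \<phi> x)) = 0)}"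

text \<open>The variational identity with its right-hand side moved to the left: the mass terms with
  factors 1 and 2 combine to the single negative one.\<close>

definition form :: "real \<Rightarrow> ('a \<Rightarrow> complex) \<Rightarrow> ('a \<Rightarrow> complex) \<Rightarrow> complex" where
  "form \<mu> u \<psi> = (LINT x|lebesgue_on L. of_real (a x) * (weak_laplacian L u x + of_real \<mu> * u x) *
      cnj (weak_laplacian L \<psi> x + of_real \<mu> * \<psi> x)) +
    of_real \<mu> * grad_inner \<Omega> u \<psi> - (of_real \<mu>)\<^sup>2 * L2_inner \<Omega> u \<psi>"

abbreviation D :: "'a \<Rightarrow> ('a \<Rightarrow> complex) \<Rightarrow> 'a \<Rightarrow> complex" where "D \<equiv> weak_partial \<Omega>"
abbreviation Lap :: "('a \<Rightarrow> complex) \<Rightarrow> 'a \<Rightarrow> complex" where "Lap \<equiv> weak_laplacian L"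

text \<open>Multiplication by the square root of the weight turns the weighted layer term into an
  ordinary \<open>L2\<close> inner product, so that the estimates for \<open>L2_inner\<close> and
  \<open>L2_norm\<close> apply unchanged.\<close>

definition flux :: "('a \<Rightarrow> complex) \<Rightarrow> 'a \<Rightarrow> complex" where
  "flux f x = of_real (sqrt (a x)) * f x"

definition E :: "real \<Rightarrow> ('a \<Rightarrow> complex) \<Rightarrow> 'a \<Rightarrow> complex" where
  "E \<mu> u = flux (\<lambda>x. Lap u x + of_real \<mu> * u x)"

definition grad2 :: "('a \<Rightarrow> complex) \<Rightarrow> real" where
  "grad2 u = (\<Sum>b\<in>Basis. (L2_norm \<Omega> (D b u))\<^sup>2)"

definition q :: "real \<Rightarrow> ('a \<Rightarrow> complex) \<Rightarrow> real" where
  "q \<mu> u = (L2_norm L (E \<mu> u))\<^sup>2 + \<mu> * grad2 u - \<mu>\<^sup>2 * (L2_norm \<Omega> u)\<^sup>2"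

lemmas \<Omega>_sets = open_sets_lebesgue[OF open_\<Omega>]
lemmas L_sets = open_sets_lebesgue[OF open_L]

lemma L2_L: "f \<in> L2 \<Omega> \<Longrightarrow> f \<in> L2 L"
  using L2_subset L_subset L_sets \<Omega>_sets by blast

lemma a_nonneg: "x \<in> L \<Longrightarrow> 0 \<le> a x"
  using a_lower[of x] a0_pos by linarith

lemma flux_L2:
  assumes "f \<in> L2 L"
  shows "flux f \<in> L2 L"
  unfolding flux_def[abs_def]
proof (rule L2_bounded_mult[OF assms])
  show "(\<lambda>x. complex_of_real (sqrt (a x))) \<in> borel_measurable (lebesgue_on L)"
    using a_measurable by measurable
  show "norm (complex_of_real (sqrt (a x))) \<le> sqrt a1" if "x \<in> L" for x
    using a_nonneg[OF that] a_upper[OF that] by simp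
qed

lemma flux_lower:
  assumes "f \<in> L2 L"
  shows "a0 * (L2_norm L f)\<^sup>2 \<le> (L2_norm L (flux f))\<^sup>2"
  unfolding L2_norm_power2 integral_mult_right_zero[symmetric]
proof (rule integral_mono)
  show "a0 * (norm (f x))\<^sup>2 \<le> (norm (flux f x))\<^sup>2" if "x \<in> space (lebesgue_on L)" for x
    using that a_nonneg[of x] a_lower[of x]
    by (simp add: flux_def norm_mult power_mult_distrib mult_right_mono)
qed (use L2D(2)[OF assms] L2D(2)[OF flux_L2[OF assms]] in auto)

lemma flux_upper:
  assumes "f \<in> L2 L"
  shows "(L2_norm L (flux f))\<^sup>2 \<le> a1 * (L2_norm L f)\<^sup>2"
  unfolding L2_norm_power2 integral_mult_right_zero[symmetric]
proof (rule integral_mono)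
  show "(norm (flux f x))\<^sup>2 \<le> a1 * (norm (f x))\<^sup>2" if "x \<in> space (lebesgue_on L)" for x
    using that a_nonneg[of x] a_upper[of x]
    by (simp add: flux_def norm_mult power_mult_distrib mult_right_mono)
qed (use L2D(2)[OF assms] L2D(2)[OF flux_L2[OF assms]] in auto)

section \<open>Linear structure of the energy space\<close>

lemma V_H10: "u \<in> V \<Longrightarrow> u \<in> H10 \<Omega>"
  by (simp add: V_def)

lemma V_L2: "u \<in> V \<Longrightarrow> u \<in> L2 \<Omega>"
  using V_H10 H10_L2 by blast

lemma V_D_L2: "u \<in> V \<Longrightarrow> b \<in> Basis \<Longrightarrow> D b u \<in> L2 \<Omega>"
  using V_H10 H10_weak_partial by blast

lemma V_Lap:
  assumes "u \<in> V" shows "is_weak_laplacian L u (Lap u)" "Lap u \<in> L2 L"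
proof -
  show "is_weak_laplacian L u (Lap u)"
    using assms is_weak_laplacian_weak_laplacian unfolding V_def by blast
  then show "Lap u \<in> L2 L" by (simp add: is_weak_laplacian_def)
qed

lemma V_E_L2: "u \<in> V \<Longrightarrow> E \<mu> u \<in> L2 L"
  unfolding E_def by (intro flux_L2 L2_add L2_scale V_Lap L2_L V_L2)

lemma D_add:
  assumes "u \<in> V" "v \<in> V" "b \<in> Basis"
  shows "AE x in lebesgue_on \<Omega>. D b (\<lambda>x. u x + c * v x) x = D b u x + c * D b v x"
  by (rule weak_partial_AE_eq[OF open_\<Omega> H10_add(2)[OF open_\<Omega> V_H10[OF assms(1)] V_H10[OF assms(2)] assms(3)]])

lemma is_weak_laplacian_add:
  assumes "u \<in> V" "v \<in> V"
  shows "is_weak_laplacian L (\<lambda>x. u x + c * v x) (\<lambda>x. Lap u x + c * Lap v x)"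
  using weak_op_add[OF open_L test_functions_laplacian L2_L[OF V_L2[OF assms(1)]] L2_L[OF V_L2[OF assms(2)]]]
    V_Lap(1)[OF assms(1)] V_Lap(1)[OF assms(2)] by (simp add: is_weak_laplacian_iff)

lemma Lap_add:
  assumes "u \<in> V" "v \<in> V"
  shows "AE x in lebesgue_on L. Lap (\<lambda>x. u x + c * v x) x = Lap u x + c * Lap v x"
  by (rule weak_laplacian_AE_eq[OF open_L is_weak_laplacian_add[OF assms]])

lemma normal_split:
  assumes "f \<in> L2 L" "\<And>b. b \<in> Basis \<Longrightarrow> g b \<in> L2 L" "\<phi> \<in> N"
  shows "(LINT x|lebesgue_on L. f x * \<phi> x + (\<Sum>b\<in>Basis. g b x * partial b \<phi> x))
    = (LINT x|lebesgue_on L. f x * \<phi> x) + (\<Sum>b\<in>Basis. LINT x|lebesgue_on L. g b x * partial b \<phi> x)"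
proof -
  have \<phi>: "\<phi> \<in> test_functions UNIV" using assms(3) N_subset by blast
  have 1: "integrable (lebesgue_on L) (\<lambda>x. f x * \<phi> x)"
    by (rule L2_mult_integrable[OF assms(1) test_functions_L2[OF \<phi> L_sets]])
  have 2: "integrable (lebesgue_on L) (\<lambda>x. g b x * partial b \<phi> x)" if "b \<in> Basis" for b
    by (rule L2_mult_integrable[OF assms(2)[OF that] test_functions_L2[OF test_functions_partial[OF \<phi> that] L_sets]])
  have "(LINT x|lebesgue_on L. f x * \<phi> x + (\<Sum>b\<in>Basis. g b x * partial b \<phi> x))
    = (LINT x|lebesgue_on L. f x * \<phi> x) + (LINT x|lebesgue_on L. (\<Sum>b\<in>Basis. g b x * partial b \<phi> x))"
    by (intro Bochner_Integration.integral_add 1 Bochner_Integration.integrable_sum 2)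
  also have "(LINT x|lebesgue_on L. (\<Sum>b\<in>Basis. g b x * partial b \<phi> x))
    = (\<Sum>b\<in>Basis. LINT x|lebesgue_on L. g b x * partial b \<phi> x)"
    by (rule Bochner_Integration.integral_sum[OF 2])
  finally show ?thesis .
qed

lemma AE_\<Omega>_imp_L:
  assumes "AE x in lebesgue_on \<Omega>. P x" shows "AE x in lebesgue_on L. P x"
  using assms \<Omega>_sets L_sets L_subset by (auto simp: AE_restrict_space_iff elim!: eventually_mono)

lemma normal_eq_cong:
  assumes "\<phi> \<in> N" "f \<in> L2 L" "f' \<in> L2 L" "AE x in lebesgue_on L. f x = f' x"
    and "\<And>b. b \<in> Basis \<Longrightarrow> g b \<in> L2 L" "\<And>b. b \<in> Basis \<Longrightarrow> g' b \<in> L2 L"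
    and "\<And>b. b \<in> Basis \<Longrightarrow> AE x in lebesgue_on L. g b x = g' b x"
  shows "(LINT x|lebesgue_on L. f x * \<phi> x + (\<Sum>b\<in>Basis. g b x * partial b \<phi> x)) =
    (LINT x|lebesgue_on L. f' x * \<phi> x + (\<Sum>b\<in>Basis. g' b x * partial b \<phi> x))"
proof -
  have \<phi>: "\<phi> \<in> test_functions UNIV" using assms(1) N_subset by blast
  have *: "(LINT x|lebesgue_on L. p x * \<psi> x) = (LINT x|lebesgue_on L. p' x * \<psi> x)"
    if "p \<in> L2 L" "p' \<in> L2 L" "AE x in lebesgue_on L. p x = p' x" "\<psi> \<in> L2 L" for p p' \<psi> :: "'a \<Rightarrow> complex"
    using L2_mult_integrable[OF that(1,4)] L2_mult_integrable[OF that(2,4)] that(3)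
    by (intro integral_cong_AE borel_measurable_integrable) (auto elim!: eventually_mono)
  have "(LINT x|lebesgue_on L. f x * \<phi> x) = (LINT x|lebesgue_on L. f' x * \<phi> x)"
    by (rule *[OF assms(2-4) test_functions_L2[OF \<phi> L_sets]])
  moreover have "(LINT x|lebesgue_on L. g b x * partial b \<phi> x) = (LINT x|lebesgue_on L. g' b x * partial b \<phi> x)"
    if "b \<in> Basis" for b
    by (rule *[OF assms(5-7) test_functions_L2[OF test_functions_partial[OF \<phi> that] L_sets]]) (fact that)+
  ultimately show ?thesis
    by (simp add: normal_split[OF assms(2,5,1)] normal_split[OF assms(3,6,1)])
qed

text \<open>Membership can be checked with any weak Laplacian \<open>h\<close> and any weak
  derivatives \<open>g b\<close>. The selected ones agree with them almost everywhere, so the Green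
  functional is the same.\<close>

lemma V_I:
  assumes "u \<in> H10 \<Omega>" "is_weak_laplacian L u h" "\<And>b. b \<in> Basis \<Longrightarrow> is_weak_partial \<Omega> b u (g b)"
    and "\<And>\<phi>. \<phi> \<in> N \<Longrightarrow> (LINT x|lebesgue_on L. h x * \<phi> x + (\<Sum>b\<in>Basis. g b x * partial b \<phi> x)) = 0"
  shows "u \<in> V"
proof -
  have h: "h \<in> L2 L" "Lap u \<in> L2 L"
    using assms(2) is_weak_laplacian_weak_laplacian[OF assms(2)] by (auto simp: is_weak_laplacian_def)
  have g: "g b \<in> L2 L" "D b u \<in> L2 L" if "b \<in> Basis" for b
    using assms(3)[OF that] H10_weak_partial(2)[OF assms(1) that] L2_L by (auto simp: is_weak_partial_def)
  have "(LINT x|lebesgue_on L. Lap u x * \<phi> x + (\<Sum>b\<in>Basis. D b u x * partial b \<phi> x)) = 0" if "\<phi> \<in> N" for \<phi>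
    using normal_eq_cong[OF that h(2,1) weak_laplacian_AE_eq[OF open_L assms(2)] g(2,1)
        AE_\<Omega>_imp_L[OF weak_partial_AE_eq[OF open_\<Omega> assms(3)]]] assms(4)[OF that] by simp
  then show ?thesis unfolding V_def using assms(1,2) by blast
qed

lemma V_add:
  assumes u: "u \<in> V" and v: "v \<in> V"
  shows "(\<lambda>x. u x + c * v x) \<in> V"
proof (rule V_I[OF H10_add(1)[OF open_\<Omega> V_H10[OF u] V_H10[OF v]] is_weak_laplacian_add[OF u v]
      H10_add(2)[OF open_\<Omega> V_H10[OF u] V_H10[OF v]]])
  fix \<phi> assume \<phi>: "\<phi> \<in> N"
  then have t: "\<phi> \<in> test_functions UNIV" using N_subset by blast
  note Lu = V_Lap(2)[OF u] and Lv = V_Lap(2)[OF v]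
    and Du = L2_L[OF V_D_L2[OF u]] and Dv = L2_L[OF V_D_L2[OF v]]
  have z: "(LINT x|lebesgue_on L. Lap w x * \<phi> x) + (\<Sum>b\<in>Basis. LINT x|lebesgue_on L. D b w x * partial b \<phi> x) = 0"
    if w: "w \<in> V" for w
    using w \<phi> normal_split[OF V_Lap(2)[OF w] L2_L[OF V_D_L2[OF w]] \<phi>] unfolding V_def by auto
  have "(LINT x|lebesgue_on L. (Lap u x + c * Lap v x) * \<phi> x +
      (\<Sum>b\<in>Basis. (D b u x + c * D b v x) * partial b \<phi> x)) =
    (LINT x|lebesgue_on L. (Lap u x + c * Lap v x) * \<phi> x) +
      (\<Sum>b\<in>Basis. LINT x|lebesgue_on L. (D b u x + c * D b v x) * partial b \<phi> x)"
    by (intro normal_split \<phi> L2_add L2_scale Lu Lv Du Dv)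
  also have "\<dots> = ((LINT x|lebesgue_on L. Lap u x * \<phi> x) + c * (LINT x|lebesgue_on L. Lap v x * \<phi> x)) +
     (\<Sum>b\<in>Basis. (LINT x|lebesgue_on L. D b u x * partial b \<phi> x) + c * (LINT x|lebesgue_on L. D b v x * partial b \<phi> x))"
    using L2_integral_mult_add[OF Lu Lv test_functions_L2[OF t L_sets]]
      L2_integral_mult_add[OF Du Dv test_functions_L2[OF test_functions_partial[OF t] L_sets]] by simp
  also have "\<dots> = 0"
    using z[OF u] z[OF v] by (simp add: sum.distrib flip: sum_distrib_left) algebra
  finally show "(LINT x|lebesgue_on L. (Lap u x + c * Lap v x) * \<phi> x +
      (\<Sum>b\<in>Basis. (D b u x + c * D b v x) * partial b \<phi> x)) = 0" .
qed

lemma V_scale: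
  assumes "u \<in> V" shows "(\<lambda>x. c * u x) \<in> V"
  \<comment> \<open>\<open>u + (c - 1) * u = c * u\<close>, so closure under combinations already
    contains closure under scaling.\<close>
  using V_add[OF assms assms, of "c - 1"] by (simp add: algebra_simps)

lemma V_diff:
  assumes "u \<in> V" "v \<in> V" shows "(\<lambda>x. u x - v x) \<in> V"
  using V_add[OF assms, of "-1"] by simp

lemma E_add:
  assumes "u \<in> V" "v \<in> V"
  shows "AE x in lebesgue_on L. E \<mu> (\<lambda>x. u x + c * v x) x = E \<mu> u x + c * E \<mu> v x"
  using Lap_add[OF assms, of c] by (rule eventually_mono) (simp add: E_def flux_def algebra_simps)

section \<open>The sesquilinear form and its quadratic form\<close>

lemma form_eq:
  assumes u: "u \<in> V" and v: "v \<in> V"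
  shows "form \<mu> u v = L2_inner L (E \<mu> u) (E \<mu> v) + of_real \<mu> * (\<Sum>b\<in>Basis. L2_inner \<Omega> (D b u) (D b v))
    - (of_real \<mu>)\<^sup>2 * L2_inner \<Omega> u v"
proof -
  have "(LINT x|lebesgue_on L. of_real (a x) * (Lap u x + of_real \<mu> * u x) * cnj (Lap v x + of_real \<mu> * v x))
    = L2_inner L (E \<mu> u) (E \<mu> v)"
    unfolding L2_inner_def
  proof (rule Bochner_Integration.integral_cong)
    fix x assume "x \<in> space (lebesgue_on L)"
    then have "complex_of_real (sqrt (a x)) * complex_of_real (sqrt (a x)) = of_real (a x)"
      using a_nonneg[of x] by (simp flip: of_real_mult)
    then show "of_real (a x) * (Lap u x + of_real \<mu> * u x) * cnj (Lap v x + of_real \<mu> * v x)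
      = E \<mu> u x * cnj (E \<mu> v x)"
      unfolding E_def flux_def by (simp add: mult_ac)
  qed simp
  moreover have "grad_inner \<Omega> u v = (\<Sum>b\<in>Basis. L2_inner \<Omega> (D b u) (D b v))"
    unfolding grad_inner_def L2_inner_def
    by (rule Bochner_Integration.integral_sum) (rule L2_inner_integrable[OF V_D_L2[OF u] V_D_L2[OF v]])
  ultimately show ?thesis unfolding form_def by simp
qed

lemma form_add_left:
  assumes u: "u \<in> V" and v: "v \<in> V" and w: "w \<in> V"
  shows "form \<mu> (\<lambda>x. u x + c * v x) w = form \<mu> u w + c * form \<mu> v w"
proof -
  have 1: "L2_inner L (E \<mu> (\<lambda>x. u x + c * v x)) (E \<mu> w) = L2_inner L (E \<mu> u) (E \<mu> w) + c * L2_inner L (E \<mu> v) (E \<mu> w)"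
  proof -
    have "L2_inner L (E \<mu> (\<lambda>x. u x + c * v x)) (E \<mu> w) = L2_inner L (\<lambda>x. E \<mu> u x + c * E \<mu> v x) (E \<mu> w)"
      by (intro L2_inner_cong_AE E_add V_E_L2 V_add L2_add L2_scale u v w) simp
    then show ?thesis by (simp add: L2_inner_add_left[OF V_E_L2[OF u] V_E_L2[OF v] V_E_L2[OF w]])
  qed
  have 2: "L2_inner \<Omega> (D b (\<lambda>x. u x + c * v x)) (D b w) = L2_inner \<Omega> (D b u) (D b w) + c * L2_inner \<Omega> (D b v) (D b w)"
    if b: "b \<in> Basis" for b
  proof -
    have "L2_inner \<Omega> (D b (\<lambda>x. u x + c * v x)) (D b w) = L2_inner \<Omega> (\<lambda>x. D b u x + c * D b v x) (D b w)"
      by (intro L2_inner_cong_AE D_add V_D_L2 V_add L2_add L2_scale u v w b) simp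
    then show ?thesis by (simp add: L2_inner_add_left[OF V_D_L2[OF u b] V_D_L2[OF v b] V_D_L2[OF w b]])
  qed
  show ?thesis
    unfolding form_eq[OF V_add[OF u v] w] form_eq[OF u w] form_eq[OF v w] 1
      L2_inner_add_left[OF V_L2[OF u] V_L2[OF v] V_L2[OF w]]
    by (simp add: 2 sum.distrib algebra_simps flip: sum_distrib_left)
qed

lemma form_commute:
  assumes u: "u \<in> V" and v: "v \<in> V"
  shows "form \<mu> v u = cnj (form \<mu> u v)"
  unfolding form_eq[OF u v] form_eq[OF v u] L2_inner_commute[of _ "E \<mu> v"] L2_inner_commute[of _ v]
    L2_inner_commute[of _ "D _ v"]
  by simp

lemma form_self:
  assumes "u \<in> V"
  shows "form \<mu> u u = of_real (q \<mu> u)"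
  unfolding form_eq[OF assms assms] q_def grad2_def L2_inner_self by simp

lemma q_add:
  assumes u: "u \<in> V" and v: "v \<in> V"
  shows "q \<mu> (\<lambda>x. u x + c * v x) = q \<mu> u + (norm c)\<^sup>2 * q \<mu> v + 2 * Re (cnj c * form \<mu> u v)"
proof -
  note w = V_add[OF u v, of c]
  have "form \<mu> (\<lambda>x. u x + c * v x) (\<lambda>x. u x + c * v x) =
     form \<mu> u (\<lambda>x. u x + c * v x) + c * form \<mu> v (\<lambda>x. u x + c * v x)"
    by (rule form_add_left[OF u v w])
  also have "form \<mu> u (\<lambda>x. u x + c * v x) = form \<mu> u u + cnj c * form \<mu> u v"
    unfolding form_commute[OF w u] form_add_left[OF u v u] form_commute[OF u v] by (simp add: form_self[OF u])
  also have "form \<mu> v (\<lambda>x. u x + c * v x) = cnj (form \<mu> u v) + cnj c * form \<mu> v v"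
    unfolding form_commute[OF w v] form_add_left[OF u v v] by (simp add: form_self[OF v])
  finally have "complex_of_real (q \<mu> (\<lambda>x. u x + c * v x)) =
    of_real (q \<mu> u) + cnj c * form \<mu> u v + c * (cnj (form \<mu> u v) + cnj c * of_real (q \<mu> v))"
    by (simp only: form_self[OF w] form_self[OF u] form_self[OF v])
  then have "Re (complex_of_real (q \<mu> (\<lambda>x. u x + c * v x))) =
    Re (of_real (q \<mu> u) + cnj c * form \<mu> u v + c * (cnj (form \<mu> u v) + cnj c * of_real (q \<mu> v)))"
    by simp
  then show ?thesis unfolding cmod_power2 by (simp add: algebra_simps power2_eq_square)
qed

lemma q_scale:
  assumes "u \<in> V" shows "q \<mu> (\<lambda>x. c * u x) = (norm c)\<^sup>2 * q \<mu> u"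
proof -
  have "q \<mu> (\<lambda>x. u x + (c - 1) * u x) = q \<mu> u + (norm (c - 1))\<^sup>2 * q \<mu> u + 2 * Re (cnj (c - 1) * form \<mu> u u)"
    by (rule q_add[OF assms assms])
  also have "\<dots> = (norm c)\<^sup>2 * q \<mu> u"
    unfolding form_self[OF assms] cmod_power2 by (simp add: algebra_simps power2_eq_square)
  finally show ?thesis by (simp add: algebra_simps)
qed

lemma q_parallelogram:
  assumes u: "u \<in> V" and v: "v \<in> V"
  shows "q \<mu> (\<lambda>x. u x - v x) + q \<mu> (\<lambda>x. u x + v x) = 2 * q \<mu> u + 2 * q \<mu> v"
  using q_add[OF u v, of \<mu> 1] q_add[OF u v, of \<mu> "-1"] by simp

text \<open>An isotropic vector of a nonnegative form lies in its kernel: otherwise a small step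
  from \<open>u\<close> in a suitable multiple of the direction \<open>v\<close> would make the form
  negative.\<close>

lemma form_eq_0_if_q_eq_0:
  assumes nonneg: "\<And>w. w \<in> V \<Longrightarrow> 0 \<le> q \<mu> w" and u: "u \<in> V" "q \<mu> u = 0" and v: "v \<in> V"
  shows "form \<mu> u v = 0"
proof (rule ccontr)
  assume F: "form \<mu> u v \<noteq> 0"
  \<comment> \<open>With \<open>c = - t * form \<mu> u v\<close> the value at
    \<open>u + c * v\<close> is t |form|^2 (t q(v) - 2). This \<open>t\<close> keeps t q(v) at most
    1, and the \<open>+ 1\<close> covers q(v) = 0.\<close>
  define t where "t = 1 / (q \<mu> v + 1)"
  have t: "t > 0" using nonneg[OF v] by (simp add: t_def add_nonneg_pos)
  let ?c = "- (of_real t * form \<mu> u v)"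
  let ?n = "(norm (form \<mu> u v))\<^sup>2"
  have n: "?n > 0" using F by simp
  have "cnj (form \<mu> u v) * form \<mu> u v = of_real ?n"
    by (simp only: complex_norm_square mult.commute)
  then have re: "Re (cnj ?c * form \<mu> u v) = - (t * ?n)"
    by (simp add: mult.assoc)
  have "0 \<le> q \<mu> (\<lambda>x. u x + ?c * v x)" by (rule nonneg[OF V_add[OF u(1) v]])
  also have "\<dots> = (norm ?c)\<^sup>2 * q \<mu> v + 2 * Re (cnj ?c * form \<mu> u v)"
    unfolding q_add[OF u(1) v] u(2) by simp
  also have "(norm ?c)\<^sup>2 = t\<^sup>2 * ?n"
    by (simp add: norm_mult power_mult_distrib)
  also have "t\<^sup>2 * ?n * q \<mu> v + 2 * Re (cnj ?c * form \<mu> u v) = t * ?n * (t * q \<mu> v - 2)"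
    unfolding re by (simp add: power2_eq_square algebra_simps)
  finally have "0 \<le> t * q \<mu> v - 2"
    using mult_le_cancel_left_pos[OF mult_pos_pos[OF t n], of 0 "t * q \<mu> v - 2"] by simp
  moreover have "t * q \<mu> v \<le> 1"
    using nonneg[OF v] by (simp add: t_def divide_simps add_nonneg_pos)
  ultimately show False by simp
qed

text \<open>Displays \<open>q\<close> as a polynomial in \<mu> whose coefficients depend on
  \<open>u\<close> only. Both the limit in \<mu> at the infimum and the comparison of
  \<open>q\<close> at two parameters rest on this form.\<close>

lemma q_polynomial:
  assumes u: "u \<in> V"
  shows "q \<mu> u = (L2_norm L (flux (Lap u)))\<^sup>2 + \<mu> * (2 * Re (L2_inner L (flux (Lap u)) (flux u)) + grad2 u)
     + \<mu>\<^sup>2 * ((L2_norm L (flux u))\<^sup>2 - (L2_norm \<Omega> u)\<^sup>2)"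
proof -
  note f = flux_L2[OF V_Lap(2)[OF u]] and g = flux_L2[OF L2_L[OF V_L2[OF u]]]
  have E: "E \<mu> u = (\<lambda>x. flux (Lap u) x + of_real \<mu> * flux u x)"
    by (auto simp: E_def flux_def algebra_simps)
  have "complex_of_real ((L2_norm L (E \<mu> u))\<^sup>2) = L2_inner L (\<lambda>x. flux (Lap u) x + of_real \<mu> * flux u x)
      (\<lambda>x. flux (Lap u) x + of_real \<mu> * flux u x)"
    by (simp add: L2_inner_self E)
  also have "\<dots> = L2_inner L (flux (Lap u)) (flux (Lap u)) + of_real \<mu> * L2_inner L (flux (Lap u)) (flux u) +
     of_real \<mu> * (cnj (L2_inner L (flux (Lap u)) (flux u)) + of_real \<mu> * L2_inner L (flux u) (flux u))"
    unfolding L2_inner_add_left[OF f g L2_add[OF f L2_scale[OF g]]] L2_inner_add_right[OF f g f]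
      L2_inner_add_right[OF f g g] L2_inner_commute[of L "flux u" "flux (Lap u)"] by simp
  finally have "Re (complex_of_real ((L2_norm L (E \<mu> u))\<^sup>2)) =
     Re (L2_inner L (flux (Lap u)) (flux (Lap u)) + of_real \<mu> * L2_inner L (flux (Lap u)) (flux u) +
     of_real \<mu> * (cnj (L2_inner L (flux (Lap u)) (flux u)) + of_real \<mu> * L2_inner L (flux u) (flux u)))"
    by simp
  then have "(L2_norm L (E \<mu> u))\<^sup>2 = (L2_norm L (flux (Lap u)))\<^sup>2 + \<mu> * (2 * Re (L2_inner L (flux (Lap u)) (flux u)))
     + \<mu>\<^sup>2 * (L2_norm L (flux u))\<^sup>2"
    unfolding L2_inner_self by (simp add: power2_eq_square algebra_simps)
  then show ?thesis unfolding q_def by (simp add: algebra_simps)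
qed

end

lemma L2_inner_norm_le:
  assumes "f \<in> L2 U" "g \<in> L2 U"
  shows "norm (L2_inner U f g) \<le> L2_norm U f * L2_norm U g"
  using L2_Cauchy_Schwarz_mult[OF assms(1) L2_cnj[OF assms(2)]]
  by (simp add: L2_inner_def L2_norm_def)

context layer_problem
begin

section \<open>The least parameter at which the form is not positive\<close>

lemma D_diff_norm:
  assumes "u \<in> V" "v \<in> V" "b \<in> Basis"
  shows "L2_norm \<Omega> (D b (\<lambda>x. u x - v x)) = L2_norm \<Omega> (\<lambda>x. D b u x - D b v x)"
proof (rule L2_norm_cong_AE)
  show "D b (\<lambda>x. u x - v x) \<in> borel_measurable (lebesgue_on \<Omega>)"
    by (rule L2D(1)[OF V_D_L2[OF V_diff[OF assms(1,2)] assms(3)]])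
  show "(\<lambda>x. D b u x - D b v x) \<in> borel_measurable (lebesgue_on \<Omega>)"
    by (rule L2D(1)[OF L2_diff[OF V_D_L2[OF assms(1,3)] V_D_L2[OF assms(2,3)]]])
  show "AE x in lebesgue_on \<Omega>. D b (\<lambda>x. u x - v x) x = D b u x - D b v x"
    using D_add[OF assms, of "-1"] by simp
qed

lemma Lap_diff_norm:
  assumes "u \<in> V" "v \<in> V"
  shows "L2_norm L (Lap (\<lambda>x. u x - v x)) = L2_norm L (\<lambda>x. Lap u x - Lap v x)"
proof (rule L2_norm_cong_AE)
  show "Lap (\<lambda>x. u x - v x) \<in> borel_measurable (lebesgue_on L)"
    by (rule L2D(1)[OF V_Lap(2)[OF V_diff[OF assms]]])
  show "(\<lambda>x. Lap u x - Lap v x) \<in> borel_measurable (lebesgue_on L)"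
    by (rule L2D(1)[OF L2_diff[OF V_Lap(2)[OF assms(1)] V_Lap(2)[OF assms(2)]]])
  show "AE x in lebesgue_on L. Lap (\<lambda>x. u x - v x) x = Lap u x - Lap v x"
    using Lap_add[OF assms, of "-1"] by simp
qed

lemma norm_L_le: "u \<in> L2 \<Omega> \<Longrightarrow> L2_norm L u \<le> L2_norm \<Omega> u"
  by (rule L2_norm_mono[OF _ L_subset L_sets \<Omega>_sets])

lemma grad2_nonneg: "0 \<le> grad2 u"
  unfolding grad2_def by (intro sum_nonneg) simp

lemma D_norm_le_grad2: "b \<in> Basis \<Longrightarrow> (L2_norm \<Omega> (D b u))\<^sup>2 \<le> grad2 u"
  unfolding grad2_def by (intro member_le_sum) auto

text \<open>Membership asks for an inequality rather than a zero of \<open>q\<close>, so an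
  eigenfunction and a mere trial function both witness it. The requirement on the norm excludes
  functions vanishing almost everywhere.\<close>

definition S :: "real set" where
  "S = {\<mu>. 0 < \<mu> \<and> (\<exists>u\<in>V. L2_norm \<Omega> u \<noteq> 0 \<and> q \<mu> u \<le> 0)}"

lemma q_le_0_grad2:
  assumes "0 < \<mu>" "q \<mu> u \<le> 0"
  shows "grad2 u \<le> \<mu> * (L2_norm \<Omega> u)\<^sup>2"
proof -
  have "\<mu> * grad2 u \<le> \<mu> * (\<mu> * (L2_norm \<Omega> u)\<^sup>2)"
    using assms(2) zero_le_power2[of "L2_norm L (E \<mu> u)"] unfolding q_def power2_eq_square[of \<mu>]
    by (simp only: mult.assoc)
  then show ?thesis using assms(1) by simp
qed

text \<open>The Poincare inequality keeps \<open>S\<close> away from 0. At \<mu> = 0 only the layer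
  term of \<open>q\<close> is left, and it vanishes for every function supported off the layer, so
  positivity of the infimum is a genuine statement.\<close>

lemma S_lower_bound: "\<exists>m>0. \<forall>\<mu>\<in>S. m \<le> \<mu>"
proof -
  obtain c where c: "c > 0" "\<And>u. u \<in> H10 \<Omega> \<Longrightarrow> (L2_norm \<Omega> u)\<^sup>2 \<le> c * (\<Sum>b\<in>Basis. (L2_norm \<Omega> (D b u))\<^sup>2)"
    using Poincare[OF open_\<Omega> bounded_\<Omega>] by blast
  have "1 / c \<le> \<mu>" if \<mu>: "\<mu> \<in> S" for \<mu>
  proof -
    obtain u where u: "u \<in> V" "L2_norm \<Omega> u \<noteq> 0" "q \<mu> u \<le> 0" "\<mu> > 0" using \<mu> unfolding S_def by blast
    have n: "(L2_norm \<Omega> u)\<^sup>2 > 0" using u(2) by simp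
    have g: "grad2 u \<le> \<mu> * (L2_norm \<Omega> u)\<^sup>2" by (rule q_le_0_grad2[OF u(4,3)])
    have "(L2_norm \<Omega> u)\<^sup>2 \<le> c * grad2 u" using c(2)[OF V_H10[OF u(1)]] by (simp add: grad2_def)
    also have "\<dots> \<le> c * (\<mu> * (L2_norm \<Omega> u)\<^sup>2)" using g c(1) by (intro mult_left_mono) auto
    finally have "1 * (L2_norm \<Omega> u)\<^sup>2 \<le> (c * \<mu>) * (L2_norm \<Omega> u)\<^sup>2" by simp
    then have "1 \<le> c * \<mu>" by (rule mult_right_le_imp_le[OF _ n])
    then show ?thesis using c(1) by (simp add: divide_simps mult.commute)
  qed
  then show ?thesis using c(1) by (intro exI[of _ "1 / c"]) auto
qed

lemma Inf_S:
  assumes "S \<noteq> {}"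
  shows "0 < Inf S" "\<mu> \<in> S \<Longrightarrow> Inf S \<le> \<mu>"
proof -
  obtain m where m: "m > 0" "\<And>\<mu>. \<mu> \<in> S \<Longrightarrow> m \<le> \<mu>" using S_lower_bound by blast
  have bdd: "bdd_below S" using m(2) by (intro bdd_belowI) auto
  show "0 < Inf S" using cInf_greatest[OF assms m(2)] m(1) by linarith
  show "\<mu> \<in> S \<Longrightarrow> Inf S \<le> \<mu>" using cInf_lower[OF _ bdd] .
qed

text \<open>Positive parameters below the infimum are not in \<open>S\<close>, so \<open>q\<close>
  is nonnegative there, and being polynomial in \<mu> it keeps this at the limit. If
  \<open>w\<close> has norm 0, the only negative term of \<open>q\<close> is absent.\<close>

lemma q_nonneg_Inf_S:
  assumes S: "S \<noteq> {}" and w: "w \<in> V"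
  shows "0 \<le> q (Inf S) w"
proof (cases "L2_norm \<Omega> w = 0")
  case True
  then show ?thesis using Inf_S(1)[OF S] grad2_nonneg[of w] by (simp add: q_def)
next
  case False
  let ?m = "Inf S"
  \<comment> \<open>Approaches \<open>?m\<close> strictly from below and never falls under
    \<open>?m / 2\<close>, hence stays positive.\<close>
  let ?\<mu> = "\<lambda>k. ?m - (?m / 2) * inverse (real (Suc k))"
  have m: "0 < ?m" by (rule Inf_S(1)[OF S])
  have lim: "?\<mu> \<longlonglongrightarrow> ?m - (?m / 2) * 0"
    by (intro tendsto_intros LIMSEQ_inverse_real_of_nat)
  have nonS: "0 \<le> q \<mu> w" if "\<mu> \<notin> S" "0 < \<mu>" for \<mu>
  proof (rule ccontr)
    assume "\<not> 0 \<le> q \<mu> w"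
    then have "q \<mu> w \<le> 0" by linarith
    with w False that(2) have "\<mu> \<in> S" unfolding S_def by blast
    with that(1) show False by blast
  qed
  have "0 \<le> q (?\<mu> k) w" for k
  proof -
    have i: "0 < inverse (real (Suc k))" "inverse (real (Suc k)) \<le> 1" by (simp_all add: inverse_eq_divide)
    have "(?m / 2) * inverse (real (Suc k)) \<le> (?m / 2) * 1" using m i by (intro mult_left_mono) auto
    moreover have "0 < (?m / 2) * inverse (real (Suc k))" using m i by (intro mult_pos_pos) auto
    ultimately have "0 < ?\<mu> k" "?\<mu> k < ?m" using m by linarith+
    then have "?\<mu> k \<notin> S" using Inf_S(2)[OF S, of "?\<mu> k"] by linarith
    from nonS[OF this \<open>0 < ?\<mu> k\<close>] show ?thesis .
  qed
  moreover have "(\<lambda>k. q (?\<mu> k) w) \<longlonglongrightarrow> q (?m - (?m / 2) * 0) w"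
    unfolding q_polynomial[OF w] by (intro tendsto_add tendsto_mult tendsto_const tendsto_power lim)
  ultimately show ?thesis by (intro LIMSEQ_le_const) auto
qed

lemma minimizing_sequence:
  assumes "S \<noteq> {}"
  shows "\<exists>\<mu> u. \<forall>k. \<mu> k \<in> S \<and> \<mu> k < Inf S + inverse (real (Suc k)) \<and> u k \<in> V \<and>
    L2_norm \<Omega> (u k) = 1 \<and> q (\<mu> k) (u k) \<le> 0"
proof -
  have "\<exists>\<mu>u. fst \<mu>u \<in> S \<and> fst \<mu>u < Inf S + inverse (real (Suc k)) \<and> snd \<mu>u \<in> V \<and>
    L2_norm \<Omega> (snd \<mu>u) = 1 \<and> q (fst \<mu>u) (snd \<mu>u) \<le> 0" for k
  proof -
    have "Inf S < Inf S + inverse (real (Suc k))" by simp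
    from cInf_lessD[OF assms this] obtain \<mu> where \<mu>: "\<mu> \<in> S" "\<mu> < Inf S + inverse (real (Suc k))" by blast
    then obtain u where u: "u \<in> V" "L2_norm \<Omega> u \<noteq> 0" "q \<mu> u \<le> 0" unfolding S_def by blast
    let ?c = "complex_of_real (1 / L2_norm \<Omega> u)"
    have c: "norm ?c = 1 / L2_norm \<Omega> u" by (simp only: norm_of_real abs_divide abs_one) simp
    have "L2_norm \<Omega> (\<lambda>x. ?c * u x) = 1"
      unfolding L2_norm_scale c using u(2) by simp
    moreover have "q \<mu> (\<lambda>x. ?c * u x) \<le> 0"
      unfolding q_scale[OF u(1)] using u(3) by (intro mult_nonneg_nonpos) auto
    ultimately show ?thesis
      using \<mu> V_scale[OF u(1), of ?c] by (intro exI[of _ "(\<mu>, \<lambda>x. ?c * u x)"]) auto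
  qed
  then obtain F where "\<And>k. fst (F k) \<in> S \<and> fst (F k) < Inf S + inverse (real (Suc k)) \<and> snd (F k) \<in> V \<and>
    L2_norm \<Omega> (snd (F k)) = 1 \<and> q (fst (F k)) (snd (F k)) \<le> 0" by metis
  then show ?thesis by (intro exI[of _ "\<lambda>k. fst (F k)"] exI[of _ "\<lambda>k. snd (F k)"]) auto
qed

text \<open>The absolute value of \<open>a1\<close> is taken because an empty layer leaves the sign
  of \<open>a1\<close> open.\<close>

lemma E_norm_le:
  assumes u: "u \<in> V" and "\<mu> \<ge> 0"
  shows "(L2_norm L (E \<mu> u))\<^sup>2 \<le> \<bar>a1\<bar> * (L2_norm L (Lap u) + \<mu> * L2_norm \<Omega> u)\<^sup>2"
proof -
  note p = V_Lap(2)[OF u] and r = L2_L[OF V_L2[OF u]]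
  have "(L2_norm L (E \<mu> u))\<^sup>2 \<le> a1 * (L2_norm L (\<lambda>x. Lap u x + of_real \<mu> * u x))\<^sup>2"
    unfolding E_def by (rule flux_upper[OF L2_add[OF p L2_scale[OF r]]])
  also have "\<dots> \<le> \<bar>a1\<bar> * (L2_norm L (\<lambda>x. Lap u x + of_real \<mu> * u x))\<^sup>2"
    by (intro mult_right_mono) auto
  also have "\<dots> \<le> \<bar>a1\<bar> * (L2_norm L (Lap u) + \<mu> * L2_norm \<Omega> u)\<^sup>2"
  proof (intro mult_left_mono power_mono)
    have "L2_norm L (\<lambda>x. Lap u x + of_real \<mu> * u x) \<le> L2_norm L (Lap u) + L2_norm L (\<lambda>x. of_real \<mu> * u x)"
      by (rule L2_norm_triangle[OF p L2_scale[OF r]])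
    also have "L2_norm L (\<lambda>x. of_real \<mu> * u x) \<le> \<mu> * L2_norm \<Omega> u"
      using norm_L_le[OF V_L2[OF u]] assms(2) by (simp add: L2_norm_scale mult_left_mono)
    finally show "L2_norm L (\<lambda>x. Lap u x + of_real \<mu> * u x) \<le> L2_norm L (Lap u) + \<mu> * L2_norm \<Omega> u" by simp
  qed auto
  finally show ?thesis .
qed

text \<open>The layer term controls the Laplacian only up to a multiple of \<open>u\<close>. Since
  \<open>a0\<close> is a positive lower bound of the weight, convergence of \<open>E \<mu> u\<close>
  and of \<open>u\<close> yields convergence of the Laplacians.\<close>

lemma Lap_norm_le:
  assumes u: "u \<in> V" and "\<mu> \<ge> 0"
  shows "L2_norm L (Lap u) \<le> L2_norm L (E \<mu> u) / sqrt a0 + \<mu> * L2_norm \<Omega> u"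
proof -
  note p = V_Lap(2)[OF u] and r = L2_L[OF V_L2[OF u]]
  let ?f = "\<lambda>x. Lap u x + of_real \<mu> * u x"
  have f: "?f \<in> L2 L" by (rule L2_add[OF p L2_scale[OF r]])
  have "(sqrt a0 * L2_norm L ?f)\<^sup>2 \<le> (L2_norm L (E \<mu> u))\<^sup>2"
    using flux_lower[OF f] a0_pos by (simp add: E_def power_mult_distrib)
  then have "sqrt a0 * L2_norm L ?f \<le> L2_norm L (E \<mu> u)" by (rule power2_le_imp_le) simp
  then have 1: "L2_norm L ?f \<le> L2_norm L (E \<mu> u) / sqrt a0"
    using a0_pos by (simp add: pos_le_divide_eq mult.commute)
  have "L2_norm L (Lap u) \<le> L2_norm L ?f + L2_norm L (\<lambda>x. Lap u x - ?f x)"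
    by (rule L2_norm_le_diff[OF p f])
  also have "L2_norm L (\<lambda>x. Lap u x - ?f x) = \<mu> * L2_norm L u"
    using L2_norm_scale[of L "- complex_of_real \<mu>" u] assms(2) by simp
  also have "\<mu> * L2_norm L u \<le> \<mu> * L2_norm \<Omega> u"
    by (intro mult_left_mono norm_L_le V_L2 u assms(2))
  finally show ?thesis using 1 by simp
qed

text \<open>A near-minimizer is known to satisfy q \<le> 0 only at its own parameter. Moving to
  \<open>m\<close> costs a multiple of \<open>\<mu> - m\<close>, because normalization and q \<le> 0
  bound the coefficients of the polynomial; the energy enters with the favourable sign and is
  dropped.\<close>

lemma q_shift_le:
  assumes u: "u \<in> V" and n1: "L2_norm \<Omega> u = 1" and q: "q \<mu> u \<le> 0"
    and m: "0 < m" "m \<le> \<mu>" "\<mu> \<le> M"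
  shows "q m u \<le> (\<mu> - m) * (2 * ((M + M * sqrt \<bar>a1\<bar>) * sqrt \<bar>a1\<bar>) + 2 * M * (\<bar>a1\<bar> + 1))"
proof -
  have mu: "0 < \<mu>" using m by linarith
  let ?F = "flux (Lap u)" and ?G = "flux u" and ?A = "sqrt \<bar>a1\<bar>"
  note FL = flux_L2[OF V_Lap(2)[OF u]] and GL = flux_L2[OF L2_L[OF V_L2[OF u]]]
  have "(L2_norm L ?G)\<^sup>2 \<le> a1 * (L2_norm L u)\<^sup>2" by (rule flux_upper[OF L2_L[OF V_L2[OF u]]])
  also have "\<dots> \<le> \<bar>a1\<bar> * 1\<^sup>2"
    using norm_L_le[OF V_L2[OF u]] n1 by (intro mult_mono power_mono) auto
  finally have "(L2_norm L ?G)\<^sup>2 \<le> \<bar>a1\<bar>" by simp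
  then have G1: "L2_norm L ?G \<le> ?A" by (rule real_le_rsqrt)
  have "(L2_norm L (E \<mu> u))\<^sup>2 \<le> \<mu>\<^sup>2"
    using q n1 mult_nonneg_nonneg[OF less_imp_le[OF mu] grad2_nonneg[of u]] by (simp add: q_def)
  then have E1: "L2_norm L (E \<mu> u) \<le> \<mu>" by (rule power2_le_imp_le) (use mu in simp)
  have "L2_norm L ?F \<le> L2_norm L (E \<mu> u) + L2_norm L (\<lambda>x. ?F x - E \<mu> u x)"
    by (rule L2_norm_le_diff[OF FL V_E_L2[OF u]])
  also have "(\<lambda>x. ?F x - E \<mu> u x) = (\<lambda>x. - of_real \<mu> * ?G x)"
    by (auto simp: E_def flux_def algebra_simps)
  also have "L2_norm L (\<lambda>x. - of_real \<mu> * ?G x) = \<mu> * L2_norm L ?G"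
    using mu by (simp only: L2_norm_scale norm_minus_cancel norm_of_real abs_of_pos)
  also have "L2_norm L (E \<mu> u) + \<mu> * L2_norm L ?G \<le> M + M * ?A"
    using E1 G1 m mu by (intro add_mono mult_mono) auto
  finally have F1: "L2_norm L ?F \<le> M + M * ?A" by simp
  let ?I = "Re (L2_inner L ?F ?G)"
  have "\<bar>?I\<bar> \<le> norm (L2_inner L ?F ?G)" by (rule abs_Re_le_cmod)
  also have "\<dots> \<le> L2_norm L ?F * L2_norm L ?G" by (rule L2_inner_norm_le[OF FL GL])
  also have "\<dots> \<le> (M + M * ?A) * ?A" using F1 G1 m mu by (intro mult_mono) auto
  finally have I: "- ?I \<le> (M + M * ?A) * ?A" by linarith
  let ?C = "(L2_norm L ?G)\<^sup>2 - 1"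
  have C: "- ?C \<le> \<bar>a1\<bar> + 1" using zero_le_power2[of "L2_norm L ?G"] by linarith
  have "q m u = q \<mu> u + (\<mu> - m) * (2 * (- ?I) - grad2 u + (\<mu> + m) * (- ?C))"
    unfolding q_polynomial[OF u, of m] q_polynomial[OF u, of \<mu>] n1
    by (simp add: power2_eq_square algebra_simps)
  also have "\<dots> \<le> 0 + (\<mu> - m) * (2 * ((M + M * ?A) * ?A) + 2 * M * (\<bar>a1\<bar> + 1))"
  proof (rule add_mono[OF q mult_left_mono])
    have "(\<mu> + m) * (- ?C) \<le> (\<mu> + m) * (\<bar>a1\<bar> + 1)" using C m by (intro mult_left_mono) auto
    also have "\<dots> \<le> 2 * M * (\<bar>a1\<bar> + 1)" using m by (intro mult_right_mono) auto
    finally show "2 * (- ?I) - grad2 u + (\<mu> + m) * (- ?C) \<le> 2 * ((M + M * ?A) * ?A) + 2 * M * (\<bar>a1\<bar> + 1)"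
      using I grad2_nonneg[of u] by linarith
  qed (use m in auto)
  finally show ?thesis by simp
qed

text \<open>Closedness of \<open>V\<close> in its graph norm. The condition on the normal derivative
  survives because it is a sum of pairings with fixed \<open>L2\<close> functions.\<close>

lemma V_limit:
  assumes w: "\<And>k. w k \<in> V" and v: "v \<in> L2 \<Omega>" "(\<lambda>k. L2_norm \<Omega> (\<lambda>x. w k x - v x)) \<longlonglongrightarrow> 0"
    and g: "\<And>b. b \<in> Basis \<Longrightarrow> g b \<in> L2 \<Omega>"
    "\<And>b. b \<in> Basis \<Longrightarrow> (\<lambda>k. L2_norm \<Omega> (\<lambda>x. D b (w k) x - g b x)) \<longlonglongrightarrow> 0"
    and h: "h \<in> L2 L" "(\<lambda>k. L2_norm L (\<lambda>x. Lap (w k) x - h x)) \<longlonglongrightarrow> 0"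
  shows "v \<in> V" "b \<in> Basis \<Longrightarrow> is_weak_partial \<Omega> b v (g b)" "is_weak_laplacian L v h"
proof -
  have toL: "(\<lambda>k. L2_norm L (\<lambda>x. f k x - f' x)) \<longlonglongrightarrow> 0"
    if "(\<lambda>k. L2_norm \<Omega> (\<lambda>x. f k x - f' x)) \<longlonglongrightarrow> 0" "\<And>k. f k \<in> L2 \<Omega>" "f' \<in> L2 \<Omega>" for f f'
    by (rule tendsto_sandwich[OF _ _ tendsto_const that(1)])
       (auto intro!: always_eventually norm_L_le L2_diff that(2,3))
  note H = H10_limit[OF open_\<Omega> V_H10[OF w] v g]
  show "is_weak_partial \<Omega> b v (g b)" if "b \<in> Basis" for b by (rule H(2)[OF _ _ that]) auto
  then have gp: "\<And>b. b \<in> Basis \<Longrightarrow> is_weak_partial \<Omega> b v (g b)" by blast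
  show hl: "is_weak_laplacian L v h"
    using weak_op_limit[OF open_L test_functions_laplacian L2_L[OF V_L2[OF w]] L2_L[OF v(1)]
        toL[OF v(2) V_L2[OF w] v(1)] h] V_Lap(1)[OF w] by (simp add: is_weak_laplacian_iff)
  show "v \<in> V"
  proof (rule V_I[OF _ hl gp])
    show "v \<in> H10 \<Omega>" by (rule H(1)) auto
    fix \<phi> assume \<phi>: "\<phi> \<in> N"
    then have t: "\<phi> \<in> test_functions UNIV" using N_subset by blast
    have z: "(LINT x|lebesgue_on L. Lap (w k) x * \<phi> x) + (\<Sum>b\<in>Basis. LINT x|lebesgue_on L. D b (w k) x * partial b \<phi> x) = 0" for k
      using w[of k] \<phi> normal_split[OF V_Lap(2)[OF w] L2_L[OF V_D_L2[OF w]] \<phi>] unfolding V_def by auto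
    have "(\<lambda>k. (LINT x|lebesgue_on L. Lap (w k) x * \<phi> x) + (\<Sum>b\<in>Basis. LINT x|lebesgue_on L. D b (w k) x * partial b \<phi> x))
      \<longlonglongrightarrow> (LINT x|lebesgue_on L. h x * \<phi> x) + (\<Sum>b\<in>Basis. LINT x|lebesgue_on L. g b x * partial b \<phi> x)"
    proof (intro tendsto_add tendsto_sum)
      show "(\<lambda>k. LINT x|lebesgue_on L. Lap (w k) x * \<phi> x) \<longlonglongrightarrow> (LINT x|lebesgue_on L. h x * \<phi> x)"
        by (rule L2_integral_mult_tendsto[OF V_Lap(2)[OF w] h(1) test_functions_L2[OF t L_sets] h(2)])
      show "(\<lambda>k. LINT x|lebesgue_on L. D b (w k) x * partial b \<phi> x) \<longlonglongrightarrow> (LINT x|lebesgue_on L. g b x * partial b \<phi> x)"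
        if b: "b \<in> Basis" for b
        by (rule L2_integral_mult_tendsto[OF L2_L[OF V_D_L2[OF w b]] L2_L[OF g(1)[OF b]]
            test_functions_L2[OF test_functions_partial[OF t b] L_sets] toL[OF g(2)[OF b] V_D_L2[OF w b] g(1)[OF b]]])
    qed
    then have "0 = (LINT x|lebesgue_on L. h x * \<phi> x) + (\<Sum>b\<in>Basis. LINT x|lebesgue_on L. g b x * partial b \<phi> x)"
      unfolding z by (rule LIMSEQ_unique[OF tendsto_const])
    then show "(LINT x|lebesgue_on L. h x * \<phi> x + (\<Sum>b\<in>Basis. g b x * partial b \<phi> x)) = 0"
      using normal_split[OF h(1) L2_L[OF g(1)] \<phi>] by simp
  qed
qed

text \<open>By the parallelogram law a minimizing sequence that is Cauchy in \<open>L\<^sup>2\<close> is Cauchy in the norm of the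
  space \<open>V\<close>, so no weak convergence is needed.\<close>

theorem minimizer:
  assumes S: "S \<noteq> {}"
  shows "\<exists>u\<in>V. L2_norm \<Omega> u = 1 \<and> q (Inf S) u = 0"
proof -
  let ?m = "Inf S"
  let ?F = "sequentially \<times>\<^sub>F sequentially"
  have m: "0 < ?m" by (rule Inf_S(1)[OF S])
  obtain \<mu> u where "\<forall>k. \<mu> k \<in> S \<and> \<mu> k < ?m + inverse (real (Suc k)) \<and> u k \<in> V \<and>
    L2_norm \<Omega> (u k) = 1 \<and> q (\<mu> k) (u k) \<le> 0" using minimizing_sequence[OF S] by blast
  then have \<mu>: "\<And>k. \<mu> k \<in> S" "\<And>k. \<mu> k < ?m + inverse (real (Suc k))" and u: "\<And>k. u k \<in> V"
    and n1: "\<And>k. L2_norm \<Omega> (u k) = 1" and q0: "\<And>k. q (\<mu> k) (u k) \<le> 0" by auto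
  \<comment> \<open>Bounds every \<open>\<mu> k\<close>; being at least 1, it also bounds the norm 1
    of \<open>u k\<close> and the square root of \<open>\<mu> k\<close>, hence the first
    derivatives.\<close>
  let ?M = "?m + 1"
  have \<mu>m: "?m \<le> \<mu> k" for k by (rule Inf_S(2)[OF S \<mu>(1)])
  have i1: "inverse (real (Suc k)) \<le> 1" for k by (simp add: inverse_eq_divide)
  have \<mu>M: "\<mu> k \<le> ?M" for k using \<mu>(2)[of k] i1[of k] by linarith
  have \<mu>0: "0 < \<mu> k" for k using \<mu>m[of k] m by linarith
  define e where "e k = q ?m (u k)" for k
  have e0: "0 \<le> e k" for k unfolding e_def by (rule q_nonneg_Inf_S[OF S u])
  define K where "K = 2 * ((?M + ?M * sqrt \<bar>a1\<bar>) * sqrt \<bar>a1\<bar>) + 2 * ?M * (\<bar>a1\<bar> + 1)"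
  have K0: "0 \<le> K" unfolding K_def using m by (intro add_nonneg_nonneg mult_nonneg_nonneg) auto
  have eK: "e k \<le> inverse (real (Suc k)) * K" for k
  proof -
    have "e k \<le> (\<mu> k - ?m) * K"
      unfolding e_def K_def by (rule q_shift_le[OF u n1 q0 m \<mu>m \<mu>M])
    also have "\<dots> \<le> inverse (real (Suc k)) * K"
      by (rule mult_right_mono[OF _ K0]) (use \<mu>(2)[of k] in linarith)
    finally show ?thesis .
  qed
  have elim: "e \<longlonglongrightarrow> 0"
  proof (rule tendsto_sandwich[OF _ _ tendsto_const])
    show "(\<lambda>k. inverse (real (Suc k)) * K) \<longlonglongrightarrow> 0"
      by (rule tendsto_mult_left_zero[OF LIMSEQ_inverse_real_of_nat])
  qed (auto intro!: always_eventually e0 eK simp del: of_nat_Suc)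
  have Dbound: "L2_norm \<Omega> (D b (u k)) \<le> ?M" if "b \<in> Basis" for b k
  proof -
    have "(L2_norm \<Omega> (D b (u k)))\<^sup>2 \<le> grad2 (u k)" by (rule D_norm_le_grad2[OF that])
    also have "\<dots> \<le> \<mu> k" using q_le_0_grad2[OF \<mu>0 q0, of k] n1[of k] by simp
    also have "\<dots> \<le> ?M\<^sup>2"
    proof -
      have "1 * ?M \<le> ?M * ?M" using m by (intro mult_right_mono) auto
      then show ?thesis using \<mu>M[of k] by (simp add: power2_eq_square)
    qed
    finally show ?thesis by (rule power2_le_imp_le) (use m in simp)
  qed
  have "L2_norm \<Omega> (u k) \<le> ?M" for k using n1[of k] m by simp
  then have "\<exists>r. strict_mono (r :: nat \<Rightarrow> nat) \<and>
    (\<forall>d>0. \<exists>N. \<forall>j\<ge>N. \<forall>k\<ge>N. L2_norm \<Omega> (\<lambda>x. u (r j) x - u (r k) x) < d)"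
    by (intro Rellich[where u = u and M = ?M, OF open_\<Omega> bounded_\<Omega> V_H10[OF u]] Dbound)
  then obtain r where r: "strict_mono (r :: nat \<Rightarrow> nat)"
    and C: "\<And>d. d > 0 \<Longrightarrow> \<exists>N. \<forall>j\<ge>N. \<forall>k\<ge>N. L2_norm \<Omega> (\<lambda>x. u (r j) x - u (r k) x) < d" by blast
  define w where "w k = u (r k)" for k
  have w: "w k \<in> V" for k unfolding w_def by (rule u)
  define X where "X p = L2_norm \<Omega> (\<lambda>x. w (fst p) x - w (snd p) x)" for p
  have X: "(X \<longlongrightarrow> 0) ?F"
  proof (rule order_tendstoI)
    fix d :: real assume "d < 0"
    then show "\<forall>\<^sub>F p in ?F. d < X p"
      by (intro always_eventually allI) (simp add: X_def less_le_trans)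
  next
    fix d :: real assume "0 < d"
    from C[OF this] obtain N where N: "\<forall>j\<ge>N. \<forall>k\<ge>N. L2_norm \<Omega> (\<lambda>x. u (r j) x - u (r k) x) < d" by blast
    then show "\<forall>\<^sub>F p in ?F. X p < d"
      unfolding eventually_prod_sequentially X_def w_def by (intro exI[of _ N]) auto
  qed
  have er: "(\<lambda>k. e (r k)) \<longlonglongrightarrow> 0"
    using LIMSEQ_subseq_LIMSEQ[OF elim r] by (simp add: o_def)
  \<comment> \<open>The upper bound that the parallelogram law gives for the positive part of
    \<open>q ?m\<close> on a difference; the last summand returns the negative mass term of
    \<open>q\<close>.\<close>
  define T where "T p = 2 * (e (r (fst p)) + e (r (snd p))) + ?m\<^sup>2 * (X p)\<^sup>2" for p
  have "((\<lambda>p. 2 * (e (r (fst p)) + e (r (snd p))) + ?m\<^sup>2 * (X p)\<^sup>2) \<longlongrightarrow> 2 * 0 + ?m\<^sup>2 * 0\<^sup>2) ?F"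
    by (intro tendsto_add[OF tendsto_mult[OF tendsto_const prod_filter_tendsto_add[OF er]]]
        tendsto_mult[OF tendsto_const tendsto_power[OF X]])
  then have T: "(T \<longlongrightarrow> 0) ?F" unfolding T_def by simp
  let ?d = "\<lambda>p x. w (fst p) x - w (snd p) x"
  have dV: "?d p \<in> V" for p by (rule V_diff[OF w w])
  have bound: "(L2_norm L (E ?m (?d p)))\<^sup>2 + ?m * grad2 (?d p) \<le> T p" for p
  proof -
    have "q ?m (?d p) + q ?m (\<lambda>x. w (fst p) x + w (snd p) x) = 2 * q ?m (w (fst p)) + 2 * q ?m (w (snd p))"
      by (rule q_parallelogram[OF w w])
    moreover have "0 \<le> q ?m (\<lambda>x. w (fst p) x + w (snd p) x)"
      using q_nonneg_Inf_S[OF S V_add[OF w w, of "fst p" 1 "snd p"]] by simp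
    ultimately have "q ?m (?d p) \<le> 2 * (e (r (fst p)) + e (r (snd p)))"
      by (simp add: e_def w_def)
    then show ?thesis by (simp add: q_def T_def X_def)
  qed
  have E_lim: "((\<lambda>p. L2_norm L (E ?m (?d p))) \<longlongrightarrow> 0) ?F"
  proof (rule tendsto_0_if_power2_le[OF T])
    show "(L2_norm L (E ?m (?d p)))\<^sup>2 \<le> T p" for p
      using bound[of p] mult_nonneg_nonneg[OF less_imp_le[OF m] grad2_nonneg[of "?d p"]] by linarith
  qed simp
  have D_lim: "((\<lambda>p. L2_norm \<Omega> (\<lambda>x. D b (w (fst p)) x - D b (w (snd p)) x)) \<longlongrightarrow> 0) ?F" if b: "b \<in> Basis" for b
  proof (rule tendsto_0_if_power2_le)
    show "((\<lambda>p. T p / ?m) \<longlongrightarrow> 0) ?F" by (rule tendsto_divide_zero[OF T])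
    show "(L2_norm \<Omega> (\<lambda>x. D b (w (fst p)) x - D b (w (snd p)) x))\<^sup>2 \<le> T p / ?m" for p
    proof -
      have "(L2_norm \<Omega> (\<lambda>x. D b (w (fst p)) x - D b (w (snd p)) x))\<^sup>2 \<le> grad2 (?d p)"
        using D_norm_le_grad2[OF b, of "?d p"] unfolding D_diff_norm[OF w w b] .
      moreover have "?m * grad2 (?d p) \<le> T p"
        using bound[of p] zero_le_power2[of "L2_norm L (E ?m (?d p))"] by linarith
      then have "grad2 (?d p) \<le> T p / ?m" using m by (simp add: pos_le_divide_eq mult.commute)
      ultimately show ?thesis by linarith
    qed
  qed simp
  have Lap_lim: "((\<lambda>p. L2_norm L (\<lambda>x. Lap (w (fst p)) x - Lap (w (snd p)) x)) \<longlongrightarrow> 0) ?F"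
  proof (rule tendsto_sandwich[OF _ _ tendsto_const])
    have "((\<lambda>p. L2_norm L (E ?m (?d p)) / sqrt a0 + ?m * X p) \<longlongrightarrow> 0 + ?m * 0) ?F"
      by (intro tendsto_add tendsto_divide_zero[OF E_lim] tendsto_mult tendsto_const X)
    then show "((\<lambda>p. L2_norm L (E ?m (?d p)) / sqrt a0 + ?m * X p) \<longlongrightarrow> 0) ?F" by simp
    show "\<forall>\<^sub>F p in ?F. L2_norm L (\<lambda>x. Lap (w (fst p)) x - Lap (w (snd p)) x) \<le> L2_norm L (E ?m (?d p)) / sqrt a0 + ?m * X p"
      using Lap_norm_le[OF dV less_imp_le[OF m]] unfolding Lap_diff_norm[OF w w] X_def
      by (intro always_eventually allI)
  qed (simp add: always_eventually)
  obtain v where v: "v \<in> L2 \<Omega>" "(\<lambda>k. L2_norm \<Omega> (\<lambda>x. w k x - v x)) \<longlonglongrightarrow> 0"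
    using L2_complete_prod_filter[of w, OF V_L2[OF w] X[unfolded X_def]] by blast
  have "\<forall>b\<in>Basis. \<exists>g. g \<in> L2 \<Omega> \<and> (\<lambda>k. L2_norm \<Omega> (\<lambda>x. D b (w k) x - g x)) \<longlonglongrightarrow> 0"
  proof
    fix b :: 'a assume b: "b \<in> Basis"
    show "\<exists>g. g \<in> L2 \<Omega> \<and> (\<lambda>k. L2_norm \<Omega> (\<lambda>x. D b (w k) x - g x)) \<longlonglongrightarrow> 0"
      using L2_complete_prod_filter[of "\<lambda>k. D b (w k)", OF V_D_L2[OF w b] D_lim[OF b]] by blast
  qed
  from bchoice[OF this] obtain g where g: "\<And>b. b \<in> Basis \<Longrightarrow> g b \<in> L2 \<Omega>"
    "\<And>b. b \<in> Basis \<Longrightarrow> (\<lambda>k. L2_norm \<Omega> (\<lambda>x. D b (w k) x - g b x)) \<longlonglongrightarrow> 0" by blast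
  obtain h where h: "h \<in> L2 L" "(\<lambda>k. L2_norm L (\<lambda>x. Lap (w k) x - h x)) \<longlonglongrightarrow> 0"
    using L2_complete_prod_filter[of "\<lambda>k. Lap (w k)", OF V_Lap(2)[OF w] Lap_lim] by blast
  note vl = V_limit[OF w v g h]
  have vV: "v \<in> V" by (rule vl(1)) auto
  have vD: "is_weak_partial \<Omega> b v (g b)" if "b \<in> Basis" for b by (rule vl(2)[OF _ _ that]) auto
  have vh: "is_weak_laplacian L v h" by (rule vl(3)) auto
  have wD: "L2_norm \<Omega> (D b (\<lambda>x. w k x - v x)) = L2_norm \<Omega> (\<lambda>x. D b (w k) x - g b x)" if b: "b \<in> Basis" for b k
    unfolding D_diff_norm[OF w vV b]
    by (rule L2_norm_cong_AE[OF L2D(1)[OF L2_diff[OF V_D_L2[OF w b] V_D_L2[OF vV b]]]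
          L2D(1)[OF L2_diff[OF V_D_L2[OF w b] g(1)[OF b]]]])
       (use weak_partial_AE_eq[OF open_\<Omega> vD[OF b]] in \<open>auto elim!: eventually_mono\<close>)
  have wL: "L2_norm L (Lap (\<lambda>x. w k x - v x)) = L2_norm L (\<lambda>x. Lap (w k) x - h x)" for k
    unfolding Lap_diff_norm[OF w vV]
    by (rule L2_norm_cong_AE[OF L2D(1)[OF L2_diff[OF V_Lap(2)[OF w] V_Lap(2)[OF vV]]]
          L2D(1)[OF L2_diff[OF V_Lap(2)[OF w] h(1)]]])
       (use weak_laplacian_AE_eq[OF open_L vh] in \<open>auto elim!: eventually_mono\<close>)
  let ?B = "\<lambda>k. \<bar>a1\<bar> * (L2_norm L (\<lambda>x. Lap (w k) x - h x) + ?m * L2_norm \<Omega> (\<lambda>x. w k x - v x))\<^sup>2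
     + ?m * (\<Sum>b\<in>Basis. (L2_norm \<Omega> (\<lambda>x. D b (w k) x - g b x))\<^sup>2)"
  have q_le: "q ?m v \<le> 2 * e (r k) + 2 * ?B k" for k
  proof -
    have dV: "(\<lambda>x. w k x - v x) \<in> V" by (rule V_diff[OF w vV])
    \<comment> \<open>The parallelogram law for \<open>w k\<close> and \<open>w k - v\<close>, whose
      difference is \<open>v\<close>, bounds \<open>q ?m v\<close> by twice the two values of
      \<open>q\<close>. No continuity of \<open>q\<close> in the norm of \<open>V\<close> has to be
      stated.\<close>
    have "q ?m (\<lambda>x. w k x - (w k x - v x)) + q ?m (\<lambda>x. w k x + (w k x - v x)) = 2 * q ?m (w k) + 2 * q ?m (\<lambda>x. w k x - v x)"
      by (rule q_parallelogram[OF w dV])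
    moreover have "0 \<le> q ?m (\<lambda>x. w k x + (w k x - v x))"
      using q_nonneg_Inf_S[OF S V_add[OF w dV, of k 1]] by simp
    moreover have "q ?m (\<lambda>x. w k x - v x) \<le> ?B k"
    proof -
      have "q ?m (\<lambda>x. w k x - v x) \<le> (L2_norm L (E ?m (\<lambda>x. w k x - v x)))\<^sup>2 + ?m * grad2 (\<lambda>x. w k x - v x)"
        by (simp add: q_def)
      also have "grad2 (\<lambda>x. w k x - v x) = (\<Sum>b\<in>Basis. (L2_norm \<Omega> (\<lambda>x. D b (w k) x - g b x))\<^sup>2)"
        unfolding grad2_def by (intro sum.cong refl) (simp add: wD)
      finally show ?thesis using E_norm_le[OF dV less_imp_le[OF m]] unfolding wL by linarith
    qed
    ultimately show ?thesis by (simp add: e_def w_def)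
  qed
  have "(\<lambda>k. 2 * e (r k) + 2 * ?B k) \<longlonglongrightarrow> 2 * 0 + 2 * (\<bar>a1\<bar> * (0 + ?m * 0)\<^sup>2 + ?m * (\<Sum>b\<in>(Basis::'a set). 0\<^sup>2))"
    by (intro tendsto_add tendsto_mult tendsto_const er tendsto_power tendsto_sum h(2) v(2) g(2))
  then have "(\<lambda>k. 2 * e (r k) + 2 * ?B k) \<longlonglongrightarrow> 0" by simp
  then have "q ?m v \<le> 0" by (rule LIMSEQ_le_const) (use q_le in blast)
  moreover have "0 \<le> q ?m v" by (rule q_nonneg_Inf_S[OF S vV])
  moreover have "L2_norm \<Omega> v = 1"
  proof -
    have "(\<lambda>k. L2_norm \<Omega> (w k)) \<longlonglongrightarrow> L2_norm \<Omega> v" by (rule L2_norm_tendsto[OF V_L2[OF w] v])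
    then show ?thesis using n1 LIMSEQ_unique[OF _ tendsto_const[of 1]] by (simp add: w_def)
  qed
  ultimately show ?thesis using vV by (intro bexI[of _ v]) auto
qed

section \<open>Eigenvalues of the layer problem\<close>

definition eigenvalue :: "real \<Rightarrow> bool" where
  "eigenvalue \<mu> \<longleftrightarrow> \<mu> > 0 \<and> (\<exists>u\<in>V. \<not> (AE x in lebesgue_on \<Omega>. u x = 0) \<and> (\<forall>\<psi>\<in>V. form \<mu> u \<psi> = 0))"

lemma eigenvalue_in_S:
  assumes "eigenvalue \<mu>" shows "\<mu> \<in> S"
proof -
  obtain u where u: "u \<in> V" "\<not> (AE x in lebesgue_on \<Omega>. u x = 0)" "form \<mu> u u = 0" "\<mu> > 0"
    using assms unfolding eigenvalue_def by blast
  have "L2_norm \<Omega> u \<noteq> 0" using L2_norm_eq_0_iff[OF V_L2[OF u(1)]] u(2) by simp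
  moreover have "q \<mu> u = 0" using form_self[OF u(1), of \<mu>] u(3) by simp
  ultimately show ?thesis using u(1,4) unfolding S_def by auto
qed

text \<open>The form is nonnegative at the infimum and vanishes at the minimizer, which is therefore
  an eigenfunction. That the infimum is attained in \<open>S\<close> is recorded separately:
  comparing two problems requires the minimizer of one as a trial function for the other.\<close>

theorem eigenvalue_Inf_S:
  assumes S: "S \<noteq> {}"
  shows "eigenvalue (Inf S)" "(LEAST \<mu>. eigenvalue \<mu>) = Inf S" "Inf S \<in> S"
proof -
  obtain u where u: "u \<in> V" "L2_norm \<Omega> u = 1" "q (Inf S) u = 0" using minimizer[OF S] by blast
  have "\<not> (AE x in lebesgue_on \<Omega>. u x = 0)"
    using L2_norm_eq_0_iff[OF V_L2[OF u(1)]] u(2) by simp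
  moreover have "form (Inf S) u \<psi> = 0" if "\<psi> \<in> V" for \<psi>
    by (rule form_eq_0_if_q_eq_0[OF q_nonneg_Inf_S[OF S] u(1,3) that])
  ultimately show *: "eigenvalue (Inf S)"
    using Inf_S(1)[OF S] u(1) unfolding eigenvalue_def by blast
  show "(LEAST \<mu>. eigenvalue \<mu>) = Inf S"
    by (rule Least_equality[where P = eigenvalue, OF *]) (rule Inf_S(2)[OF S eigenvalue_in_S])
  show "Inf S \<in> S" by (rule eigenvalue_in_S[OF *])
qed

end

section \<open>Shrinking the domain by a flow transversal to its boundary\<close>

lemma finite_positive_lower_bound:
  fixes f :: "'i \<Rightarrow> real"
  assumes "finite I" "\<And>i. i \<in> I \<Longrightarrow> 0 < f i"
  shows "\<exists>m>0. \<forall>i\<in>I. m \<le> f i"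
  using assms
proof (induction I rule: finite_induct)
  case empty
  show ?case by (intro exI[of _ 1]) auto
next
  case (insert i I)
  then obtain m where "m > 0" "\<forall>i\<in>I. m \<le> f i" by auto
  then show ?case using insert.prems by (intro exI[of _ "min m (f i)"]) (auto simp: min_le_iff_disj)
qed

text \<open>In the terminology of nonsmooth analysis, every boundary point admits a hypertangent direction: moving from a
  point outside the domain against any direction close to it one stays outside.\<close>

lemma smooth_boundary_cone:
  fixes \<Omega> :: "'a::euclidean_space set"
  assumes "smooth_boundary \<Omega>" "p \<in> frontier \<Omega>"
  shows "\<exists>e \<rho> \<eta>. norm e = 1 \<and> \<rho> > 0 \<and> \<eta> > 0 \<and>
    (\<forall>x s w. dist x p < \<rho> \<longrightarrow> x \<notin> \<Omega> \<longrightarrow> 0 \<le> s \<longrightarrow> s \<le> \<rho> \<longrightarrow> norm (w - e) \<le> \<eta> \<longrightarrow> x - s *\<^sub>R w \<notin> \<Omega>)"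
proof -
  obtain r e and \<gamma> :: "'a \<Rightarrow> real" where r: "r > 0" and e: "norm e = 1" and \<gamma>: "smooth_on UNIV \<gamma>"
    and eq: "\<Omega> \<inter> ball p r = {x \<in> ball p r. x \<bullet> e > \<gamma> (x - (x \<bullet> e) *\<^sub>R e)}"
    using assms unfolding smooth_boundary_def by blast
  define P where "P x = x - (x \<bullet> e) *\<^sub>R e" for x
  have ee: "e \<bullet> e = 1" using e by (simp add: norm_eq_1)
  have P_le: "norm (P x) \<le> 2 * norm x" for x
  proof -
    have "norm (P x) \<le> norm x + \<bar>x \<bullet> e\<bar>"
      using norm_triangle_ineq4[of x "(x \<bullet> e) *\<^sub>R e"] e by (simp add: P_def)
    moreover have "\<bar>x \<bullet> e\<bar> \<le> norm x" using Cauchy_Schwarz_ineq2[of x e] e by simp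
    ultimately show ?thesis by linarith
  qed
  have P_diff: "P (x - s *\<^sub>R y) = P x - s *\<^sub>R P y" for x y s
    by (simp add: P_def algebra_simps inner_diff_left)
  \<comment> \<open>\<open>\<gamma>\<close> is Lipschitz only on bounded sets; this ball contains
    the projections of all points of \<open>ball p r\<close>.\<close>
  let ?S = "cball (0::'a) (2 * (norm p + r))"
  obtain K where K: "K \<ge> 0" "\<And>x h. x \<in> ?S \<Longrightarrow> norm (frechet_derivative \<gamma> (at x) h) \<le> K * norm h"
    using smooth_on_derivative_bound[OF \<gamma> compact_cball] by blast
  have lip: "\<bar>\<gamma> (P x) - \<gamma> (P y)\<bar> \<le> K * norm (P x - P y)" if "x \<in> ball p r" "y \<in> ball p r" for x y
  proof -
    have in_S: "P x \<in> ?S" if "x \<in> ball p r" for x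
    proof -
      have "norm x \<le> norm p + dist p x" using norm_triangle_ineq[of p "x - p"] by (simp add: dist_norm norm_minus_commute)
      then have "norm x \<le> norm p + r" using that by simp
      then show ?thesis using P_le[of x] by simp
    qed
    show ?thesis
      using smooth_on_Lipschitz_convex[OF \<gamma> convex_cball K(2) in_S[OF that(1)] in_S[OF that(2)]] by simp
  qed
  \<comment> \<open>Moving by \<open>s\<close> against \<open>w\<close> lowers the height by at
    least s (1 - \<eta>) and changes the graph by at most 2 K \<eta> s. The value 1/(2 K + 2) makes
    the second smaller than the first.\<close>
  define \<eta> where "\<eta> = 1 / (2 * K + 2)"
  have \<eta>: "\<eta> > 0" "\<eta> < 1" "2 * K * \<eta> < 1 - \<eta>"
    using K(1) by (simp_all add: \<eta>_def divide_simps)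
  have "x - s *\<^sub>R w \<notin> \<Omega>"
    if x: "dist x p < r / 4" "x \<notin> \<Omega>" and s: "0 \<le> s" "s \<le> r / 4" and w: "norm (w - e) \<le> \<eta>" for x s w
  proof
    assume in_\<Omega>: "x - s *\<^sub>R w \<in> \<Omega>"
    have "norm w \<le> norm (w - e) + norm e" using norm_triangle_ineq[of "w - e" e] by simp
    \<comment> \<open>With steps of length at most r/4 the displacement is at most r/2, so the moved
      point stays in the ball where the graph description holds.\<close>
    then have nw: "norm w \<le> 2" using w \<eta> e by linarith
    have "norm (s *\<^sub>R w) \<le> (r / 4) * 2"
      unfolding norm_scaleR using s nw by (intro mult_mono) auto
    moreover have "dist (x - s *\<^sub>R w) p \<le> norm (s *\<^sub>R w) + dist x p"
      using norm_triangle_ineq4[of "x - p" "s *\<^sub>R w"] by (simp add: dist_norm algebra_simps)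
    ultimately have b: "x - s *\<^sub>R w \<in> ball p r" using x(1) r by (simp add: dist_commute)
    have b': "x \<in> ball p r" using x(1) r by (simp add: dist_commute)
    have "x - s *\<^sub>R w \<in> \<Omega> \<inter> ball p r" using in_\<Omega> b by blast
    then have 1: "(x - s *\<^sub>R w) \<bullet> e > \<gamma> (P (x - s *\<^sub>R w))" unfolding eq P_def by blast
    have "x \<notin> \<Omega> \<inter> ball p r" using x(2) by blast
    then have 2: "x \<bullet> e \<le> \<gamma> (P x)" using b' unfolding eq P_def by auto
    have 3: "\<gamma> (P x) \<le> \<gamma> (P (x - s *\<^sub>R w)) + K * (s * norm (P w))"
      using lip[OF b' b] s(1) by (simp add: P_diff)
    have "P w = P (w - e)" by (simp add: P_def inner_diff_left ee algebra_simps)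
    then have "norm (P w) \<le> 2 * \<eta>" using P_le[of "w - e"] w by simp
    then have "K * (s * norm (P w)) \<le> K * (s * (2 * \<eta>))"
      using K(1) s(1) by (intro mult_left_mono) auto
    also have "\<dots> = s * (2 * K * \<eta>)" by simp
    also have "\<dots> \<le> s * (1 - \<eta>)" using \<eta>(3) s(1) by (intro mult_left_mono) auto
    also have "\<dots> \<le> s * (w \<bullet> e)"
    proof (intro mult_left_mono s(1))
      have "\<bar>(w - e) \<bullet> e\<bar> \<le> \<eta>" using Cauchy_Schwarz_ineq2[of "w - e" e] w e by simp
      then show "1 - \<eta> \<le> w \<bullet> e" by (simp add: inner_diff_left ee)
    qed
    finally have 4: "K * (s * norm (P w)) \<le> s * (w \<bullet> e)" .
    show False using 1 2 3 4 by (simp add: inner_diff_left)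
  qed
  then show ?thesis using e \<eta>(1) r by (intro exI[of _ e] exI[of _ "r / 4"] exI[of _ \<eta>]) auto
qed

text \<open>Sums of hypertangent directions are hypertangent, so a partition-of-unity style combination \<open>X\<close> of
  local directions works globally; the first summand with a coefficient bounded below absorbs the displacement
  from \<open>y\<close> to a point outside \<open>\<Omega>\<close>.\<close>

lemma transversal_field:
  fixes \<Omega> :: "'a::euclidean_space set"
  assumes \<Omega>: "open \<Omega>" "bounded \<Omega>" "smooth_boundary \<Omega>" and ne: "frontier \<Omega> \<noteq> {}"
  shows "\<exists>(X :: 'a \<Rightarrow> 'a) K c t0. smooth_on UNIV X \<and> compact K \<and> (\<forall>x. x \<notin> K \<longrightarrow> X x = 0) \<and> c > 0 \<and> t0 > 0 \<and>
    (\<forall>t y. 0 < t \<longrightarrow> t \<le> t0 \<longrightarrow> y \<notin> inner_domain \<Omega> (c * t) \<longrightarrow> y - t *\<^sub>R X y \<notin> \<Omega>)"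
proof -
  let ?\<Gamma> = "frontier \<Omega>"
  have cG: "compact ?\<Gamma>" using \<Omega>(2) by (simp add: compact_frontier_bounded)
  have "\<forall>p\<in>?\<Gamma>. \<exists>E. norm (fst E) = 1 \<and> fst (snd E) > 0 \<and> snd (snd E) > 0 \<and>
    (\<forall>x s w. dist x p < fst (snd E) \<longrightarrow> x \<notin> \<Omega> \<longrightarrow> 0 \<le> s \<longrightarrow> s \<le> fst (snd E) \<longrightarrow>
       norm (w - fst E) \<le> snd (snd E) \<longrightarrow> x - s *\<^sub>R w \<notin> \<Omega>)"
  proof
    fix p assume "p \<in> ?\<Gamma>"
    from smooth_boundary_cone[OF \<Omega>(3) this] obtain e \<rho> \<eta> where "norm e = 1 \<and> \<rho> > 0 \<and> \<eta> > 0 \<and>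
    (\<forall>x s w. dist x p < \<rho> \<longrightarrow> x \<notin> \<Omega> \<longrightarrow> 0 \<le> s \<longrightarrow> s \<le> \<rho> \<longrightarrow> norm (w - e) \<le> \<eta> \<longrightarrow> x - s *\<^sub>R w \<notin> \<Omega>)" by blast
    then show "\<exists>E. norm (fst E) = 1 \<and> fst (snd E) > 0 \<and> snd (snd E) > 0 \<and>
    (\<forall>x s w. dist x p < fst (snd E) \<longrightarrow> x \<notin> \<Omega> \<longrightarrow> 0 \<le> s \<longrightarrow> s \<le> fst (snd E) \<longrightarrow>
       norm (w - fst E) \<le> snd (snd E) \<longrightarrow> x - s *\<^sub>R w \<notin> \<Omega>)"
      by (intro exI[of _ "(e, \<rho>, \<eta>)"]) simp
  qed
  from bchoice[OF this] obtain E where E: "\<And>p. p \<in> ?\<Gamma> \<Longrightarrow> norm (fst (E p)) = 1 \<and> fst (snd (E p)) > 0 \<and> snd (snd (E p)) > 0 \<and>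
    (\<forall>x s w. dist x p < fst (snd (E p)) \<longrightarrow> x \<notin> \<Omega> \<longrightarrow> 0 \<le> s \<longrightarrow> s \<le> fst (snd (E p)) \<longrightarrow>
       norm (w - fst (E p)) \<le> snd (snd (E p)) \<longrightarrow> x - s *\<^sub>R w \<notin> \<Omega>)" by blast
  define e where "e p = fst (E p)" for p
  define \<rho> where "\<rho> p = fst (snd (E p))" for p
  define \<eta> where "\<eta> p = snd (snd (E p))" for p
  have e1: "norm (e p) = 1" and \<rho>0: "\<rho> p > 0" and \<eta>0: "\<eta> p > 0"
    and cone: "\<And>x s w. dist x p < \<rho> p \<Longrightarrow> x \<notin> \<Omega> \<Longrightarrow> 0 \<le> s \<Longrightarrow> s \<le> \<rho> p \<Longrightarrow> norm (w - e p) \<le> \<eta> p \<Longrightarrow> x - s *\<^sub>R w \<notin> \<Omega>"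
    if "p \<in> ?\<Gamma>" for p
    using E[OF that] unfolding e_def \<rho>_def \<eta>_def by blast+
  \<comment> \<open>The radii leave room in stages: a point within \<open>r0 / 8\<close> of the
    boundary is within a quarter of \<open>\<rho> p\<close> of some centre, the bumps live on half
    of it, and all displacements below stay inside the full cone neighbourhood.\<close>
  have cov: "?\<Gamma> \<subseteq> (\<Union>p\<in>?\<Gamma>. ball p (\<rho> p / 8))" using \<rho>0 by force
  obtain I where I: "I \<subseteq> ?\<Gamma>" "finite I" "?\<Gamma> \<subseteq> (\<Union>p\<in>I. ball p (\<rho> p / 8))"
    using compactE_image[OF cG _ cov] by (metis open_ball)
  define \<beta> where "\<beta> p = ball_bump p (\<rho> p / 2)" for p
  define X where "X y = (\<Sum>p\<in>I. \<beta> p y *\<^sub>R e p)" for y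
  have \<beta>01: "0 \<le> \<beta> p y" "\<beta> p y \<le> 1" for p y unfolding \<beta>_def by (rule ball_bump_bounds)+
  have \<beta>pos: "0 < \<beta> p y \<longleftrightarrow> dist y p < \<rho> p / 2" if "p \<in> I" for p y
    unfolding \<beta>_def using \<rho>0 I(1) that by (intro ball_bump_pos_iff) auto
  \<comment> \<open>A common lower bound of the bumps on the quarter balls; the displayed value is
    that of the bump on the bounding sphere.\<close>
  obtain m where m: "m > 0" "\<And>p. p \<in> I \<Longrightarrow> m \<le> cutoff ((\<rho> p / 2)\<^sup>2 - (\<rho> p / 4)\<^sup>2)"
  proof -
    have "0 < cutoff ((\<rho> p / 2)\<^sup>2 - (\<rho> p / 4)\<^sup>2)" if "p \<in> I" for p
      using \<rho>0[of p] I(1) that unfolding cutoff_pos_iff by (auto simp: power_strict_mono intro!: power_strict_mono)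
    then show ?thesis
      using finite_positive_lower_bound[OF I(2), of "\<lambda>p. cutoff ((\<rho> p / 2)\<^sup>2 - (\<rho> p / 4)\<^sup>2)"] that by blast
  qed
  have m_le: "m \<le> \<beta> p y" if "p \<in> I" "dist y p < \<rho> p / 4" for p y
  proof -
    have "(y - p) \<bullet> (y - p) \<le> (\<rho> p / 4)\<^sup>2"
      using that(2) unfolding power2_norm_eq_inner[symmetric] dist_norm by (intro power_mono) auto
    then have "cutoff ((\<rho> p / 2)\<^sup>2 - (\<rho> p / 4)\<^sup>2) \<le> \<beta> p y"
      unfolding \<beta>_def ball_bump_def by (intro cutoff_mono) simp
    with m(2)[OF that(1)] show ?thesis by linarith
  qed
  obtain r0 where r0: "r0 > 0" "\<And>p. p \<in> I \<Longrightarrow> r0 \<le> \<rho> p"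
    using finite_positive_lower_bound[OF I(2), of \<rho>] \<rho>0 I(1) by blast
  obtain h0 where h0: "h0 > 0" "\<And>p. p \<in> I \<Longrightarrow> h0 \<le> \<eta> p"
    using finite_positive_lower_bound[OF I(2), of \<eta>] \<eta>0 I(1) by blast
  \<comment> \<open>The ratio of layer width to time: a displacement of at most
    \<open>c * t\<close>, divided by a step of at least \<open>t * m\<close>, tilts a direction by
    at most \<open>h0\<close>.\<close>
  define c where "c = m * h0"
  have c: "c > 0" unfolding c_def using m h0 by simp
  let ?n = "real (card I)"
  \<comment> \<open>Keeps the total displacement \<open>t * ?n\<close>, the layer width
    \<open>c * t\<close> and a single step \<open>t\<close> below \<open>r0 / 16\<close> at the same
    time.\<close>
  define t0 where "t0 = r0 / (16 * (?n + c + 1))"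
  have n0: "0 < ?n + c + 1" using c by simp
  have t0: "t0 > 0" unfolding t0_def using r0(1) n0 by simp
  have t0n: "t * (?n + c + 1) \<le> r0 / 16" if "t \<le> t0" for t
  proof -
    have "t * (?n + c + 1) \<le> t0 * (?n + c + 1)" using that n0 by (intro mult_right_mono) auto
    also have "\<dots> = r0 / 16" unfolding t0_def using n0 by (simp add: field_simps)
    finally show ?thesis .
  qed
  have small: "t * ?n \<le> r0 / 16" "c * t \<le> r0 / 16" "t \<le> r0 / 16" if "0 < t" "t \<le> t0" for t
  proof -
    have "t * ?n + c * t + t \<le> r0 / 16" using t0n[OF that(2)] by (simp add: algebra_simps)
    moreover have "0 \<le> t * ?n" "0 \<le> c * t" using that(1) c by simp_all
    ultimately show "t * ?n \<le> r0 / 16" "c * t \<le> r0 / 16" "t \<le> r0 / 16" using that(1) by linarith+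
  qed
  have sum_le: "norm (\<Sum>p\<in>J. (t * \<beta> p y) *\<^sub>R e p) \<le> t * ?n" if "J \<subseteq> I" "0 < t" for J t y
  proof -
    have "norm (\<Sum>p\<in>J. (t * \<beta> p y) *\<^sub>R e p) \<le> (\<Sum>p\<in>J. t)"
    proof (rule sum_norm_le)
      fix p assume "p \<in> J"
      then have "p \<in> ?\<Gamma>" using that(1) I(1) by blast
      then show "norm ((t * \<beta> p y) *\<^sub>R e p) \<le> t"
        using e1 \<beta>01[of p y] that(2) by (simp add: abs_mult mult_left_le)
    qed
    also have "\<dots> = t * real (card J)" by simp
    also have "\<dots> \<le> t * ?n" using card_mono[OF I(2) that(1)] that(2) by (intro mult_left_mono) auto
    finally show ?thesis .
  qed
  have Xsum: "t *\<^sub>R X y = (\<Sum>p\<in>I. (t * \<beta> p y) *\<^sub>R e p)" for t y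
    unfolding X_def by (simp add: scaleR_sum_right)
  have near: "y - t *\<^sub>R X y \<notin> \<Omega>"
    if t: "0 < t" "t \<le> t0" and x: "x \<notin> \<Omega>" "dist x y \<le> c * t" and y: "infdist y ?\<Gamma> < r0 / 8" for t x y
  proof -
    obtain z where z: "z \<in> ?\<Gamma>" "infdist y ?\<Gamma> = dist y z"
      using infdist_attains_inf[OF _ ne] compact_imp_closed[OF cG] by blast
    obtain p0 where p0: "p0 \<in> I" "dist p0 z < \<rho> p0 / 8" using I(3) z(1) by auto
    have p0G: "p0 \<in> ?\<Gamma>" using p0(1) I(1) by blast
    have dy: "dist y p0 < \<rho> p0 / 4"
      using dist_triangle[of y p0 z] z(2) y p0(2) r0(2)[OF p0(1)] by (simp add: dist_commute)
    have \<beta>0: "m \<le> \<beta> p0 y" by (rule m_le[OF p0(1) dy])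
    have step0: "y - (t * \<beta> p0 y) *\<^sub>R e p0 \<notin> \<Omega>"
    proof -
      define \<sigma> where "\<sigma> = t * \<beta> p0 y"
      have s: "0 < \<sigma>" "\<sigma> \<le> t" using \<beta>0 m(1) t \<beta>01[of p0 y] by (simp_all add: \<sigma>_def mult_left_le)
      \<comment> \<open>Tilted so that the step from \<open>x\<close> along \<open>?w\<close> ends
        where the step from \<open>y\<close> along \<open>e p0\<close> ends. The starting point
        outside the domain is thus exchanged for \<open>y\<close> itself.\<close>
      let ?w = "e p0 - (y - x) /\<^sub>R \<sigma>"
      have "norm (?w - e p0) = dist x y / \<sigma>"
        using s(1) by (simp add: dist_norm norm_minus_commute divide_inverse mult.commute)
      also have "\<dots> \<le> (c * t) / (t * m)"
        using x(2) \<beta>0 t m(1) c unfolding \<sigma>_def by (intro frac_le mult_left_mono) auto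
      also have "\<dots> = h0" using t m by (simp add: c_def)
      also have "\<dots> \<le> \<eta> p0" by (rule h0(2)[OF p0(1)])
      finally have w: "norm (?w - e p0) \<le> \<eta> p0" .
      have "dist x p0 < \<rho> p0"
        using dist_triangle[of x p0 y] x(2) dy small(2)[OF t] r0(2)[OF p0(1)] r0(1) by linarith
      moreover have "\<sigma> \<le> \<rho> p0" using s(2) small(3)[OF t] r0(2)[OF p0(1)] r0(1) by linarith
      ultimately have "x - \<sigma> *\<^sub>R ?w \<notin> \<Omega>" using cone[OF p0G _ x(1) _ _ w] s(1) by simp
      moreover have "x - \<sigma> *\<^sub>R ?w = y - \<sigma> *\<^sub>R e p0"
        using s(1) by (simp add: scaleR_diff_right)
      ultimately show ?thesis by (simp add: \<sigma>_def)
    qed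
    \<comment> \<open>The direction \<open>p0\<close> goes first, since it alone has a step long
      enough to absorb the gap between \<open>x\<close> and \<open>y\<close>. The remaining steps
      start outside the domain, in any order, and use the exact directions
      \<open>e p\<close>.\<close>
    have "y - (\<Sum>p\<in>insert p0 J. (t * \<beta> p y) *\<^sub>R e p) \<notin> \<Omega>" if "finite J" "J \<subseteq> I - {p0}" for J
      using that
    proof (induction J rule: finite_induct)
      case empty
      then show ?case using step0 by simp
    next
      case (insert q J)
      let ?z = "y - (\<Sum>p\<in>insert p0 J. (t * \<beta> p y) *\<^sub>R e p)"
      have q: "q \<in> I" "q \<noteq> p0" "q \<in> ?\<Gamma>" using insert.prems I(1) by auto
      have J: "insert p0 J \<subseteq> I" using insert.prems p0(1) by auto
      have IH: "?z \<notin> \<Omega>" using insert by simp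
      have eq: "y - (\<Sum>p\<in>insert p0 (insert q J). (t * \<beta> p y) *\<^sub>R e p) = ?z - (t * \<beta> q y) *\<^sub>R e q"
      proof -
        have "(\<Sum>p\<in>insert p0 (insert q J). (t * \<beta> p y) *\<^sub>R e p)
            = (t * \<beta> q y) *\<^sub>R e q + (\<Sum>p\<in>insert p0 J. (t * \<beta> p y) *\<^sub>R e p)"
          unfolding insert_commute[of p0 q] by (rule sum.insert) (use insert.hyps q(2) in auto)
        then show ?thesis by (simp only: diff_add_eq_diff_diff_swap)
      qed
      show ?case
      proof (cases "\<beta> q y > 0")
        case True
        then have "dist y q < \<rho> q / 2" using \<beta>pos[OF q(1)] by simp
        moreover have "dist ?z y \<le> r0 / 16"
          using sum_le[OF J t(1), of y] small(1)[OF t] by (simp add: dist_norm)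
        ultimately have "dist ?z q < \<rho> q"
          using dist_triangle[of ?z q y] r0(2)[OF q(1)] r0(1) by linarith
        moreover have "t * \<beta> q y \<le> \<rho> q"
          using mult_left_le[of "\<beta> q y" t] \<beta>01[of q y] t small(3)[OF t] r0(2)[OF q(1)] r0(1) by linarith
        ultimately have "?z - (t * \<beta> q y) *\<^sub>R e q \<notin> \<Omega>"
          using cone[OF q(3) _ IH, of "t * \<beta> q y" "e q"] True t \<eta>0[OF q(3)] by simp
        then show ?thesis unfolding eq .
      next
        case False
        then have "\<beta> q y = 0" using \<beta>01[of q y] by linarith
        then show ?thesis unfolding eq using IH by simp
      qed
    qed
    from this[of "I - {p0}"] show ?thesis
      using I(2) p0(1) by (simp add: Xsum insert_absorb)
  qed
  \<comment> \<open>The outside point for \<open>near\<close> is the nearest boundary point when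
    \<open>y\<close> lies in the layer, and \<open>y\<close> itself when \<open>y\<close> is outside
    but near the boundary. A point further away cannot reach the boundary, its displacement being
    too short.\<close>
  have "y - t *\<^sub>R X y \<notin> \<Omega>" if t: "0 < t" "t \<le> t0" and y: "y \<notin> inner_domain \<Omega> (c * t)" for t y
  proof (cases "infdist y ?\<Gamma> < r0 / 8")
    case True
    show ?thesis
    proof (cases "y \<in> \<Omega>")
      case yin: True
      then have "infdist y ?\<Gamma> \<le> c * t" using y by (simp add: inner_domain_def)
      moreover obtain z where z: "z \<in> ?\<Gamma>" "infdist y ?\<Gamma> = dist y z"
        using infdist_attains_inf[OF _ ne] compact_imp_closed[OF cG] by blast
      moreover have "z \<notin> \<Omega>" using z(1) \<Omega>(1) by (simp add: frontier_def interior_open)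
      ultimately show ?thesis using near[OF t, of z y] True by (simp add: dist_commute)
    next
      case False
      then show ?thesis using near[OF t, of y y] True c t by simp
    qed
  next
    case False
    have yout: "y \<notin> \<Omega>"
    proof
      assume "y \<in> \<Omega>"
      then have "infdist y ?\<Gamma> \<le> c * t" using y by (simp add: inner_domain_def)
      then show False using False small(2)[OF t] r0(1) by linarith
    qed
    show ?thesis
    proof
      assume in_\<Omega>: "y - t *\<^sub>R X y \<in> \<Omega>"
      let ?seg = "closed_segment y (y - t *\<^sub>R X y)"
      have "?seg \<inter> ?\<Gamma> \<noteq> {}"
        using in_\<Omega> yout by (intro connected_Int_frontier connected_segment) auto
      then obtain z where z: "z \<in> ?seg" "z \<in> ?\<Gamma>" by blast
      have "dist y z \<le> norm (t *\<^sub>R X y)"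
        using segment_bound(1)[OF z(1)] by (simp add: dist_norm norm_minus_commute)
      also have "\<dots> \<le> r0 / 16" using sum_le[of I t y] t small(1)[OF t] unfolding Xsum by simp
      finally have "infdist y ?\<Gamma> \<le> r0 / 16" using infdist_le[OF z(2), of y] by linarith
      then show False using False r0(1) by linarith
    qed
  qed
  moreover have "smooth_on UNIV X"
    unfolding X_def[abs_def] \<beta>_def
    by (intro smooth_on_sum smooth_on_scaleR smooth_on_ball_bump smooth_on_const)
  moreover have "compact (\<Union>p\<in>I. cball p (\<rho> p / 2))"
    using I(2) by (intro compact_UN) auto
  moreover have "X x = 0" if "x \<notin> (\<Union>p\<in>I. cball p (\<rho> p / 2))" for x
  proof -
    have "\<beta> p x = 0" if "p \<in> I" for p
    proof -
      have "\<not> dist x p < \<rho> p / 2" using \<open>x \<notin> (\<Union>p\<in>I. cball p (\<rho> p / 2))\<close> that by (force simp: dist_commute)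
      then show ?thesis using \<beta>pos[OF that, of x] \<beta>01[of p x] by linarith
    qed
    then show ?thesis by (simp add: X_def)
  qed
  ultimately show ?thesis using c t0 by blast
qed

subsection \<open>The perturbed identity\<close>

text \<open>The product \<open>t * B\<close>, later \<open>s\<close>, measures how far the
  derivative of the map is from the identity. The bound 1/6 makes the perturbation a contraction,
  keeps \<open>1 - 3 * s\<close> at least 1/2, and is the range on which the constant 27 below is
  valid.\<close>

locale perturbed_identity =
  fixes X :: "real ^ 2 \<Rightarrow> real ^ 2" and K :: "(real ^ 2) set" and B t :: real
  assumes smooth_X: "smooth_on UNIV X" and compact_K: "compact K" and X_outside: "\<And>x. x \<notin> K \<Longrightarrow> X x = 0"
    and B_nonneg: "0 \<le> B" and X_derivative: "\<And>x h. norm (frechet_derivative X (at x) h) \<le> B * norm h"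
    and t_nonneg: "0 \<le> t" and small: "t * B \<le> 1 / 6"
begin

definition T :: "real ^ 2 \<Rightarrow> real ^ 2" where "T y = y - t *\<^sub>R X y"

definition s :: real where "s = t * B"

definition jac :: "real ^ 2 \<Rightarrow> real" where
  "jac y = \<bar>det (matrix (\<lambda>h. h - t *\<^sub>R frechet_derivative X (at y) h))\<bar>"

lemma s_nonneg: "0 \<le> s"
  using B_nonneg t_nonneg by (simp add: s_def)

lemma s_small: "s \<le> 1 / 6"
  using small by (simp add: s_def)

lemma X_Lipschitz: "norm (X x - X y) \<le> B * norm (x - y)"
  by (rule smooth_on_Lipschitz_convex[OF smooth_X convex_UNIV X_derivative]) auto

lemma tX_Lipschitz: "norm (t *\<^sub>R X x - t *\<^sub>R X y) \<le> s * norm (x - y)"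
  using mult_left_mono[OF X_Lipschitz t_nonneg, of x y] t_nonneg
  by (simp add: s_def mult.assoc flip: scaleR_diff_right)

lemma smooth_T: "smooth_on UNIV T"
proof -
  have "smooth_on UNIV (\<lambda>y. y + (- t) *\<^sub>R X y)"
    by (intro smooth_on_add smooth_on_scaleR smooth_on_const smooth_X smooth_on_bounded_linear bounded_linear_ident)
  then show ?thesis by (simp add: T_def[abs_def])
qed

lemma T_has_derivative:
  "(T has_derivative (\<lambda>h. h - t *\<^sub>R frechet_derivative X (at y) h)) (at y within S)"
  unfolding T_def[abs_def]
  by (intro has_derivative_diff has_derivative_ident has_derivative_scaleR_right
      has_derivative_at_withinI[OF smooth_on_has_derivative[OF smooth_X]])

lemma inj_T: "inj T"
proof (rule injI)
  fix x y assume "T x = T y"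
  then have "x - y = t *\<^sub>R X x - t *\<^sub>R X y" by (simp add: T_def algebra_simps)
  then have "norm (x - y) \<le> s * norm (x - y)" using tX_Lipschitz[of x y] by simp
  also have "\<dots> \<le> (1 / 6) * norm (x - y)" by (intro mult_right_mono s_small) simp
  finally have "norm (x - y) \<le> 0" by simp
  then show "x = y" by simp
qed

text \<open>Solving \<open>T y = z\<close> means finding a fixed point of the contraction y
  \<mapsto> z + t X(y).\<close>

lemma surj_T: "surj T"
unfolding surj_def
proof
  fix z
  have "\<exists>!y. z + t *\<^sub>R X y = y"
  proof (rule banach_fix_type)
    show "0 \<le> s" by (rule s_nonneg)
    show "s < 1" using s_small by simp
    show "\<forall>x y. dist (z + t *\<^sub>R X x) (z + t *\<^sub>R X y) \<le> s * dist x y"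
      using tX_Lipschitz by (simp add: dist_norm)
  qed
  then obtain y where "z + t *\<^sub>R X y = y" by blast
  then have "T y = z" by (simp add: T_def algebra_simps)
  then show "\<exists>y. z = T y" by blast
qed

lemma continuous_on_T: "continuous_on S T"
  by (rule smooth_on_continuous_on[OF smooth_T])

text \<open>\<open>X\<close> is bounded, so \<open>T\<close> moves points by a bounded amount and is
  proper; this keeps the supports of pulled-back test functions compact.\<close>

lemma compact_vimage_T:
  assumes "compact C" shows "compact (T -` C)"
proof -
  have "bounded (X ` K)"
    by (intro compact_imp_bounded compact_continuous_image compact_K smooth_on_continuous_on smooth_X)
  then obtain M where M: "M > 0" "\<And>x. x \<in> K \<Longrightarrow> norm (X x) \<le> M" by (auto simp: bounded_pos)
  have XM: "norm (X x) \<le> M" for x using M X_outside[of x] by (cases "x \<in> K") auto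
  obtain R where R: "\<And>x. x \<in> C \<Longrightarrow> norm x \<le> R" using compact_imp_bounded[OF assms] by (auto simp: bounded_iff)
  have "norm y \<le> R + t * M" if "y \<in> T -` C" for y
  proof -
    have "norm y \<le> norm (T y) + norm (t *\<^sub>R X y)" using norm_triangle_ineq[of "T y" "t *\<^sub>R X y"] by (simp add: T_def)
    also have "norm (t *\<^sub>R X y) \<le> t * M" using XM[of y] t_nonneg by (simp add: mult_left_mono)
    finally show ?thesis using R[of "T y"] that by simp
  qed
  then have "bounded (T -` C)" unfolding bounded_iff by blast
  moreover have "closed (T -` C)"
    by (rule closed_vimage[OF compact_imp_closed[OF assms] continuous_on_T])
  ultimately show ?thesis by (simp add: compact_eq_bounded_closed)
qed

lemma test_functions_pullback:
  assumes "\<phi> \<in> test_functions U" "\<And>y. T y \<in> U \<Longrightarrow> y \<in> W"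
  shows "(\<lambda>y. \<phi> (T y)) \<in> test_functions W"
proof -
  obtain C where C: "compact C" "C \<subseteq> U" "\<And>x. x \<notin> C \<Longrightarrow> \<phi> x = 0"
    using test_functions_support[OF assms(1)] by blast
  show ?thesis
    using C assms(2)
    by (intro test_functionsI[OF smooth_on_compose[OF test_functionsD(1)[OF assms(1)] smooth_T] compact_vimage_T[OF C(1)]])
       auto
qed

text \<open>For a matrix 1 - m of order 2 the determinant is 1 - tr m + det m. The trace is at most
  2 s, and the two products in det m are at most s/6 each because s \<le> 1/6.\<close>

lemma jac_bounds: "1 - 3 * s \<le> jac y" "jac y \<le> 1 + 3 * s"
proof -
  let ?D = "frechet_derivative X (at y)"
  define m where "m i j = t * (?D (axis j 1) $ i)" for i j :: 2
  have m: "\<bar>m i j\<bar> \<le> s" for i j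
  proof -
    have "\<bar>?D (axis j 1) $ i\<bar> \<le> norm (?D (axis j 1))" by (rule component_le_norm_cart)
    also have "\<dots> \<le> B" using X_derivative[of y "axis j 1"] by (simp add: norm_axis_1)
    finally show ?thesis using t_nonneg by (simp add: m_def s_def abs_mult mult_left_mono)
  qed
  have "det (matrix (\<lambda>h. h - t *\<^sub>R ?D h)) = (1 - m 1 1) * (1 - m 2 2) - m 1 2 * m 2 1"
    by (simp add: det_2 matrix_def m_def axis_def)
  also have "\<dots> = 1 - (m 1 1 + m 2 2) + (m 1 1 * m 2 2 - m 1 2 * m 2 1)" by (simp add: algebra_simps)
  finally have det: "det (matrix (\<lambda>h. h - t *\<^sub>R ?D h)) = 1 - (m 1 1 + m 2 2) + (m 1 1 * m 2 2 - m 1 2 * m 2 1)" .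
  have p: "\<bar>m i j * m k l\<bar> \<le> s / 6" for i j k l
  proof -
    have "\<bar>m i j * m k l\<bar> \<le> s * (1/6)"
      unfolding abs_mult using m[of i j] m[of k l] s_small s_nonneg by (intro mult_mono) auto
    then show ?thesis by simp
  qed
  have "\<bar>det (matrix (\<lambda>h. h - t *\<^sub>R ?D h)) - 1\<bar> \<le> 3 * s"
    unfolding det using m[of 1 1] m[of 2 2] p[of 1 1 2 2] p[of 1 2 2 1] s_nonneg by linarith
  then show "1 - 3 * s \<le> jac y" "jac y \<le> 1 + 3 * s" unfolding jac_def by linarith+
qed

lemma change_of_variables:
  fixes f :: "real ^ 2 \<Rightarrow> real"
  assumes "continuous_on UNIV f" "compact C" "\<And>x. x \<notin> C \<Longrightarrow> f x = 0"
  shows "integrable lebesgue (\<lambda>y. jac y * f (T y))" "(LINT y|lebesgue. jac y * f (T y)) = (LINT x|lborel. f x)"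
proof -
  \<comment> \<open>The change-of-variables theorem speaks of functions with values in a Cartesian
    power, so real integrands are read as vectors with one entry.\<close>
  let ?v = "\<lambda>r::real. (vec r :: real ^ 1)"
  have bl: "bounded_linear ?v" by (simp add: linear_linear)
  have f: "integrable lborel f" by (rule continuous_compact_support_integrable[OF assms])
  then have "integrable lebesgue f"
    using integrable_completion[of f lborel] borel_measurable_integrable[OF f] by simp
  then have "integrable lebesgue (\<lambda>x. ?v (f x))" by (rule integrable_bounded_linear[OF bl])
  then have ai: "(\<lambda>x. ?v (f x)) absolutely_integrable_on UNIV" by (simp add: set_integrable_def)
  have "T ` UNIV = UNIV" by (rule surj_T)
  then have *: "(\<lambda>y. jac y *\<^sub>R ?v (f (T y))) absolutely_integrable_on UNIV \<and>
      integral UNIV (\<lambda>y. jac y *\<^sub>R ?v (f (T y))) = integral UNIV (\<lambda>x. ?v (f x))"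
    using has_absolute_integral_change_of_variables[of UNIV T "\<lambda>y h. h - t *\<^sub>R frechet_derivative X (at y) h"
        "\<lambda>x. ?v (f x)" "integral UNIV (\<lambda>x. ?v (f x))"] T_has_derivative inj_T ai
    unfolding jac_def by simp
  have comp: "(jac y *\<^sub>R ?v (f (T y))) $ 1 = jac y * f (T y)" for y by simp
  have i1: "integrable lebesgue (\<lambda>y. jac y *\<^sub>R ?v (f (T y)))" using *[THEN conjunct1] by (simp add: set_integrable_def)
  from integrable_bounded_linear[OF bounded_linear_vec_nth[of 1] this]
  show "integrable lebesgue (\<lambda>y. jac y * f (T y))" by (simp only: comp)
  have "(LINT y|lebesgue. jac y * f (T y)) = (LINT y|lebesgue. (jac y *\<^sub>R ?v (f (T y))) $ 1)" by (simp only: comp)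
  also have "\<dots> = (LINT y|lebesgue. jac y *\<^sub>R ?v (f (T y))) $ 1"
    by (rule integral_bounded_linear[OF bounded_linear_vec_nth i1])
  also have "(LINT y|lebesgue. jac y *\<^sub>R ?v (f (T y))) = integral UNIV (\<lambda>y. jac y *\<^sub>R ?v (f (T y)))"
    using set_lebesgue_integral_eq_integral(2)[OF *[THEN conjunct1]] by (simp add: set_lebesgue_integral_def)
  also have "\<dots> = integral UNIV (\<lambda>x. ?v (f x))" by (rule *[THEN conjunct2])
  also have "\<dots> = (LINT x|lebesgue. ?v (f x))"
    using set_lebesgue_integral_eq_integral(2)[OF ai] by (simp add: set_lebesgue_integral_def)
  also have "(LINT x|lebesgue. ?v (f x)) $ 1 = (LINT x|lebesgue. ?v (f x) $ 1)"
    by (rule integral_bounded_linear[OF bounded_linear_vec_nth, symmetric])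
       (rule integrable_bounded_linear[OF bl \<open>integrable lebesgue f\<close>])
  also have "\<dots> = (LINT x|lborel. f x)"
    using integral_completion[of f lborel] borel_measurable_integrable[OF f] by simp
  finally show "(LINT y|lebesgue. jac y * f (T y)) = (LINT x|lborel. f x)" .
qed

lemma integral_compose_T:
  fixes f :: "real ^ 2 \<Rightarrow> real"
  assumes f: "continuous_on UNIV f" "compact C" "\<And>x. x \<notin> C \<Longrightarrow> f x = 0" and nn: "\<And>x. 0 \<le> f x"
  shows "integrable lborel (\<lambda>y. f (T y))"
    and "(1 - 3 * s) * (LINT y|lborel. f (T y)) \<le> (LINT x|lborel. f x)"
    and "(LINT x|lborel. f x) \<le> (1 + 3 * s) * (LINT y|lborel. f (T y))"
proof -
  have c: "continuous_on UNIV (\<lambda>y. f (T y))"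
    by (rule continuous_on_compose2[OF f(1) continuous_on_T]) simp
  show i: "integrable lborel (\<lambda>y. f (T y))"
    by (rule continuous_compact_support_integrable[OF c compact_vimage_T[OF f(2)]]) (simp add: f(3))
  have m: "(\<lambda>y. f (T y)) \<in> borel_measurable lborel" using i by (rule borel_measurable_integrable)
  have il: "integrable lebesgue (\<lambda>y. f (T y))" using i integrable_completion[OF m] by simp
  have eq: "(LINT y|lebesgue. f (T y)) = (LINT y|lborel. f (T y))" by (rule integral_completion[OF m])
  note cv = change_of_variables[OF f(1-3)]
  have "(LINT y|lebesgue. (1 - 3 * s) * f (T y)) \<le> (LINT y|lebesgue. jac y * f (T y))"
    by (intro integral_mono integrable_mult_right il cv(1) mult_right_mono jac_bounds nn)
  then show "(1 - 3 * s) * (LINT y|lborel. f (T y)) \<le> (LINT x|lborel. f x)"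
    by (simp add: cv(2) eq)
  have "(LINT y|lebesgue. jac y * f (T y)) \<le> (LINT y|lebesgue. (1 + 3 * s) * f (T y))"
    by (intro integral_mono integrable_mult_right il cv(1) mult_right_mono jac_bounds nn)
  then show "(LINT x|lborel. f x) \<le> (1 + 3 * s) * (LINT y|lborel. f (T y))"
    by (simp add: cv(2) eq)
qed

lemma gradient_pullback_le:
  assumes "smooth_on UNIV \<phi>"
  shows "(\<Sum>b\<in>Basis. (norm (partial b (\<lambda>y. \<phi> (T y)) y))\<^sup>2) \<le> (1 + 5 * s) * (\<Sum>b\<in>Basis. (norm (partial b \<phi> (T y)))\<^sup>2)"
proof -
  define G where "G = (\<Sum>b\<in>Basis. (norm (partial b \<phi> (T y)))\<^sup>2)"
  have G0: "0 \<le> G" unfolding G_def by (intro sum_nonneg) simp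
  let ?D = "frechet_derivative \<phi> (at (T y))"
  have dir: "(norm (?D h))\<^sup>2 \<le> (norm h)\<^sup>2 * G" for h
    using directional_derivative_bound[OF assms, of "T y" h] unfolding G_def partial_def .
  have lin: "linear ?D" by (rule has_derivative_linear[OF smooth_on_has_derivative[OF assms]])
  have one: "(norm (partial b (\<lambda>y. \<phi> (T y)) y))\<^sup>2 \<le> (1 + s) * (norm (partial b \<phi> (T y)))\<^sup>2 + 2 * s * G"
    if b: "b \<in> Basis" for b
  proof -
    let ?h = "t *\<^sub>R frechet_derivative X (at y) b"
    have "((\<lambda>y. \<phi> (T y)) has_derivative (\<lambda>h. ?D (h - t *\<^sub>R frechet_derivative X (at y) h))) (at y)"
      by (rule has_derivative_compose[OF T_has_derivative smooth_on_has_derivative[OF assms]])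
    from frechet_derivative_at[OF this, symmetric]
    have "partial b (\<lambda>y. \<phi> (T y)) y = ?D (b - ?h)" by (simp add: partial_def)
    also have "\<dots> = ?D b - ?D ?h" by (rule linear_diff[OF lin])
    finally have "norm (partial b (\<lambda>y. \<phi> (T y)) y) \<le> norm (partial b \<phi> (T y)) + norm (?D ?h)"
      using norm_triangle_ineq4 by (simp add: partial_def)
    moreover have "norm (?D ?h) \<le> s * sqrt G"
    proof -
      have "norm ?h \<le> s"
        using mult_left_mono[OF X_derivative[of y b] t_nonneg] b t_nonneg by (simp add: s_def)
      then have "(norm ?h)\<^sup>2 * G \<le> s\<^sup>2 * G" using G0 by (intro mult_right_mono power_mono) auto
      then have "(norm (?D ?h))\<^sup>2 \<le> (s * sqrt G)\<^sup>2"
        using dir[of ?h] G0 by (simp add: power_mult_distrib)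
      then show ?thesis by (rule power2_le_imp_le) (use s_nonneg G0 in simp)
    qed
    ultimately have "(norm (partial b (\<lambda>y. \<phi> (T y)) y))\<^sup>2 \<le> (norm (partial b \<phi> (T y)) + s * sqrt G)\<^sup>2"
      by (intro power_mono) auto
    also have "\<dots> \<le> (1 + s) * (norm (partial b \<phi> (T y)))\<^sup>2 + (s + s\<^sup>2) * G"
    proof -
      \<comment> \<open>Young's inequality with weight \<open>s\<close>: the cross term
        \<open>2 * s * p * r\<close> is at most \<open>s * p\<^sup>2 + s * r\<^sup>2\<close>, so the
        error stays linear in \<open>s\<close>.\<close>
      have aux: "(p + s * r)\<^sup>2 \<le> (1 + s) * p\<^sup>2 + (s + s\<^sup>2) * r\<^sup>2" for p r
        using mult_nonneg_nonneg[OF s_nonneg zero_le_power2[of "p - r"]]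
        by (simp add: power2_eq_square algebra_simps)
      show ?thesis using aux[of "norm (partial b \<phi> (T y))" "sqrt G"] G0 by simp
    qed
    also have "(s + s\<^sup>2) * G \<le> 2 * s * G"
      using G0 s_nonneg s_small mult_left_mono[of s 1 s] by (intro mult_right_mono) (simp_all add: power2_eq_square)
    finally show ?thesis by simp
  qed
  have "(\<Sum>b\<in>Basis. (norm (partial b (\<lambda>y. \<phi> (T y)) y))\<^sup>2)
    \<le> (\<Sum>b\<in>(Basis::(real ^ 2) set). (1 + s) * (norm (partial b \<phi> (T y)))\<^sup>2 + 2 * s * G)"
    by (rule sum_mono) (rule one)
  \<comment> \<open>Each of the two basis directions contributes an error 2 s G, which together with
    the factor 1 + s gives 1 + 5 s.\<close>
  also have "\<dots> = (1 + s) * G + real DIM(real ^ 2) * (2 * s * G)"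
    by (simp add: sum.distrib G_def sum_distrib_left)
  also have "\<dots> = (1 + 5 * s) * G" by (simp add: algebra_simps)
  finally show ?thesis unfolding G_def .
qed

lemma L2_norm_pullback:
  assumes "\<phi> \<in> test_functions U"
  shows "(L2_norm UNIV \<phi>)\<^sup>2 \<le> (1 + 3 * s) * (L2_norm UNIV (\<lambda>y. \<phi> (T y)))\<^sup>2"
proof -
  note c = test_functions_continuous_on[OF assms]
  obtain C where C: "compact C" "\<And>x. x \<notin> C \<Longrightarrow> \<phi> x = 0"
    using test_functions_support[OF assms] by blast
  have cT: "continuous_on UNIV (\<lambda>y. \<phi> (T y))"
    by (rule continuous_on_compose2[OF c[of UNIV] continuous_on_T]) simp
  show ?thesis
    unfolding L2_norm_UNIV_lborel[OF c] L2_norm_UNIV_lborel[OF cT]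
    by (rule integral_compose_T(3)[OF _ C(1)]) (auto intro!: continuous_intros c simp: C(2))
qed

lemma grad_norm2_lborel:
  fixes \<phi> :: "real ^ 2 \<Rightarrow> complex"
  assumes "\<phi> \<in> test_functions U"
  shows "integrable lborel (\<lambda>x. \<Sum>b\<in>Basis. (norm (partial b \<phi> x))\<^sup>2)"
    and "grad_norm2 \<phi> = (LINT x|lborel. (\<Sum>b\<in>Basis. (norm (partial b \<phi> x))\<^sup>2))"
proof -
  note i = test_functions_integrable(2)[OF test_functions_partial[OF assms]]
  show "integrable lborel (\<lambda>x. \<Sum>b\<in>Basis. (norm (partial b \<phi> x))\<^sup>2)"
    by (rule Bochner_Integration.integrable_sum[OF i])
  have "(LINT x|lborel. (\<Sum>b\<in>Basis. (norm (partial b \<phi> x))\<^sup>2)) = (\<Sum>b\<in>Basis. LINT x|lborel. (norm (partial b \<phi> x))\<^sup>2)"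
    by (rule Bochner_Integration.integral_sum[OF i])
  also have "\<dots> = grad_norm2 \<phi>"
    unfolding grad_norm2_def
    by (intro sum.cong refl L2_norm_UNIV_lborel[symmetric] test_functions_continuous_on[OF test_functions_partial[OF assms]])
  finally show "grad_norm2 \<phi> = (LINT x|lborel. (\<Sum>b\<in>Basis. (norm (partial b \<phi> x))\<^sup>2))" by simp
qed

lemma grad_norm2_pullback:
  assumes "\<phi> \<in> test_functions U"
  shows "(1 - 3 * s) * grad_norm2 (\<lambda>y. \<phi> (T y)) \<le> (1 + 5 * s) * grad_norm2 \<phi>"
proof -
  have \<psi>: "(\<lambda>y. \<phi> (T y)) \<in> test_functions UNIV" by (rule test_functions_pullback[OF assms]) simp
  let ?g = "\<lambda>x. \<Sum>b\<in>Basis. (norm (partial b \<phi> x))\<^sup>2"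
  obtain C where C: "compact C" "\<And>x. x \<notin> C \<Longrightarrow> \<phi> x = 0"
    using test_functions_support[OF assms] by blast
  have g: "continuous_on UNIV ?g"
    by (intro continuous_intros test_functions_continuous_on[OF test_functions_partial[OF assms]])
  have g0: "?g x = 0" if "x \<notin> C" for x
    using frechet_derivative_eq_0_outside[OF compact_imp_closed[OF C(1)] C(2) that] by (simp add: partial_def)
  note ic = integral_compose_T[OF g C(1) g0 sum_nonneg]
  have "grad_norm2 (\<lambda>y. \<phi> (T y)) \<le> (LINT y|lborel. (1 + 5 * s) * ?g (T y))"
    unfolding grad_norm2_lborel(2)[OF \<psi>]
    by (intro integral_mono grad_norm2_lborel(1)[OF \<psi>] integrable_mult_right ic(1)
        gradient_pullback_le[OF test_functionsD(1)[OF assms]]) auto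
  then have "(1 - 3 * s) * grad_norm2 (\<lambda>y. \<phi> (T y)) \<le> (1 - 3 * s) * ((1 + 5 * s) * (LINT y|lborel. ?g (T y)))"
    using s_small by (intro mult_left_mono) auto
  also have "\<dots> = (1 + 5 * s) * ((1 - 3 * s) * (LINT y|lborel. ?g (T y)))" by (simp only: mult.left_commute)
  also have "\<dots> \<le> (1 + 5 * s) * (LINT x|lborel. ?g x)"
    using s_nonneg by (intro mult_left_mono ic(2)) auto
  finally show ?thesis unfolding grad_norm2_lborel(2)[OF assms] .
qed

text \<open>The comparison of Rayleigh quotients, cross-multiplied to avoid division by norms. The
  energy estimate and the norm estimate combine to the factor (1 + 5 s)(1 + 3 s)/(1 - 3 s).\<close>

lemma Rayleigh_pullback:
  assumes "\<phi> \<in> test_functions U"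
  shows "grad_norm2 (\<lambda>y. \<phi> (T y)) * (L2_norm UNIV \<phi>)\<^sup>2
    \<le> (1 + 27 * s) * grad_norm2 \<phi> * (L2_norm UNIV (\<lambda>y. \<phi> (T y)))\<^sup>2"
proof -
  let ?G' = "grad_norm2 (\<lambda>y. \<phi> (T y))" and ?G = "grad_norm2 \<phi>"
  let ?n' = "(L2_norm UNIV (\<lambda>y. \<phi> (T y)))\<^sup>2" and ?n = "(L2_norm UNIV \<phi>)\<^sup>2"
  have p: "0 < 1 - 3 * s" using s_small by simp
  \<comment> \<open>The two sides differ by 16 s - 96 s^2, which is nonnegative exactly for 0 \<le>
    s \<le> 1/6; a constant below 27 would fail at s = 1/6.\<close>
  have "(1 + 5 * s) * (1 + 3 * s) \<le> (1 + 27 * s) * (1 - 3 * s)"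
  proof -
    have "96 * (s * s) \<le> 96 * (s * (1 / 6))" using s_nonneg s_small by (intro mult_left_mono) auto
    then show ?thesis by (simp add: algebra_simps)
  qed
  then have k: "((1 + 5 * s) * (1 + 3 * s)) * (?G * ?n') \<le> ((1 + 27 * s) * (1 - 3 * s)) * (?G * ?n')"
    by (rule mult_right_mono) (simp add: grad_norm2_nonneg)
  have "(1 - 3 * s) * (?G' * ?n) = ((1 - 3 * s) * ?G') * ?n" by simp
  also have "\<dots> \<le> ((1 + 5 * s) * ?G) * ((1 + 3 * s) * ?n')"
    by (rule mult_mono[OF grad_norm2_pullback[OF assms] L2_norm_pullback[OF assms]])
       (simp_all add: s_nonneg grad_norm2_nonneg)
  also have "\<dots> = ((1 + 5 * s) * (1 + 3 * s)) * (?G * ?n')" by (simp only: ac_simps)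
  also have "\<dots> \<le> ((1 + 27 * s) * (1 - 3 * s)) * (?G * ?n')" by (rule k)
  also have "\<dots> = (1 - 3 * s) * ((1 + 27 * s) * ?G * ?n')" by (simp only: ac_simps)
  finally show ?thesis using mult_le_cancel_left_pos[OF p] by blast
qed

end

text \<open>\<open>T\<close> sends the complement of the inner domain into the complement of
  \<open>\<Omega>\<close>, so composing with \<open>T\<close> moves supports into the inner domain.
  The pullback is nonzero because its norm bounds that of \<open>\<phi>\<close> from above up to a
  factor.\<close>

theorem inner_domain_Rayleigh:
  fixes \<Omega> :: "(real ^ 2) set"
  assumes \<Omega>: "open \<Omega>" "bounded \<Omega>" "\<Omega> \<noteq> {}" "smooth_boundary \<Omega>"
  shows "\<exists>C>0. \<exists>\<delta>0>0. \<forall>\<delta> \<phi>. 0 < \<delta> \<longrightarrow> \<delta> < \<delta>0 \<longrightarrow> \<phi> \<in> test_functions \<Omega> \<longrightarrow> L2_norm UNIV \<phi> \<noteq> 0 \<longrightarrow>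
    (\<exists>\<psi>\<in>test_functions (inner_domain \<Omega> \<delta>). L2_norm UNIV \<psi> \<noteq> 0 \<and>
       grad_norm2 \<psi> * (L2_norm UNIV \<phi>)\<^sup>2 \<le> (1 + C * \<delta>) * grad_norm2 \<phi> * (L2_norm UNIV \<psi>)\<^sup>2)"
proof -
  have "\<Omega> \<noteq> UNIV" using \<Omega>(2) not_bounded_UNIV by blast
  with \<Omega>(3) have ne: "frontier \<Omega> \<noteq> {}" by (rule frontier_not_empty)
  from transversal_field[OF \<Omega>(1,2,4) ne] obtain X :: "real ^ 2 \<Rightarrow> real ^ 2" and K c t0
    where X: "smooth_on UNIV X" "compact K" "\<And>x. x \<notin> K \<Longrightarrow> X x = 0" and c: "c > 0" and t0: "t0 > 0"
    and out: "\<And>t y. 0 < t \<Longrightarrow> t \<le> t0 \<Longrightarrow> y \<notin> inner_domain \<Omega> (c * t) \<Longrightarrow> y - t *\<^sub>R X y \<notin> \<Omega>"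
    by blast
  obtain B where B: "B \<ge> 0" "\<And>x h. norm (frechet_derivative X (at x) h) \<le> B * norm h"
    using smooth_on_derivative_bound_compact_support[OF X] by blast
  \<comment> \<open>Translates the two smallness conditions on the time, \<open>t \<le> t0\<close>
    and \<open>t * B \<le> 1 / 6\<close>, into conditions on the width; \<open>B + 1\<close> avoids
    a division by 0.\<close>
  define \<delta>0 where "\<delta>0 = c * min t0 (1 / (6 * (B + 1)))"
  have \<delta>0: "\<delta>0 > 0" unfolding \<delta>0_def using c t0 B(1) by (intro mult_pos_pos) auto
  have "\<exists>\<psi>\<in>test_functions (inner_domain \<Omega> \<delta>). L2_norm UNIV \<psi> \<noteq> 0 \<and>
       grad_norm2 \<psi> * (L2_norm UNIV \<phi>)\<^sup>2 \<le> (1 + (27 * (B + 1) / c) * \<delta>) * grad_norm2 \<phi> * (L2_norm UNIV \<psi>)\<^sup>2"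
    if \<delta>: "0 < \<delta>" "\<delta> < \<delta>0" and \<phi>: "\<phi> \<in> test_functions \<Omega>" "L2_norm UNIV \<phi> \<noteq> 0" for \<delta> \<phi>
  proof -
    \<comment> \<open>The time at which the field empties a layer of width exactly \<delta>; it is
      linear in \<delta>, and so is the relative error 27 t B.\<close>
    define t where "t = \<delta> / c"
    have t: "0 < t" "c * t = \<delta>" using \<delta>(1) c by (simp_all add: t_def)
    have tlt: "t < min t0 (1 / (6 * (B + 1)))"
    proof -
      have "\<delta> < min t0 (1 / (6 * (B + 1))) * c" using \<delta>(2) unfolding \<delta>0_def by (simp only: mult.commute)
      then show ?thesis unfolding t_def using c by (simp only: pos_divide_less_eq)
    qed
    have "t * B \<le> 1 / 6"
    proof -
      have "t * B \<le> 1 / (6 * (B + 1)) * (B + 1)" using tlt t(1) B(1) by (intro mult_mono) auto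
      also have "\<dots> = 1 / 6" using B(1) by simp
      finally show ?thesis .
    qed
    then interpret perturbed_identity X K B t
      using X B t(1) by unfold_locales auto
    let ?\<psi> = "\<lambda>y. \<phi> (T y)"
    have \<psi>: "?\<psi> \<in> test_functions (inner_domain \<Omega> \<delta>)"
    proof (rule test_functions_pullback[OF \<phi>(1)])
      fix y assume "T y \<in> \<Omega>"
      then show "y \<in> inner_domain \<Omega> \<delta>" using out[of t y] t tlt by (auto simp: T_def)
    qed
    have "0 < (L2_norm UNIV \<phi>)\<^sup>2" using \<phi>(2) by simp
    with L2_norm_pullback[OF \<phi>(1)] have nz: "L2_norm UNIV ?\<psi> \<noteq> 0" by auto
    have "27 * (t * B) \<le> (27 * (B + 1) / c) * \<delta>"
    proof -
      have "27 * (t * B) \<le> 27 * (t * (B + 1))" using t(1) by simp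
      also have "\<dots> = (27 * (B + 1) / c) * \<delta>" by (simp add: t_def)
      finally show ?thesis .
    qed
    then have "(1 + 27 * (t * B)) * (grad_norm2 \<phi> * (L2_norm UNIV ?\<psi>)\<^sup>2)
        \<le> (1 + (27 * (B + 1) / c) * \<delta>) * (grad_norm2 \<phi> * (L2_norm UNIV ?\<psi>)\<^sup>2)"
      by (intro mult_right_mono mult_nonneg_nonneg grad_norm2_nonneg) auto
    with Rayleigh_pullback[OF \<phi>(1)] \<psi> nz show ?thesis
      by (intro bexI[of _ ?\<psi>]) (auto simp: s_def mult.assoc)
  qed
  moreover have "27 * (B + 1) / c > 0" using B(1) c by simp
  ultimately show ?thesis using \<delta>0 by blast
qed

section \<open>The first eigenvalues\<close>

lemma test_functions_nonzero:
  fixes \<Omega> :: "'a::euclidean_space set"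
  assumes "open \<Omega>" "\<Omega> \<noteq> {}"
  shows "\<exists>\<phi>\<in>test_functions \<Omega>. L2_norm UNIV \<phi> \<noteq> 0"
proof -
  obtain x where "x \<in> \<Omega>" using assms(2) by blast
  then obtain a c where ac: "x \<in> box a c" "cbox a c \<subseteq> \<Omega>"
    using open_contains_cbox[OF assms(1)] by metis
  let ?\<phi> = "\<lambda>x. complex_of_real (box_bump a c 0 x)"
  have \<phi>: "?\<phi> \<in> test_functions \<Omega>" by (rule test_functions_box_bump[OF ac(2)])
  have pos: "?\<phi> y \<noteq> 0" if "y \<in> box a c" for y
    using that by (auto simp: box_bump_def mem_box cutoff_eq inner_diff_left)
  have "L2_norm UNIV ?\<phi> \<noteq> 0"
  proof
    assume "L2_norm UNIV ?\<phi> = 0"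
    then have "AE y in lebesgue. ?\<phi> y = 0"
      using L2_norm_eq_0_iff[OF test_functions_L2_UNIV[OF \<phi>]] unfolding lebesgue_on_UNIV_eq by blast
    then have "AE y in lebesgue. y \<notin> box a c" by (rule eventually_mono) (use pos in blast)
    then have "box a c \<in> null_sets lebesgue" by (simp add: AE_iff_null_sets)
    then have "negligible (box a c)" by (simp add: negligible_iff_null_sets)
    then show False using open_not_negligible[OF open_box] ac(1) by blast
  qed
  with \<phi> show ?thesis by blast
qed

lemma grad_norm2_pos:
  assumes "bounded \<Omega>" "\<phi> \<in> test_functions \<Omega>" "L2_norm UNIV \<phi> \<noteq> 0"
  shows "0 < grad_norm2 \<phi>"
proof -
  obtain R where "R > 0" "\<Omega> \<subseteq> ball 0 R" using bounded_subset_ballD[OF assms(1)] by blast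
  then have "(L2_norm UNIV \<phi>)\<^sup>2 \<le> 2 * R\<^sup>2 * grad_norm2 \<phi>" using Poincare_test[OF assms(2)] by blast
  moreover have "0 < (L2_norm UNIV \<phi>)\<^sup>2" using assms(3) by simp
  ultimately show ?thesis using grad_norm2_nonneg[of \<phi>] by (cases "grad_norm2 \<phi> = 0") auto
qed

context layer_problem
begin

text \<open>Vanishing on the open set \<open>L\<close>, the function has weak Laplacian 0 there and
  its derivatives vanish as well, so the Green functional is identically 0 and only the Dirichlet
  part of \<open>q\<close> remains.\<close>

lemma test_function_in_V:
  assumes \<psi>: "\<psi> \<in> test_functions \<Omega>" and zero: "\<And>x. x \<in> L \<Longrightarrow> \<psi> x = 0"
  shows "\<psi> \<in> V" "q \<mu> \<psi> = \<mu> * (grad_norm2 \<psi> - \<mu> * (L2_norm UNIV \<psi>)\<^sup>2)"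
proof -
  have lap: "is_weak_laplacian L \<psi> (\<lambda>x. 0)"
  proof -
    have "(LINT x|lebesgue_on L. \<psi> x * laplacian \<phi> x) = 0" for \<phi>
      using zero by (intro integral_eq_zero_AE AE_I2) simp
    then show ?thesis by (simp add: is_weak_laplacian_def)
  qed
  have p0: "partial b \<psi> x = 0" if "x \<in> L" for b x
    unfolding partial_def
    by (rule frechet_derivative_eq_0_outside[of "- L"]) (use open_L zero that in auto)
  show \<psi>V: "\<psi> \<in> V"
  proof (rule V_I[OF test_functions_subset_H10[OF open_\<Omega> \<psi>] lap is_weak_partial_test_function[OF \<psi> open_\<Omega>]])
    show "(LINT x|lebesgue_on L. 0 * \<phi> x + (\<Sum>b\<in>Basis. partial b \<psi> x * partial b \<phi> x)) = 0" for \<phi>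
      using p0 by (intro integral_eq_zero_AE AE_I2) simp
  qed
  have "AE x in lebesgue_on L. E \<mu> \<psi> x = 0"
    using weak_laplacian_AE_eq[OF open_L lap] AE_space
    by eventually_elim (simp add: E_def flux_def zero)
  then have "L2_norm L (E \<mu> \<psi>) = 0" using L2_norm_eq_0_iff[OF V_E_L2[OF \<psi>V]] by simp
  moreover have "grad2 \<psi> = grad_norm2 \<psi>"
    unfolding grad2_def grad_norm2_def by (simp add: weak_partial_L2_norm_test[OF \<psi> open_\<Omega>])
  ultimately show "q \<mu> \<psi> = \<mu> * (grad_norm2 \<psi> - \<mu> * (L2_norm UNIV \<psi>)\<^sup>2)"
    by (simp add: q_def L2_norm_test_eq[OF \<psi> open_\<Omega>] power2_eq_square algebra_simps)
qed

text \<open>At the parameter equal to its own Rayleigh quotient the function makes \<open>q\<close>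
  vanish.\<close>

lemma Rayleigh_in_S:
  assumes \<psi>: "\<psi> \<in> test_functions \<Omega>" and "\<And>x. x \<in> L \<Longrightarrow> \<psi> x = 0" and nz: "L2_norm UNIV \<psi> \<noteq> 0"
  shows "grad_norm2 \<psi> / (L2_norm UNIV \<psi>)\<^sup>2 \<in> S"
proof -
  have V: "\<psi> \<in> V" "q \<mu> \<psi> = \<mu> * (grad_norm2 \<psi> - \<mu> * (L2_norm UNIV \<psi>)\<^sup>2)" for \<mu>
    using test_function_in_V[OF \<psi>] assms(2) by auto
  have "0 < grad_norm2 \<psi> / (L2_norm UNIV \<psi>)\<^sup>2"
    using grad_norm2_pos[OF bounded_\<Omega> \<psi> nz] nz by simp
  moreover have "q (grad_norm2 \<psi> / (L2_norm UNIV \<psi>)\<^sup>2) \<psi> = 0" unfolding V(2) using nz by simp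
  moreover have "L2_norm \<Omega> \<psi> \<noteq> 0" using nz by (simp add: L2_norm_test_eq[OF \<psi> open_\<Omega>])
  ultimately show ?thesis using V(1) unfolding S_def by auto
qed

end

section \<open>Both eigenvalue problems as layer problems\<close>

lemma layer_problem_empty:
  assumes "open \<Omega>" "bounded \<Omega>"
  shows "layer_problem \<Omega> {} {} (\<lambda>_. 1) 1 1"
  using assms by unfold_locales auto

text \<open>With an empty layer the problem is the Dirichlet problem, its form being \<open>\<mu>\<close> times the usual one.\<close>

lemma dirichlet_eigenvalue_iff:
  fixes \<Omega> :: "'a::euclidean_space set"
  assumes \<Omega>: "open \<Omega>" "bounded \<Omega>"
  shows "dirichlet_eigenvalue \<Omega> \<mu> \<longleftrightarrow> layer_problem.eigenvalue \<Omega> {} {} (\<lambda>_. 1) \<mu>"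
proof -
  interpret layer_problem \<Omega> "{}" "{}" "\<lambda>_. 1" 1 1 by (rule layer_problem_empty[OF \<Omega>])
  have V: "V = H10 \<Omega>"
    unfolding V_def is_weak_laplacian_def by (auto intro!: exI[of _ "\<lambda>x. 0"])
  have form: "form \<nu> u \<psi> = of_real \<nu> * (grad_inner \<Omega> u \<psi> - of_real \<nu> * L2_inner \<Omega> u \<psi>)" for \<nu> u \<psi>
    unfolding form_def by (simp add: power2_eq_square algebra_simps)
  \<comment> \<open>The definition of a Dirichlet eigenvalue admits every real number, that of a
    layer eigenvalue only positive ones; the Poincare inequality closes the gap.\<close>
  have pos: "\<mu> > 0"
    if u: "u \<in> H10 \<Omega>" "\<not> (AE x in lebesgue_on \<Omega>. u x = 0)" "grad_inner \<Omega> u u = of_real \<mu> * L2_inner \<Omega> u u" for u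
  proof -
    obtain c where c: "c > 0" "\<And>u. u \<in> H10 \<Omega> \<Longrightarrow> (L2_norm \<Omega> u)\<^sup>2 \<le> c * (\<Sum>b\<in>Basis. (L2_norm \<Omega> (D b u))\<^sup>2)"
      using Poincare[OF \<Omega>] by blast
    have uV: "u \<in> V" using u(1) V by simp
    \<comment> \<open>At parameter 1 the form is energy minus mass, so that \<open>form_self\<close>
      turns the complex eigenvalue identity into a real one.\<close>
    have "form 1 u u = of_real (q 1 u)" by (rule form_self[OF uV])
    then have "complex_of_real (\<mu> * (L2_norm \<Omega> u)\<^sup>2) = of_real (grad2 u)"
      unfolding form u(3) L2_inner_self
      by (simp add: q_def L2_norm_def algebra_simps flip: of_real_mult of_real_diff of_real_power)
    then have eq: "\<mu> * (L2_norm \<Omega> u)\<^sup>2 = grad2 u" by (simp only: of_real_eq_iff)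
    have n: "0 < (L2_norm \<Omega> u)\<^sup>2" using u(2) L2_norm_eq_0_iff[OF H10_L2[OF u(1)]] by simp
    have "0 < c * grad2 u" using c(2)[OF u(1)] n unfolding grad2_def by linarith
    then have "0 < \<mu> * (L2_norm \<Omega> u)\<^sup>2" using c(1) unfolding eq by (simp add: zero_less_mult_iff)
    then show ?thesis using n by (simp add: zero_less_mult_iff)
  qed
  show ?thesis
  proof
    assume "dirichlet_eigenvalue \<Omega> \<mu>"
    then obtain u where u: "u \<in> H10 \<Omega>" "\<not> (AE x in lebesgue_on \<Omega>. u x = 0)"
      "\<And>\<psi>. \<psi> \<in> H10 \<Omega> \<Longrightarrow> grad_inner \<Omega> u \<psi> = of_real \<mu> * L2_inner \<Omega> u \<psi>"
      unfolding dirichlet_eigenvalue_def by blast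
    have "\<mu> > 0" by (rule pos[OF u(1,2) u(3)[OF u(1)]])
    moreover have "form \<mu> u \<psi> = 0" if "\<psi> \<in> V" for \<psi>
      using u(3)[of \<psi>] that unfolding form V by simp
    ultimately show "eigenvalue \<mu>" unfolding eigenvalue_def V using u(1,2) unfolding V by blast
  next
    assume "eigenvalue \<mu>"
    then obtain u where u: "\<mu> > 0" "u \<in> H10 \<Omega>" "\<not> (AE x in lebesgue_on \<Omega>. u x = 0)"
      "\<And>\<psi>. \<psi> \<in> H10 \<Omega> \<Longrightarrow> form \<mu> u \<psi> = 0"
      unfolding eigenvalue_def V by blast
    have "grad_inner \<Omega> u \<psi> = of_real \<mu> * L2_inner \<Omega> u \<psi>" if "\<psi> \<in> H10 \<Omega>" for \<psi>
      using u(4)[OF that] u(1) unfolding form by simp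
    then show "dirichlet_eigenvalue \<Omega> \<mu>" unfolding dirichlet_eigenvalue_def using u(2,3) by blast
  qed
qed

lemma thin_layer_props:
  assumes "open \<Omega>"
  shows "open (thin_layer \<Omega> \<delta>)" "thin_layer \<Omega> \<delta> \<subseteq> \<Omega>"
    "\<delta> \<le> \<delta>s \<Longrightarrow> thin_layer \<Omega> \<delta> \<subseteq> closure \<Omega> - inner_domain \<Omega> \<delta>s"
proof -
  show "open (thin_layer \<Omega> \<delta>)" unfolding thin_layer_def by (intro open_Diff assms closed_closure)
  show "thin_layer \<Omega> \<delta> \<subseteq> \<Omega>" unfolding thin_layer_def by blast
  assume "\<delta> \<le> \<delta>s"
  then have "inner_domain \<Omega> \<delta>s \<subseteq> inner_domain \<Omega> \<delta>" unfolding inner_domain_def by auto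
  then show "thin_layer \<Omega> \<delta> \<subseteq> closure \<Omega> - inner_domain \<Omega> \<delta>s"
    unfolding thin_layer_def using closure_subset[of \<Omega>] closure_subset[of "inner_domain \<Omega> \<delta>"] by blast
qed

text \<open>From 0 < n < \<open>nupp\<close> < 1 the weight 1/(1 - n) lies between 1 and 1/(1 -
  \<open>nupp\<close>), bounds that do not depend on \<delta>. It is measurable because
  \<open>n\<close> is continuous on the layer, which lies in the set where \<open>n\<close> is
  smooth.\<close>

lemma layer_problem_thin_layer:
  fixes \<Omega> :: "'a::euclidean_space set" and n :: "'a \<Rightarrow> real"
  assumes \<Omega>: "open \<Omega>" "bounded \<Omega>" and n: "smooth_extendable_on (closure \<Omega> - inner_domain \<Omega> \<delta>s) n"
    and bounds: "0 < nlow" "nupp < 1" "\<And>x. x \<in> closure \<Omega> - inner_domain \<Omega> \<delta>s \<Longrightarrow> nlow < n x \<and> n x < nupp"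
    and \<delta>: "\<delta> \<le> \<delta>s"
  shows "layer_problem \<Omega> (thin_layer \<Omega> \<delta>) (test_functions (- closure (inner_domain \<Omega> \<delta>)))
    (\<lambda>x. 1 / (1 - n x)) 1 (1 / (1 - nupp))"
proof
  let ?L = "thin_layer \<Omega> \<delta>"
  note L = thin_layer_props[OF \<Omega>(1)]
  have sub: "?L \<subseteq> closure \<Omega> - inner_domain \<Omega> \<delta>s" by (rule L(3)[OF \<delta>])
  show "open \<Omega>" "bounded \<Omega>" "open ?L" "?L \<subseteq> \<Omega>" using \<Omega> L by auto
  show "test_functions (- closure (inner_domain \<Omega> \<delta>)) \<subseteq> test_functions UNIV" by (rule test_functions_mono) simp
  obtain U g where g: "closure \<Omega> - inner_domain \<Omega> \<delta>s \<subseteq> U" "smooth_on U g"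
    "\<And>x. x \<in> closure \<Omega> - inner_domain \<Omega> \<delta>s \<Longrightarrow> g x = n x"
    using n unfolding smooth_extendable_on_def by blast
  have "Ck_on 0 U g" using g(2) unfolding smooth_on_def by blast
  then have "continuous_on ?L g" using g(1) sub by (auto intro: continuous_on_subset)
  then have "continuous_on ?L n" using g(3) sub by (auto intro: continuous_on_eq)
  moreover have "1 - n x \<noteq> 0" if "x \<in> ?L" for x
    using bounds(2) bounds(3)[of x] sub that by force
  ultimately have "continuous_on ?L (\<lambda>x. 1 / (1 - n x))"
    by (intro continuous_on_divide continuous_on_diff continuous_on_const) auto
  then show "(\<lambda>x. 1 / (1 - n x)) \<in> borel_measurable (lebesgue_on ?L)"
    by (rule continuous_imp_measurable_on_sets_lebesgue[OF _ open_sets_lebesgue[OF L(1)]])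
  show "(0::real) < 1" by simp
  fix x assume "x \<in> ?L"
  then have "0 < n x" "n x < nupp" using bounds(1) bounds(3)[of x] sub by auto
  then show "1 \<le> 1 / (1 - n x)" "1 / (1 - n x) \<le> 1 / (1 - nupp)"
    using bounds(2) by (auto simp: divide_simps)
qed

lemma transmission_eigenvalue_iff:
  fixes \<Omega> :: "'a::euclidean_space set"
  assumes "layer_problem \<Omega> (thin_layer \<Omega> \<delta>) (test_functions (- closure (inner_domain \<Omega> \<delta>)))
    (\<lambda>x. 1 / (1 - n x)) a0 a1"
  shows "transmission_eigenvalue \<Omega> n \<delta> \<mu> \<longleftrightarrow>
    layer_problem.eigenvalue \<Omega> (thin_layer \<Omega> \<delta>) (test_functions (- closure (inner_domain \<Omega> \<delta>))) (\<lambda>x. 1 / (1 - n x)) \<mu>"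
proof -
  interpret layer_problem \<Omega> "thin_layer \<Omega> \<delta>" "test_functions (- closure (inner_domain \<Omega> \<delta>))"
    "\<lambda>x. 1 / (1 - n x)" a0 a1 by (rule assms)
  have V: "V = W_space \<Omega> \<delta>"
    unfolding V_def W_space_def normal_derivative_def by simp
  \<comment> \<open>Cancels one of the two copies of the mass term on the right. The sign in front
    of the normal derivative does not matter, as only its vanishing is required.\<close>
  have *: "(p + r + s = 2 * m * l) \<longleftrightarrow> (p + s - m * l = 0)" if "r = m * l" for p r s m l :: complex
    using that by (auto simp: algebra_simps)
  show ?thesis
    unfolding transmission_eigenvalue_def eigenvalue_def V form_def by (simp add: *[OF refl])
qed

text \<open>The analytic comparison, with the geometry isolated in the hypothesis on shrinking test
  functions. Each minimizer serves in the other problem: the transmission minimizer directly, the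
  Dirichlet minimizer after approximation and shrinking.\<close>

lemma first_transmission_eigenvalue_bounds:
  fixes \<Omega> :: "(real ^ 2) set" and n :: "real ^ 2 \<Rightarrow> real"
  assumes \<Omega>: "open \<Omega>" "bounded \<Omega>" "\<Omega> \<noteq> {}"
    and layer: "layer_problem \<Omega> (thin_layer \<Omega> \<delta>) (test_functions (- closure (inner_domain \<Omega> \<delta>)))
      (\<lambda>x. 1 / (1 - n x)) a0 a1"
    and shrink: "\<And>\<phi>. \<phi> \<in> test_functions \<Omega> \<Longrightarrow> L2_norm UNIV \<phi> \<noteq> 0 \<Longrightarrow>
      \<exists>\<psi>\<in>test_functions (inner_domain \<Omega> \<delta>). L2_norm UNIV \<psi> \<noteq> 0 \<and>
       grad_norm2 \<psi> * (L2_norm UNIV \<phi>)\<^sup>2 \<le> (1 + k) * grad_norm2 \<phi> * (L2_norm UNIV \<psi>)\<^sup>2"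
    and k: "0 \<le> k"
  shows "first_dirichlet_eigenvalue \<Omega> \<le> first_transmission_eigenvalue \<Omega> n \<delta>"
    and "first_transmission_eigenvalue \<Omega> n \<delta> \<le> (1 + k) * first_dirichlet_eigenvalue \<Omega>"
proof -
  interpret D: layer_problem \<Omega> "{}" "{}" "\<lambda>_. 1" 1 1 by (rule layer_problem_empty[OF \<Omega>(1,2)])
  interpret T: layer_problem \<Omega> "thin_layer \<Omega> \<delta>" "test_functions (- closure (inner_domain \<Omega> \<delta>))"
    "\<lambda>x. 1 / (1 - n x)" a0 a1 by (rule layer)
  let ?LD = "first_dirichlet_eigenvalue \<Omega>" and ?LT = "first_transmission_eigenvalue \<Omega> n \<delta>"
  obtain \<phi>0 where \<phi>0: "\<phi>0 \<in> test_functions \<Omega>" "L2_norm UNIV \<phi>0 \<noteq> 0"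
    using test_functions_nonzero[OF \<Omega>(1,3)] by blast
  have DS: "D.S \<noteq> {}" using D.Rayleigh_in_S[OF \<phi>0(1) _ \<phi>0(2)] by blast
  have in_T: "grad_norm2 \<psi> / (L2_norm UNIV \<psi>)\<^sup>2 \<in> T.S"
    if \<psi>: "\<psi> \<in> test_functions (inner_domain \<Omega> \<delta>)" "L2_norm UNIV \<psi> \<noteq> 0" for \<psi>
  proof (rule T.Rayleigh_in_S[OF _ _ \<psi>(2)])
    show "\<psi> \<in> test_functions \<Omega>"
      using \<psi>(1) test_functions_mono[of "inner_domain \<Omega> \<delta>" \<Omega>] unfolding inner_domain_def by blast
    show "\<psi> x = 0" if "x \<in> thin_layer \<Omega> \<delta>" for x
      using that closure_subset[of "inner_domain \<Omega> \<delta>"] unfolding thin_layer_def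
      by (intro test_functions_outside[OF \<psi>(1)]) blast
  qed
  have TS: "T.S \<noteq> {}" using in_T shrink[OF \<phi>0] by blast
  have LD: "?LD = Inf D.S"
    unfolding first_dirichlet_eigenvalue_def dirichlet_eigenvalue_iff[OF \<Omega>(1,2)] by (rule D.eigenvalue_Inf_S(2)[OF DS])
  have LT: "?LT = Inf T.S"
    unfolding first_transmission_eigenvalue_def transmission_eigenvalue_iff[OF layer] by (rule T.eigenvalue_Inf_S(2)[OF TS])
  have DV: "D.V = H10 \<Omega>"
    unfolding D.V_def is_weak_laplacian_def by (auto intro!: exI[of _ "\<lambda>x. 0"])
  have Dq: "D.q \<mu> u = \<mu> * (D.grad2 u - \<mu> * (L2_norm \<Omega> u)\<^sup>2)" for \<mu> u
    by (simp add: D.q_def L2_norm_def[of "{}"] power2_eq_square algebra_simps)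
  have "Inf T.S \<in> T.S" by (rule T.eigenvalue_Inf_S(3)[OF TS])
  then obtain u where u: "0 < Inf T.S" "u \<in> T.V" "L2_norm \<Omega> u \<noteq> 0" "T.q (Inf T.S) u \<le> 0"
    unfolding T.S_def by blast
  have "T.grad2 u \<le> Inf T.S * (L2_norm \<Omega> u)\<^sup>2" by (rule T.q_le_0_grad2[OF u(1,4)])
  \<comment> \<open>The Dirichlet form at \<mu> is \<mu> times energy minus \<mu> times mass, so a
    Rayleigh quotient of at most \<mu> puts \<mu> into the Dirichlet set.\<close>
  then have "D.q (Inf T.S) u \<le> 0"
    unfolding Dq using u(1) by (intro mult_nonneg_nonpos) (auto simp: D.grad2_def T.grad2_def)
  then have "Inf T.S \<in> D.S" using u(1,3) T.V_H10[OF u(2)] unfolding D.S_def DV by blast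
  from D.Inf_S(2)[OF DS this] show "?LD \<le> ?LT" unfolding LD LT .
  \<comment> \<open>Stated for all test functions, including those of norm 0, so that it can be
    applied along an approximating sequence of the Dirichlet minimizer.\<close>
  have test: "?LT * (L2_norm UNIV \<phi>)\<^sup>2 \<le> (1 + k) * grad_norm2 \<phi>" if \<phi>: "\<phi> \<in> test_functions \<Omega>" for \<phi>
  proof (cases "L2_norm UNIV \<phi> = 0")
    case True
    then show ?thesis using k grad_norm2_nonneg[of \<phi>] by simp
  next
    case False
    from shrink[OF \<phi> False] obtain \<psi> where \<psi>: "\<psi> \<in> test_functions (inner_domain \<Omega> \<delta>)" "L2_norm UNIV \<psi> \<noteq> 0"
      "grad_norm2 \<psi> * (L2_norm UNIV \<phi>)\<^sup>2 \<le> (1 + k) * grad_norm2 \<phi> * (L2_norm UNIV \<psi>)\<^sup>2" by blast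
    have p: "0 < (L2_norm UNIV \<psi>)\<^sup>2" using \<psi>(2) by simp
    have "?LT \<le> grad_norm2 \<psi> / (L2_norm UNIV \<psi>)\<^sup>2" unfolding LT by (rule T.Inf_S(2)[OF TS in_T[OF \<psi>(1,2)]])
    then have "?LT * (L2_norm UNIV \<psi>)\<^sup>2 \<le> grad_norm2 \<psi>" using p by (simp only: pos_le_divide_eq)
    then have "(?LT * (L2_norm UNIV \<psi>)\<^sup>2) * (L2_norm UNIV \<phi>)\<^sup>2 \<le> grad_norm2 \<psi> * (L2_norm UNIV \<phi>)\<^sup>2"
      by (rule mult_right_mono) simp
    also note \<psi>(3)
    finally have "(?LT * (L2_norm UNIV \<phi>)\<^sup>2) * (L2_norm UNIV \<psi>)\<^sup>2 \<le> ((1 + k) * grad_norm2 \<phi>) * (L2_norm UNIV \<psi>)\<^sup>2"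
      by (simp only: ac_simps)
    then show ?thesis by (rule mult_right_le_imp_le[OF _ p])
  qed
  have "Inf D.S \<in> D.S" by (rule D.eigenvalue_Inf_S(3)[OF DS])
  then obtain v where v: "0 < Inf D.S" "v \<in> H10 \<Omega>" "L2_norm \<Omega> v \<noteq> 0" "D.q (Inf D.S) v \<le> 0"
    unfolding D.S_def DV by blast
  have gv: "D.grad2 v \<le> Inf D.S * (L2_norm \<Omega> v)\<^sup>2" by (rule D.q_le_0_grad2[OF v(1,4)])
  obtain f where f: "\<And>j. f j \<in> test_functions \<Omega>" "(\<lambda>j. L2_norm \<Omega> (f j)) \<longlonglongrightarrow> L2_norm \<Omega> v"
    "\<And>b. b \<in> Basis \<Longrightarrow> (\<lambda>j. L2_norm \<Omega> (partial b (f j))) \<longlonglongrightarrow> L2_norm \<Omega> (weak_partial \<Omega> b v)"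
    using H10_test_sequence[OF \<Omega>(1) v(2)] by blast
  have "?LT * (L2_norm \<Omega> (f j))\<^sup>2 \<le> (1 + k) * (\<Sum>b\<in>Basis. (L2_norm \<Omega> (partial b (f j)))\<^sup>2)" for j
    using test[OF f(1), of j] L2_norm_test_eq[OF test_functions_partial[OF f(1)] \<Omega>(1), of _ j]
    by (simp add: grad_norm2_def L2_norm_test_eq[OF f(1) \<Omega>(1)])
  \<comment> \<open>Only here does the estimate leave test functions: both sides are continuous in
    the norms of the function and of its first derivatives.\<close>
  then have "?LT * (L2_norm \<Omega> v)\<^sup>2 \<le> (1 + k) * (\<Sum>b\<in>Basis. (L2_norm \<Omega> (weak_partial \<Omega> b v))\<^sup>2)"
    by (intro LIMSEQ_le[OF tendsto_mult[OF tendsto_const tendsto_power[OF f(2)]]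
          tendsto_mult[OF tendsto_const tendsto_sum[OF tendsto_power[OF f(3)]]]]) auto
  also have "\<dots> \<le> (1 + k) * (Inf D.S * (L2_norm \<Omega> v)\<^sup>2)"
    using gv k unfolding D.grad2_def by (intro mult_left_mono) auto
  finally have "?LT * (L2_norm \<Omega> v)\<^sup>2 \<le> ((1 + k) * ?LD) * (L2_norm \<Omega> v)\<^sup>2" by (simp add: LD)
  then show "?LT \<le> (1 + k) * ?LD" by (rule mult_right_le_imp_le) (use v(3) in simp)
qed

theorem theorem4p3:
  fixes \<Omega> :: "(real ^ 2) set" and n :: "real ^ 2 \<Rightarrow> real" and \<delta>s nlow nupp :: real
  assumes "open \<Omega>" and "connected \<Omega>" and "\<Omega> \<noteq> {}" and "bounded \<Omega>"
    and "simply_connected \<Omega>" and "smooth_boundary \<Omega>"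
    and "\<delta>s > 0" and "smooth_extendable_on (closure \<Omega> - inner_domain \<Omega> \<delta>s) n"
    and "0 < nlow" and "nupp < 1"
    and "\<And>x. x \<in> closure \<Omega> - inner_domain \<Omega> \<delta>s \<Longrightarrow> nlow < n x \<and> n x < nupp"
  shows "\<exists>C>0. \<exists>\<delta>0>0. \<delta>0 \<le> \<delta>s \<and> (\<forall>\<delta>. 0 < \<delta> \<and> \<delta> < \<delta>0 \<longrightarrow>
    \<bar>first_transmission_eigenvalue \<Omega> n \<delta> - first_dirichlet_eigenvalue \<Omega>\<bar> \<le> C * \<delta>)"
proof -
  obtain C \<delta>1 where C: "C > 0" "\<delta>1 > 0"
    and shrink: "\<And>\<delta> \<phi>. 0 < \<delta> \<Longrightarrow> \<delta> < \<delta>1 \<Longrightarrow> \<phi> \<in> test_functions \<Omega> \<Longrightarrow> L2_norm UNIV \<phi> \<noteq> 0 \<Longrightarrow>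
    \<exists>\<psi>\<in>test_functions (inner_domain \<Omega> \<delta>). L2_norm UNIV \<psi> \<noteq> 0 \<and>
       grad_norm2 \<psi> * (L2_norm UNIV \<phi>)\<^sup>2 \<le> (1 + C * \<delta>) * grad_norm2 \<phi> * (L2_norm UNIV \<psi>)\<^sup>2"
    using inner_domain_Rayleigh[OF assms(1,4,3,6)] by blast
  let ?LD = "first_dirichlet_eigenvalue \<Omega>"
  \<comment> \<open>The difference lies between 0 and C \<delta> times the Dirichlet eigenvalue.
    Absolute value and \<open>+ 1\<close> make the constant positive without recourse to the sign of
    that eigenvalue; it depends on \<open>\<Omega>\<close> alone.\<close>
  have "\<bar>first_transmission_eigenvalue \<Omega> n \<delta> - ?LD\<bar> \<le> (C * (\<bar>?LD\<bar> + 1)) * \<delta>"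
    if \<delta>: "0 < \<delta>" "\<delta> < min \<delta>1 \<delta>s" for \<delta>
  proof -
    have "layer_problem \<Omega> (thin_layer \<Omega> \<delta>) (test_functions (- closure (inner_domain \<Omega> \<delta>)))
      (\<lambda>x. 1 / (1 - n x)) 1 (1 / (1 - nupp))"
      using \<delta> by (intro layer_problem_thin_layer[OF assms(1,4,8-11)]) auto
    note bounds = first_transmission_eigenvalue_bounds[OF assms(1,4,3) this shrink]
    have "?LD \<le> first_transmission_eigenvalue \<Omega> n \<delta>" using \<delta> C by (intro bounds(1)) auto
    moreover have "first_transmission_eigenvalue \<Omega> n \<delta> \<le> (1 + C * \<delta>) * ?LD" using \<delta> C by (intro bounds(2)) auto
    moreover have "(1 + C * \<delta>) * ?LD = ?LD + (C * \<delta>) * ?LD" by (simp add: algebra_simps)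
    moreover have "(C * \<delta>) * ?LD \<le> (C * \<delta>) * (\<bar>?LD\<bar> + 1)" using \<delta> C by (intro mult_left_mono) auto
    ultimately show ?thesis by (simp add: ac_simps)
  qed
  moreover have "C * (\<bar>?LD\<bar> + 1) > 0" using C(1) by simp
  moreover have "min \<delta>1 \<delta>s > 0" using C(2) assms(7) by simp
  ultimately show ?thesis by (intro exI[of _ "C * (\<bar>?LD\<bar> + 1)"] conjI exI[of _ "min \<delta>1 \<delta>s"]) auto
qed

end
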